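(* Let $\mathcal{C}$ be a clutter with vertex set $\{x_1,\ldots,x_n\}$, let $R=K[x_1,\ldots,x_n]$ be a polynomial ring over a field $K$, and let $I=I(\mathcal{C})\subset R$ be the edge ideal of $\mathcal{C}$. If $\mathcal{C}$ is unmixed and satisfies the max-flow min-cut property, then (a) $\operatorname{depth}(R/I^k)\geq\operatorname{depth}(R/I^{k+1})$ for all $k\geq 1$, and (b) $\operatorname{reg}(R/I^k)\leq\operatorname{reg}(R/I^{k+1})$ for all $k\geq 1$.
   Context: A clutter $\mathcal{C}$ with vertex set $X=\{x_1,\ldots,x_n\}$ is a family of subsets of $X$, called edges, none of which is included in another; clutters are taken to have at least one edge, and all edges to be nonempty. The edge ideal $I(\mathcal{C})$ is generated by the monomials $x_e=\prod_{x_i\in e}x_i$, $e$ an edge of $\mathcal{C}$. A vertex cover of $\mathcal{C}$ is a subset of $X$ meeting every edge; it is minimal if it is minimal under inclusion. $\mathcal{C}$ is unmixed if all its minimal vertex covers have the same cardinality. The incidence matrix $A$ of $\mathcal{C}$ is the $n\times r$ matrix whose columns are the exponent vectors (0-1 characteristic vectors) of the $r$ minimal generators $x_e$ of $I(\mathcal{C})$. $\mathcal{C}$ has the max-flow min-cut property if, for each nonnegative integral vector $\alpha\in\mathbb{N}^n$, both sides of the LP-duality equation $$\min\{\langle\alpha,x\rangle\mid x\in\mathbb{R}^n,\ x\geq 0,\ xA\geq\mathbf{1}\}=\max\{\langle y,\mathbf{1}\rangle\mid y\in\mathbb{R}^r,\ y\geq 0,\ Ay\leq\alpha\}$$ have integral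 optimum solutions $x,y$, where $\mathbf{1}=(1,\ldots,1)$. $\operatorname{reg}$ is Castelnuovo--Mumford regularity, and depth is with respect to the graded maximal ideal. *)

theory Defs
  imports
    Complex_Main
    "HOL-Library.Poly_Mapping"
    "HOL-Library.Extended_Nat"
    "HOL-Library.Extended_Real"
    "Jordan_Normal_Form.Matrix_Kernel"
begin

section \<open>Clutters\<close>

text \<open>
  The vertex set is the whole finite type \<open>'x\<close>; in particular vertices lying in no edge are
  allowed. A clutter is given by its set of edges.
\<close>

definition clutter :: "'x::finite set set \<Rightarrow> bool" where
  "clutter E \<longleftrightarrow> E \<noteq> {} \<and> {} \<notin> E \<and> (\<forall>e\<in>E. \<forall>f\<in>E. e \<subseteq> f \<longrightarrow> e = f)"

definition vertex_cover :: "'x::finite set set \<Rightarrow> 'x set \<Rightarrow> bool" where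
  "vertex_cover E C \<longleftrightarrow> (\<forall>e\<in>E. C \<inter> e \<noteq> {})"

definition minimal_vertex_cover :: "'x::finite set set \<Rightarrow> 'x set \<Rightarrow> bool" where
  "minimal_vertex_cover E C \<longleftrightarrow> vertex_cover E C \<and> (\<forall>D. D \<subset> C \<longrightarrow> \<not> vertex_cover E D)"

definition unmixed :: "'x::finite set set \<Rightarrow> bool" where
  "unmixed E \<longleftrightarrow>
     (\<forall>C D. minimal_vertex_cover E C \<longrightarrow> minimal_vertex_cover E D \<longrightarrow> card C = card D)"

text \<open>
  Columns of the incidence matrix are indexed by the edges themselves, so vectors in
  $\mathbb{R}^r$ are functions on edges, of which only the values on \<open>E\<close> matter.
\<close>

definition incidence :: "'x::finite \<Rightarrow> 'x set \<Rightarrow> real" where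
  "incidence v e = (if v \<in> e then 1 else 0)"

definition primal_feasible :: "'x::finite set set \<Rightarrow> ('x \<Rightarrow> real) \<Rightarrow> bool" where
  "primal_feasible E x \<longleftrightarrow>
     (\<forall>v. x v \<ge> 0) \<and> (\<forall>e\<in>E. (\<Sum>v\<in>UNIV. x v * incidence v e) \<ge> 1)"

definition dual_feasible :: "'x::finite set set \<Rightarrow> ('x \<Rightarrow> nat) \<Rightarrow> ('x set \<Rightarrow> real) \<Rightarrow> bool" where
  "dual_feasible E \<alpha> y \<longleftrightarrow>
     (\<forall>e\<in>E. y e \<ge> 0) \<and> (\<forall>v. (\<Sum>e\<in>E. incidence v e * y e) \<le> real (\<alpha> v))"

definition primal_optimal :: "'x::finite set set \<Rightarrow> ('x \<Rightarrow> nat) \<Rightarrow> ('x \<Rightarrow> real) \<Rightarrow> bool" where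
  "primal_optimal E \<alpha> x \<longleftrightarrow> primal_feasible E x \<and>
     (\<forall>x'. primal_feasible E x' \<longrightarrow>
        (\<Sum>v\<in>UNIV. real (\<alpha> v) * x v) \<le> (\<Sum>v\<in>UNIV. real (\<alpha> v) * x' v))"

definition dual_optimal :: "'x::finite set set \<Rightarrow> ('x \<Rightarrow> nat) \<Rightarrow> ('x set \<Rightarrow> real) \<Rightarrow> bool" where
  "dual_optimal E \<alpha> y \<longleftrightarrow> dual_feasible E \<alpha> y \<and>
     (\<forall>y'. dual_feasible E \<alpha> y' \<longrightarrow> (\<Sum>e\<in>E. y' e) \<le> (\<Sum>e\<in>E. y e))"

text \<open>
  The equality of the two optimal values is LP duality and is therefore not part of the
  definition.
\<close>

definition max_flow_min_cut :: "'x::finite set set \<Rightarrow> bool" where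
  "max_flow_min_cut E \<longleftrightarrow>
     (\<forall>\<alpha>. (\<exists>x. primal_optimal E \<alpha> x \<and> (\<forall>v. x v \<in> \<int>)) \<and>
          (\<exists>y. dual_optimal E \<alpha> y \<and> (\<forall>e\<in>E. y e \<in> \<int>)))"


section \<open>Ideals in polynomial rings\<close>

text \<open>
  A polynomial maps exponent vectors in \<open>'x \<Rightarrow>\<^sub>0 nat\<close> to coefficients; multiplication is the
  convolution product of \<open>HOL-Library.Poly_Mapping\<close>.
\<close>

type_synonym ('x, 'k) mpoly = "('x \<Rightarrow>\<^sub>0 nat) \<Rightarrow>\<^sub>0 'k"

definition ideal_gen :: "'r::comm_ring_1 set \<Rightarrow> 'r set" where
  "ideal_gen S = Modules.module.span (*) S"

definition ideal_pow :: "'r::comm_ring_1 set \<Rightarrow> nat \<Rightarrow> 'r set" where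
  "ideal_pow J k = ideal_gen {\<Prod>i<k. f i | f. \<forall>i<k. f i \<in> J}"

definition var :: "'x \<Rightarrow> ('x, 'k::field) mpoly" where
  "var v = Poly_Mapping.single (Poly_Mapping.single v 1) 1"

definition max_ideal :: "('x::finite, 'k::field) mpoly set" where
  "max_ideal = ideal_gen (range var)"

definition edge_ideal :: "'x::finite set set \<Rightarrow> ('x, 'k::field) mpoly set" where
  "edge_ideal E = ideal_gen ((\<lambda>e. \<Prod>v\<in>e. var v) ` E)"


section \<open>Depth\<close>

text \<open>
  Regular sequences on the module $R/J$: since
  $(R/J)/(f_1,\ldots,f_{i})(R/J) = R/(J + (f_1,\ldots,f_{i}))$, the element $f_{i+1}$ is a
  nonzerodivisor on this quotient iff $f_{i+1} g \in J + (f_1,\ldots,f_{i})$ implies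
  $g \in J + (f_1,\ldots,f_{i})$.
\<close>

definition quot_regular_seq :: "'r::comm_ring_1 set \<Rightarrow> 'r list \<Rightarrow> bool" where
  "quot_regular_seq J fs \<longleftrightarrow>
     (\<forall>i<length fs. \<forall>g. fs ! i * g \<in> ideal_gen (J \<union> set (take i fs)) \<longrightarrow>
                         g \<in> ideal_gen (J \<union> set (take i fs))) \<and>
     ideal_gen (J \<union> set fs) \<noteq> UNIV"

text \<open>\<open>quot_depth J\<close> is $\mathrm{depth}(R/J)$ with respect to the graded maximal ideal.\<close>

definition quot_depth :: "('x::finite, 'k::field) mpoly set \<Rightarrow> enat" where
  "quot_depth J = (SUP fs \<in> {fs. set fs \<subseteq> max_ideal \<and> quot_regular_seq J fs}. enat (length fs))"


section \<open>Minimal graded free resolutions and regularity\<close>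

definition mdeg :: "('x::finite \<Rightarrow>\<^sub>0 nat) \<Rightarrow> nat" where
  "mdeg m = (\<Sum>v\<in>UNIV. Poly_Mapping.lookup m v)"

definition homogeneous :: "nat \<Rightarrow> ('x::finite, 'k::field) mpoly \<Rightarrow> bool" where
  "homogeneous t p \<longleftrightarrow> (\<forall>m\<in>Poly_Mapping.keys p. mdeg m = t)"

text \<open>
  A minimal graded free resolution
  $\cdots \to F_2 \to F_1 \to F_0 = R \to R/J \to 0$ of the quotient by a proper homogeneous
  ideal $J$, where $F_i = \bigoplus_{b < r_i} R(-d_{i,b})$. The map $F_{i+1} \to F_i$ is the
  matrix \<open>\<phi> i\<close>. It is homogeneous of degree $0$, i.e. its $(a,b)$ entry is homogeneous of degree
  $d_{i+1,b} - d_{i,a}$ (and zero if this is negative), and minimality says that the image of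
  each map lies in $\mathfrak{m} F_i$.
\<close>

definition minimal_graded_free_resolution ::
  "('x::finite, 'k::field) mpoly set \<Rightarrow> (nat \<Rightarrow> nat) \<Rightarrow> (nat \<Rightarrow> nat \<Rightarrow> nat) \<Rightarrow>
     (nat \<Rightarrow> ('x, 'k) mpoly mat) \<Rightarrow> bool" where
  "minimal_graded_free_resolution J r d \<phi> \<longleftrightarrow>
     r 0 = 1 \<and> d 0 0 = 0 \<and>
     (\<forall>i. \<phi> i \<in> carrier_mat (r i) (r (Suc i))) \<and>
     (\<forall>i. \<forall>a<r i. \<forall>b<r (Suc i).
        (if d i a \<le> d (Suc i) b then homogeneous (d (Suc i) b - d i a) (\<phi> i $$ (a, b))
         else \<phi> i $$ (a, b) = 0)) \<and>
     (\<forall>i. \<forall>a<r i. \<forall>b<r (Suc i). \<phi> i $$ (a, b) \<in> max_ideal) \<and>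
     (\<lambda>w. \<phi> 0 *\<^sub>v w) ` carrier_vec (r 1) = {u \<in> carrier_vec 1. u $ 0 \<in> J} \<and>
     (\<forall>i. (\<lambda>w. \<phi> (Suc i) *\<^sub>v w) ` carrier_vec (r (Suc (Suc i))) = mat_kernel (\<phi> i))"

text \<open>
  The graded Betti number $b_{i,j}$ of $R/J$: the number of summands $R(-j)$ in $F_i$, where $F$
  is a minimal graded free resolution (unique up to isomorphism).
\<close>

definition quot_betti :: "('x::finite, 'k::field) mpoly set \<Rightarrow> nat \<Rightarrow> nat \<Rightarrow> nat" where
  "quot_betti J i j =
     (let (r, d, \<phi>) = (SOME (r, d, \<phi>). minimal_graded_free_resolution J r d \<phi>)
      in card {b. b < r i \<and> d i b = j})"

text \<open>
  \<open>quot_reg J\<close> is $\mathrm{reg}(R/J) = \max \{j - i \mid b_{i,j} \neq 0\}$. The supremum is taken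
  in \<open>ereal\<close> so that the definition does not presuppose that the set is finite.
\<close>

definition quot_reg :: "('x::finite, 'k::field) mpoly set \<Rightarrow> ereal" where
  "quot_reg J = (SUP (i, j) \<in> {(i, j). quot_betti J i j \<noteq> 0}. ereal (real j - real i))"

end

theory Submission
  imports
    Defs
    "HOL-Library.Function_Algebras"
    "HOL-Computational_Algebra.Primes"
    "HOL-Analysis.Polytope"
begin

text \<open>
  The reason is that one edge \<open>e\<close> satisfies $I^{k+1} : x_e = I^k$ for all $k$, and that taking the
  colon of a monomial ideal by a monomial neither lowers the depth nor raises the regularity of the
  quotient ring.

  The edge comes from the min-max equality, which linear programming duality turns into a statement
  about integers: for every weight on the vertices there are a packing of edges and a vertex cover
  of the same total weight (\<open>max_flow_min_cut_packing_cover\<close>). For the constant weight $1$ the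
  packing has as many edges as a smallest cover has vertices. Unmixedness gives every minimal cover
  this size, so each of them has exactly one vertex in each packed edge
  (\<open>ex_edge_meeting_minimal_covers_once\<close>). Let \<open>e\<close> be such an edge. If $x^m x_e \in I^{k+1}$, then every
  minimal cover carries weight at least $k+1$ under the exponent of $x^m x_e$, hence at least $k$
  under \<open>m\<close>; by the min-max equality there are $k$ edges whose product divides $x^m$
  (\<open>power_exponents_colon\<close>).

  Depth and regularity are both read off the Koszul homology $H_i$ of $R/J$ with respect to the
  variables. The depth is at least \<open>d\<close> iff $H_i = 0$ for $i > n - d$
  (\<open>regular_imp_koszul_vanish\<close>, \<open>koszul_vanish_imp_regular\<close>), and $b_{i,j} \neq 0$ iff $H_i$ is nonzero in
  degree \<open>j\<close> (\<open>quot_betti_nonzero_iff\<close>). For a monomial ideal \<open>J\<close> the Koszul complex splits into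
  multigraded pieces, each of them a finite complex of \<open>K\<close>-vector spaces that only depends on which
  monomials lie in \<open>J\<close>. In these terms the colon by a variable is easy to follow: if $H_i$ of
  $R/(J : x_v)$ is nonzero in multidegree \<open>a\<close>, then $H_i$ of $R/J$ is nonzero in multidegree \<open>a\<close> or
  $a + \varepsilon_v$ (\<open>koszul_nonzero_colon_var\<close>). The homological degree is unchanged and the total degree
  does not drop, which gives both parts of the theorem at once.

  The translation for depth uses that an ideal consisting of zero divisors modulo \<open>J\<close> is annihilated by
  a single nonzero class (prime avoidance); the one for Betti numbers uses that minimal graded free
  resolutions exist. Both rest on the Hilbert basis theorem.
\<close>

abbreviation "lookup \<equiv> Poly_Mapping.lookup"
abbreviation "keys \<equiv> Poly_Mapping.keys"
abbreviation "single \<equiv> Poly_Mapping.single"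

section \<open>Exterior signs and the Koszul differential\<close>

text \<open>
  The exponent vector of the squarefree monomial $\prod_{v \in F} x_v$.
\<close>

definition mchi :: "'x::finite set \<Rightarrow> ('x \<Rightarrow>\<^sub>0 nat)" where
  "mchi F = Abs_poly_mapping (\<lambda>v. if v \<in> F then 1 else 0)"

lemma lookup_mchi [simp]: "lookup (mchi F) v = (if v \<in> F then 1 else 0)"
  unfolding mchi_def by (subst lookup_Abs_poly_mapping) auto

text \<open>
  The sign of moving \<open>v\<close> to its place among the elements of \<open>F\<close>; the injection \<open>to_nat\<close> supplies the
  linear order on the vertices that fixes the signs of the exterior algebra.
\<close>

definition ksign :: "'x::finite \<Rightarrow> 'x set \<Rightarrow> 'r::comm_ring_1" where
  "ksign v F = (-1) ^ card {u \<in> F. to_nat u < to_nat v}"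

lemma ksign_square [simp]: "ksign v F * ksign v F = (1::'r::comm_ring_1)"
  unfolding ksign_def by (simp flip: power_add)

lemma ksign_square' [simp]: "ksign v F * (ksign v F * y) = (y::'r::comm_ring_1)"
  by (simp flip: mult.assoc)

lemma ksign_insert:
  assumes "u \<notin> F"
  shows "ksign v (insert u F) = (if to_nat u < to_nat v then - ksign v F else ksign v F :: 'r::comm_ring_1)"
proof -
  have "{w \<in> insert u F. to_nat w < to_nat v} =
     (if to_nat u < to_nat v then insert u {w \<in> F. to_nat w < to_nat v} else {w \<in> F. to_nat w < to_nat v})"
    by auto
  then show ?thesis using assms by (simp add: ksign_def)
qed

lemma ksign_swap:
  assumes "u \<notin> F" "v \<notin> F" "u \<noteq> v"
  shows "ksign u (insert v F) * ksign v F = - (ksign v (insert u F) * ksign u F :: 'r::comm_ring_1)"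
proof -
  have "to_nat u \<noteq> to_nat v" using assms(3) by (simp add: inj_eq)
  then show ?thesis using assms by (auto simp: ksign_insert mult.commute)
qed

text \<open>
  The Koszul differential. A chain is a function \<open>z\<close> on vertex sets, \<open>z F\<close> being the coefficient of the
  basis element $e_F$ of the exterior algebra. The weights \<open>x\<close> are the variables for the Koszul complex
  over the polynomial ring, and all equal to \<open>1\<close> in a piece of fixed multidegree, where multiplying by
  a variable only shifts the monomial.
\<close>

definition kbd :: "('x::finite \<Rightarrow> 'r::comm_ring_1) \<Rightarrow> ('x set \<Rightarrow> 'r) \<Rightarrow> 'x set \<Rightarrow> 'r" where
  "kbd x z G = (\<Sum>v\<in>-G. ksign v G * x v * z (insert v G))"

abbreviation (input) "kbd1 \<equiv> kbd (\<lambda>_. 1)"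

text \<open>
  Exterior multiplication by the basis vector $e_v$.
\<close>

definition wedge :: "'x::finite \<Rightarrow> ('x set \<Rightarrow> 'r::comm_ring_1) \<Rightarrow> 'x set \<Rightarrow> 'r" where
  "wedge v z F = (if v \<in> F then ksign v (F - {v}) * z (F - {v}) else 0)"

lemma ksign_swap':
  assumes "u \<notin> F" "v \<notin> F" "u \<noteq> v"
  shows "ksign u (insert v F) * ksign v (insert u F) = - (ksign v F * ksign u F :: 'r::comm_ring_1)"
proof -
  have "ksign u (insert v F) * ksign v (insert u F) =
     (ksign u (insert v F) * ksign v F) * (ksign v F * ksign v (insert u F) :: 'r)"
    by (simp add: mult.assoc)
  also have "\<dots> = - (ksign v F * ksign u F)"
    unfolding ksign_swap[OF assms] by (simp add: mult_ac)
  finally show ?thesis .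
qed

text \<open>
  Multiplication by \<open>x v\<close> is null-homotopic, with homotopy $e_v \wedge$. Acyclicity
  of the Koszul complex and its behaviour under regular elements rest on this identity.
\<close>

lemma kbd_wedge:
  fixes z :: "'x::finite set \<Rightarrow> 'r::comm_ring_1"
  shows "kbd x (wedge v z) F + wedge v (kbd x z) F = x v * z F"
proof (cases "v \<in> F")
  case False
  have "kbd x (wedge v z) F = (\<Sum>u\<in>-F. if u = v then x v * z F else 0)"
    unfolding kbd_def
    using False by (intro sum.cong) (auto simp: wedge_def algebra_simps)
  then show ?thesis using False by (simp add: wedge_def)
next
  case True
  define G where "G = F - {v}"
  have F: "F = insert v G" "v \<notin> G" using True by (auto simp: G_def)
  have eq: "- G = insert v (- F)" "v \<notin> - F" using F by auto
  have "kbd x (wedge v z) F = (\<Sum>u\<in>-F. - (ksign v G * (ksign u G * x u * z (insert u G))))"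
    unfolding kbd_def
  proof (rule sum.cong)
    fix u assume u: "u \<in> - F"
    have d: "insert u F - {v} = insert u G" using u F by auto
    have "ksign u F * x u * wedge v z (insert u F) = (ksign u (insert v G) * ksign v (insert u G)) * x u * z (insert u G)"
      using d u F by (simp add: wedge_def algebra_simps)
    also have "ksign u (insert v G) * ksign v (insert u G) = - (ksign v G * ksign u G :: 'r)"
      using u F by (intro ksign_swap') auto
    finally show "ksign u F * x u * wedge v z (insert u F) = - (ksign v G * (ksign u G * x u * z (insert u G)))"
      by (simp add: algebra_simps)
  qed simp
  moreover have "wedge v (kbd x z) F = ksign v G * (\<Sum>u\<in>-G. ksign u G * x u * z (insert u G))"
    using True by (simp add: wedge_def G_def kbd_def)
  moreover have "\<dots> = ksign v G * (ksign v G * x v * z F) + ksign v G * (\<Sum>u\<in>-F. ksign u G * x u * z (insert u G))"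
    unfolding eq(1) by (subst sum.insert) (use eq F in \<open>auto simp: algebra_simps\<close>)
  ultimately show ?thesis
    by (simp add: sum_negf sum_distrib_left mult.assoc)
qed

text \<open>
  Contraction against $e_v$: the factor of $e_v$ in the part of \<open>z\<close> that involves $e_v$.
\<close>

definition contract :: "'x::finite \<Rightarrow> ('x set \<Rightarrow> 'r::comm_ring_1) \<Rightarrow> 'x set \<Rightarrow> 'r" where
  "contract v z G = (if v \<in> G then 0 else ksign v G * z (insert v G))"

text \<open>
  Since the differential is itself a combination of contractions, it anticommutes with each of them.
\<close>

lemma kbd_contract:
  fixes z :: "'x::finite set \<Rightarrow> 'r::comm_ring_1"
  assumes "v \<notin> G"
  shows "kbd x (contract v z) G = - (ksign v G * kbd x z (insert v G))"
proof -
  have "kbd x (contract v z) G = (\<Sum>u\<in>-insert v G. ksign u G * x u * contract v z (insert u G))"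
    unfolding kbd_def by (rule sum.mono_neutral_right) (auto simp: contract_def)
  also have "\<dots> = (\<Sum>u\<in>-insert v G. - (ksign v G * (ksign u (insert v G) * x u * z (insert u (insert v G)))))"
  proof (rule sum.cong)
    fix u assume u: "u \<in> - insert v G"
    have "ksign u G * ksign v (insert u G) = - (ksign v G * ksign u (insert v G) :: 'r)"
      using ksign_swap[of v G u, where 'r='r] assms u by (auto simp: mult.commute)
    then have "ksign u G * ksign v (insert u G) * x u * z (insert v (insert u G)) =
      - (ksign v G * ksign u (insert v G)) * x u * z (insert v (insert u G))" by simp
    then show "ksign u G * x u * contract v z (insert u G) = - (ksign v G * (ksign u (insert v G) * x u * z (insert u (insert v G))))"
      using u assms by (auto simp: contract_def algebra_simps insert_commute)
  qed simp
  finally show ?thesis by (simp add: kbd_def sum_distrib_left sum_negf)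
qed

lemma kbd_kbd:
  fixes z :: "'x::finite set \<Rightarrow> 'r::comm_ring_1"
  shows "kbd x (kbd x z) G = 0"
proof -
  define f where "f v u = ksign v G * x v * (ksign u (insert v G) * x u * z (insert u (insert v G)))" for v u
  have as: "f u v = - f v u" if "u \<notin> G" "v \<notin> G" "u \<noteq> v" for u v
  proof -
    have "ksign v (insert u G) * ksign u G = - (ksign u (insert v G) * ksign v G :: 'r)"
      using ksign_swap[of v G u] that by simp
    then have "(ksign v (insert u G) * ksign u G) * (x u * x v * z (insert u (insert v G))) =
       - (ksign u (insert v G) * ksign v G) * (x u * x v * z (insert u (insert v G)))" by simp
    then show ?thesis by (simp add: f_def algebra_simps insert_commute)
  qed
  define P where "P = {(v, u). v \<notin> G \<and> u \<notin> G \<and> to_nat v < to_nat u}"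
  define P' where "P' = {(v, u). v \<notin> G \<and> u \<notin> G \<and> to_nat u < to_nat v}"
  have "kbd x (kbd x z) G = (\<Sum>v\<in>-G. \<Sum>u\<in>-insert v G. f v u)"
    by (simp add: kbd_def f_def sum_distrib_left)
  also have "\<dots> = (\<Sum>(v,u)\<in>(SIGMA v:-G. -insert v G). f v u)"
    by (simp add: sum.Sigma)
  also have "(SIGMA v:-G. -insert v G) = P \<union> P'"
    by (auto simp: P_def P'_def) (metis linorder_neqE_nat to_nat_split inj_to_nat injD)
  also have "(\<Sum>(v,u)\<in>P \<union> P'. f v u) = (\<Sum>(v,u)\<in>P. f v u) + (\<Sum>(v,u)\<in>P'. f v u)"
    by (rule sum.union_disjoint) (auto simp: P_def P'_def)
  also have "(\<Sum>(v,u)\<in>P'. f v u) = (\<Sum>(v,u)\<in>P. f u v)"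
    by (rule sum.reindex_bij_witness[of _ prod.swap prod.swap]) (auto simp: P_def P'_def)
  also have "\<dots> = (\<Sum>(v,u)\<in>P. - f v u)"
    by (rule sum.cong) (auto simp: P_def intro!: as)
  finally show ?thesis by (simp add: sum_negf case_prod_unfold)
qed

lemma kbd_add: "kbd x (\<lambda>F. z F + w F) G = kbd x z G + kbd x w G"
  by (simp add: kbd_def algebra_simps sum.distrib)

lemma kbd_diff: "kbd x (\<lambda>F. z F - w F) G = kbd x z G - kbd x w G"
  by (simp add: kbd_def algebra_simps sum_subtractf)

lemma kbd_scale: "kbd x (\<lambda>F. f * z F) G = f * kbd x z G"
  by (simp add: kbd_def sum_distrib_left algebra_simps)

lemma kbd_sum: "kbd x (\<lambda>F. \<Sum>i\<in>A. z i F) G = (\<Sum>i\<in>A. kbd x (z i) G)"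
  by (induction A rule: infinite_finite_induct) (simp_all add: kbd_add, auto simp: kbd_def)

lemma kbd_restrict_card:
  "kbd x (\<lambda>F. if card F = p then z F else 0) G = (if Suc (card G) = p then kbd x z G else 0)"
proof -
  have "kbd x (\<lambda>F. if card F = p then z F else 0) G =
     (\<Sum>v\<in>-G. if Suc (card G) = p then ksign v G * x v * z (insert v G) else 0)"
    unfolding kbd_def by (rule sum.cong) auto
  then show ?thesis by (simp add: kbd_def)
qed

text \<open>
  Chains concentrated in homological degree \<open>p\<close>.
\<close>

definition kchain :: "nat \<Rightarrow> ('x::finite set \<Rightarrow> 'r::comm_ring_1) \<Rightarrow> bool" where
  "kchain p z \<longleftrightarrow> (\<forall>F. z F \<noteq> 0 \<longrightarrow> card F = p)"

abbreviation (input) "supported a c \<equiv> \<forall>F. c F \<noteq> 0 \<longrightarrow> F \<subseteq> keys a"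

text \<open>
  Let \<open>J\<close> be the ideal spanned by the monomials with exponents in \<open>U\<close>. The predicate says that the
  Koszul homology $H_i$ of $R/J$ is nonzero in multidegree \<open>a\<close>. In this multidegree the coefficient of
  $e_F$ is a scalar multiple of $x^{a - F}$, so only sets \<open>F\<close> inside the support of \<open>a\<close> occur, and
  the coefficient vanishes in $R/J$ exactly if \<open>a - mchi F \<in> U\<close>.
\<close>

definition koszul_nonzero :: "'k::comm_ring_1 itself \<Rightarrow> ('x::finite \<Rightarrow>\<^sub>0 nat) set \<Rightarrow> nat \<Rightarrow> ('x \<Rightarrow>\<^sub>0 nat) \<Rightarrow> bool" where
  "koszul_nonzero _ U i a \<longleftrightarrow> (\<exists>c::'x set \<Rightarrow> 'k. supported a c \<and> kchain i c \<and>
     (\<forall>G. kbd1 c G \<noteq> 0 \<longrightarrow> a - mchi G \<in> U) \<and>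
     \<not> (\<exists>w. supported a w \<and> (\<forall>F. c F \<noteq> kbd1 w F \<longrightarrow> a - mchi F \<in> U)))"

definition upset :: "('x::finite \<Rightarrow>\<^sub>0 nat) set \<Rightarrow> bool" where
  "upset U \<longleftrightarrow> (\<forall>m\<in>U. \<forall>m'. m + m' \<in> U)"

lemma kbd_subset:
  assumes "\<forall>F. c F \<noteq> 0 \<longrightarrow> F \<subseteq> X" "kbd x c G \<noteq> 0"
  shows "G \<subseteq> X"
proof -
  obtain v where "v \<in> -G" "ksign v G * x v * c (insert v G) \<noteq> 0"
    using assms(2) unfolding kbd_def by (meson sum.neutral)
  then have "c (insert v G) \<noteq> 0" by auto
  with assms(1) show ?thesis by auto
qed

lemma koszul_zero_E:
  assumes "\<not> koszul_nonzero TYPE('k::comm_ring_1) U i a" "\<forall>F. c F \<noteq> (0::'k) \<longrightarrow> F \<subseteq> keys a" "kchain i c"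
    "\<forall>G. kbd1 c G \<noteq> 0 \<longrightarrow> a - mchi G \<in> U"
  obtains w where "supported a w" "\<forall>F. c F \<noteq> kbd1 w F \<longrightarrow> a - mchi F \<in> U"
proof -
  have "\<exists>w. supported a w \<and> (\<forall>F. c F \<noteq> kbd1 w F \<longrightarrow> a - mchi F \<in> U)"
  proof (rule ccontr)
    assume n: "\<not> ?thesis"
    have "koszul_nonzero TYPE('k) U i a"
      unfolding koszul_nonzero_def by (rule exI[of _ c], intro conjI assms(2-4) n)
    with assms(1) show False by contradiction
  qed
  then show ?thesis by (elim exE conjE) (rule that)
qed

text \<open>
  A cycle for $J : x_v$ in multidegree \<open>a\<close>, multiplied by $x_v$, is a cycle for \<open>J\<close> in multidegree
  $a + \varepsilon_v$ with the same coefficients. If it bounds there, either the bounding chain is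
  divisible by $x_v$, and then the original cycle was a boundary, or its contraction against $e_v$ is
  a nonbounding cycle for \<open>J\<close> in multidegree \<open>a\<close>.
\<close>

lemma koszul_nonzero_colon_var:
  fixes U :: "('x::finite \<Rightarrow>\<^sub>0 nat) set"
  assumes U: "upset U" and nv: "koszul_nonzero TYPE('k::comm_ring_1) {m. m + single v 1 \<in> U} i a"
  shows "koszul_nonzero TYPE('k) U i a \<or> koszul_nonzero TYPE('k) U i (a + single v 1)"
proof -
  define ev where "ev = (single v 1 :: 'x \<Rightarrow>\<^sub>0 nat)"
  from nv obtain c :: "'x set \<Rightarrow> 'k" where c: "supported a c" "kchain i c"
     and c0: "\<forall>G. kbd1 c G \<noteq> 0 \<longrightarrow> a - mchi G + ev \<in> U"
     and nob0: "\<not> (\<exists>w. supported a w \<and> (\<forall>F. c F \<noteq> kbd1 w F \<longrightarrow> a - mchi F + ev \<in> U))"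
    unfolding koszul_nonzero_def ev_def[symmetric] mem_Collect_eq by (elim exE conjE)
  have shift: "a + ev - mchi F = a - mchi F + ev" if "F \<subseteq> keys a" for F
    using that
    by (intro poly_mapping_eqI) (auto simp: lookup_add lookup_minus ev_def lookup_single when_def in_keys_iff subset_iff)
  have keys_ev: "keys (a + ev) = insert v (keys a)"
    by (auto simp: in_keys_iff lookup_add ev_def lookup_single when_def split: if_splits)
  note ksub = kbd_subset[OF c(1)]
  have c3: "a + ev - mchi G \<in> U" if "kbd1 c G \<noteq> 0" for G
    using c0 that shift ksub[OF that] by simp
  have up: "m + m' \<in> U" if "m \<in> U" for m m' using U that by (auto simp: upset_def)
  show ?thesis
  proof (rule ccontr)
    assume neg: "\<not> ?thesis"
    then have nn: "\<not> koszul_nonzero TYPE('k) U i (a + ev)" by (simp add: ev_def)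
    have k1: "\<forall>F. c F \<noteq> 0 \<longrightarrow> F \<subseteq> keys (a + ev)" using c(1) keys_ev by blast
    have k2: "\<forall>G. kbd1 c G \<noteq> 0 \<longrightarrow> a + ev - mchi G \<in> U" using c3 by blast
    obtain w where w: "\<forall>F. w F \<noteq> 0 \<longrightarrow> F \<subseteq> insert v (keys a)"
       and w2: "\<forall>F. c F \<noteq> kbd1 w F \<longrightarrow> a + ev - mchi F \<in> U"
      using koszul_zero_E[OF nn k1 c(2) k2] unfolding keys_ev by blast
    note wsub = kbd_subset[OF w]
    show False
    proof (cases "v \<in> keys a")
      case True
      then have ins: "insert v (keys a) = keys a" by auto
      have "a - mchi F + ev \<in> U" if "c F \<noteq> kbd1 w F" for F
      proof -
        have "F \<subseteq> keys a"
          using that c(1)[rule_format, of F] wsub[of "\<lambda>_. 1" F, unfolded ins] by (cases "c F = 0") auto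
        then show ?thesis using w2[rule_format, OF that] shift by simp
      qed
      then show False using nob0 w unfolding ins by blast
    next
      case False
      \<comment> \<open>Split \<open>w\<close> as \<open>w'\<close> plus the exterior product of \<open>v\<close> with \<open>w1\<close>. If \<open>s\<close> bounds \<open>w1\<close>, then \<open>w' + s\<close>
        bounds \<open>c\<close>.\<close>
      define w' where "w' F = (if v \<in> F then 0 else w F)" for F
      define w1 where "w1 = contract v w"
      have w1_sub: "supported a w1"
      proof (intro allI impI)
        fix F assume "w1 F \<noteq> 0"
        then have "v \<notin> F" "w (insert v F) \<noteq> 0" by (auto simp: w1_def contract_def split: if_splits)
        with w have "insert v F \<subseteq> insert v (keys a)" by blast
        with \<open>v \<notin> F\<close> show "F \<subseteq> keys a" by blast
      qed
      have split: "kbd1 w G = kbd1 w' G + w1 G" if "v \<notin> G" for G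
      proof -
        have "kbd1 w G = w1 G + (\<Sum>u\<in>-G-{v}. ksign u G * w (insert u G))"
          unfolding kbd_def using that
          by (subst sum.remove[of _ v]) (auto simp: w1_def contract_def)
        also have "(\<Sum>u\<in>-G-{v}. ksign u G * w (insert u G)) = (\<Sum>u\<in>-G. ksign u G * w' (insert u G))"
          by (rule sum.mono_neutral_cong_left) (use that in \<open>auto simp: w'_def\<close>)
        finally show ?thesis by (simp add: kbd_def)
      qed
      have w1_cyc: "a - mchi G \<in> U" if nz: "kbd1 w1 G \<noteq> 0" for G
      proof -
        have "G \<subseteq> keys a" using kbd_subset[OF w1_sub nz] .
        then have vG: "v \<notin> G" using False by auto
        then have "kbd1 w (insert v G) \<noteq> 0"
          using nz kbd_contract[OF vG, of "\<lambda>_. 1" w] unfolding w1_def by auto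
        moreover have "c (insert v G) = 0" using c(1) False by auto
        ultimately have "a + ev - mchi (insert v G) \<in> U" using w2[rule_format, of "insert v G"] by simp
        moreover have "a + ev - mchi (insert v G) = a - mchi G"
          using False vG
          by (intro poly_mapping_eqI) (auto simp: lookup_add lookup_minus ev_def lookup_single when_def in_keys_iff)
        ultimately show ?thesis by simp
      qed
      define w1' where "w1' F = (if card F = i then w1 F else 0)" for F
      have w1'_sub: "supported a w1'" using w1_sub by (auto simp: w1'_def)
      have w1'_ch: "kchain i w1'" by (auto simp: kchain_def w1'_def)
      have w1'_bd: "kbd1 w1' G = (if Suc (card G) = i then kbd1 w1 G else 0)" for G
        unfolding w1'_def by (rule kbd_restrict_card)
      have w1'_cyc: "\<forall>G. kbd1 w1' G \<noteq> 0 \<longrightarrow> a - mchi G \<in> U"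
        using w1_cyc by (simp add: w1'_bd)
      have "\<not> koszul_nonzero TYPE('k) U i a" using neg by simp
      then obtain s where s: "supported a s"
         and s2: "\<forall>F. w1' F \<noteq> kbd1 s F \<longrightarrow> a - mchi F \<in> U"
        using w1'_sub w1'_ch w1'_cyc by (rule koszul_zero_E)
      define t where "t F = (if card F = Suc i then w' F + s F else 0)" for F
      have t_bd: "kbd1 t G = (if card G = i then kbd1 w' G + kbd1 s G else 0)" for G
        unfolding t_def kbd_restrict_card by (simp add: kbd_add)
      have ws: "\<forall>F. w' F + s F \<noteq> 0 \<longrightarrow> F \<subseteq> keys a"
      proof (intro allI impI)
        fix F assume "w' F + s F \<noteq> 0"
        then consider "v \<notin> F" "w F \<noteq> 0" | "s F \<noteq> 0" by (cases "s F = 0") (auto simp: w'_def split: if_splits)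
        then show "F \<subseteq> keys a" by cases (use w s in blast)+
      qed
      have tU: "a - mchi F + ev \<in> U" if ne: "c F \<noteq> kbd1 t F" for F
      proof -
        have cF: "card F = i"
          using ne c(2) t_bd[of F] by (auto simp: kchain_def split: if_splits)
        have ne': "c F \<noteq> kbd1 w' F + kbd1 s F" using ne cF t_bd by simp
        have "F \<subseteq> keys a" using ne' c(1)[rule_format, of F] kbd_subset[OF ws, of "\<lambda>_. 1" F]
          unfolding kbd_add by (cases "c F = 0") auto
        then have vF: "v \<notin> F" using False by auto
        have "c F \<noteq> kbd1 w F \<or> w1' F \<noteq> kbd1 s F"
          using ne' split[OF vF] cF unfolding w1'_def by auto
        then have "a + ev - mchi F \<in> U \<or> a - mchi F \<in> U" using w2 s2 by blast
        then show ?thesis using shift[OF \<open>F \<subseteq> keys a\<close>] up by auto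
      qed
      have t_sub: "supported a t"
        using ws by (simp add: t_def)
      from nob0 show False by (rule notE) (intro exI[of _ t] conjI t_sub allI impI tU)
    qed
  qed
qed

section \<open>Multigraded pieces of the polynomial Koszul complex\<close>

lemma poly_mapping_sum_singles:
  "p = (\<Sum>k\<in>keys p. single k (lookup p k))"
  by (rule poly_mapping_eqI)
     (auto simp: lookup_sum lookup_single when_def in_keys_iff intro: sum.neutral)

lemma lookup_single_mult:
  fixes q :: "('x \<Rightarrow>\<^sub>0 nat) \<Rightarrow>\<^sub>0 'k::comm_ring_1"
  shows "lookup (single m c * q) (m + n) = c * lookup q n"
proof -
  have "single m c * q =
      (\<Sum>k\<in>keys q. single (m + k) (c * lookup q k))"
    by (subst (1) poly_mapping_sum_singles[of q]) (simp add: sum_distrib_left mult_single)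
  then show ?thesis
    by (simp add: lookup_sum lookup_single when_def in_keys_iff)
qed

lemma lookup_single_mult_0:
  fixes q :: "('x \<Rightarrow>\<^sub>0 nat) \<Rightarrow>\<^sub>0 'k::comm_ring_1"
  assumes "\<And>k. n \<noteq> m + k"
  shows "lookup (single m c * q) n = 0"
proof -
  have "single m c * q =
      (\<Sum>k\<in>keys q. single (m + k) (c * lookup q k))"
    by (subst (1) poly_mapping_sum_singles[of q]) (simp add: sum_distrib_left mult_single)
  then show ?thesis
    using assms[symmetric] by (simp add: lookup_sum lookup_single when_def)
qed

lemma lookup_var_mult:
  "lookup (var v * q) m =
     (if v \<in> keys m then lookup q (m - single v 1) else 0)"
proof (cases "v \<in> keys m")
  case True
  then have "m = single v 1 + (m - single v 1)"
    by (intro poly_mapping_eqI) (auto simp: lookup_add lookup_minus lookup_single when_def in_keys_iff)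
  then show ?thesis using True lookup_single_mult[of "single v 1" 1 q "m - single v 1"]
    unfolding var_def by simp
next
  case False
  have "m \<noteq> single v 1 + k" for k
  proof
    assume "m = single v 1 + k"
    then have "lookup m v = 1 + lookup k v" by (simp add: lookup_add)
    with False show False by (simp add: in_keys_iff)
  qed
  then show ?thesis using False lookup_single_mult_0[of m "single v 1" 1 q] unfolding var_def by simp
qed

text \<open>
  Lets the sign be evaluated in two coefficient rings at once.
\<close>

lemma ksign_cases:
  obtains "ksign v F = (1::'a::comm_ring_1)" "ksign v F = (1::'b::comm_ring_1)"
    | "ksign v F = (-1::'a)" "ksign v F = (-1::'b)"
proof (cases "even (card {u \<in> F. to_nat u < to_nat v})")
  case True
  then show ?thesis using that(1) by (simp add: ksign_def)
next
  case False
  then show ?thesis using that(2) by (simp add: ksign_def)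
qed

lemma lookup_ksign_mult:
  fixes p :: "('x, 'k::field) mpoly"
  shows "lookup (ksign v F * p) m = ksign v F * lookup p m"
  by (rule ksign_cases[of v F, where 'a="('x, 'k) mpoly" and 'b='k]) auto

text \<open>
  The piece of multidegree \<open>a\<close> of a polynomial Koszul chain; $e_F$ has multidegree \<open>mchi F\<close>.
\<close>

definition multideg_part :: "('x::finite \<Rightarrow>\<^sub>0 nat) \<Rightarrow> ('x set \<Rightarrow> ('x, 'k::field) mpoly) \<Rightarrow> 'x set \<Rightarrow> 'k" where
  "multideg_part a z F = (if F \<subseteq> keys a then lookup (z F) (a - mchi F) else 0)"

definition multideg_emb :: "('x::finite \<Rightarrow>\<^sub>0 nat) \<Rightarrow> ('x set \<Rightarrow> 'k::field) \<Rightarrow> 'x set \<Rightarrow> ('x, 'k) mpoly" where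
  "multideg_emb a c F = (if F \<subseteq> keys a then single (a - mchi F) (c F) else 0)"

text \<open>
  Passing to a multidegree turns the variables into the weights \<open>1\<close>.
\<close>

lemma multideg_part_kbd: "multideg_part a (kbd var z) G = kbd1 (multideg_part a z) G"
proof (cases "G \<subseteq> keys a")
  case True
  have "multideg_part a (kbd var z) G =
     (\<Sum>v\<in>-G. ksign v G * lookup (var v * z (insert v G)) (a - mchi G))"
    using True by (simp add: multideg_part_def kbd_def lookup_sum mult.assoc lookup_ksign_mult)
  also have "\<dots> = (\<Sum>v\<in>-G. ksign v G * multideg_part a z (insert v G))"
  proof (rule sum.cong)
    fix v assume v: "v \<in> - G"
    have "v \<in> keys (a - mchi G) \<longleftrightarrow> v \<in> keys a"
      using v by (simp add: in_keys_iff lookup_minus)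
    moreover have "a - mchi G - single v 1 = a - mchi (insert v G)"
      using v by (intro poly_mapping_eqI) (auto simp: lookup_minus lookup_single when_def)
    ultimately show "ksign v G * lookup (var v * z (insert v G)) (a - mchi G) =
        ksign v G * multideg_part a z (insert v G)"
      using True by (simp add: lookup_var_mult multideg_part_def)
  qed simp
  finally show ?thesis by (simp add: kbd_def)
next
  case False
  then show ?thesis by (auto simp: multideg_part_def kbd_def intro!: sum.neutral)
qed

lemma subset_keys_add_mchi: "F \<subseteq> keys (m + mchi F)"
  by (auto simp: in_keys_iff lookup_add)

lemma multideg_part_emb:
  assumes "supported a c"
  shows "multideg_part b (multideg_emb a c) = (if b = a then c else (\<lambda>_. 0))"
proof
  fix F
  have eq: "b = a" if "F \<subseteq> keys b" "F \<subseteq> keys a" "a - mchi F = b - mchi F"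
  proof (rule poly_mapping_eqI)
    fix v
    have "lookup (a - mchi F) v = lookup (b - mchi F) v" using that by simp
    then show "lookup b v = lookup a v"
      using that(1,2) by (auto simp: lookup_minus in_keys_iff subset_iff split: if_splits)
         (metis Suc_pred neq0_conv)
  qed
  show "multideg_part b (multideg_emb a c) F = (if b = a then c else (\<lambda>_. 0)) F"
    using assms[rule_format, of F] eq by (cases "c F = 0") (auto simp: multideg_part_def multideg_emb_def lookup_single when_def)
qed

lemma lookup_eq_multideg_part: "lookup (z F) m = multideg_part (m + mchi F) z F"
  by (simp add: multideg_part_def subset_keys_add_mchi)

lemma multideg_part_diff: "multideg_part a (\<lambda>F. z F - w F) F = multideg_part a z F - multideg_part a w F"
  by (simp add: multideg_part_def lookup_minus)

lemma multideg_part_sum: "multideg_part a (\<lambda>F. \<Sum>i\<in>A. z i F) F = (\<Sum>i\<in>A. multideg_part a (z i) F)"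
  by (simp add: multideg_part_def lookup_sum)

lemma multideg_part_supp: "supported a (multideg_part a z)"
  by (simp add: multideg_part_def)

lemma kbd_zero [simp]: "kbd x (\<lambda>_. 0) G = 0" by (simp add: kbd_def)

lemma kchain_mono: "kchain i z \<Longrightarrow> (\<And>F. z F = 0 \<Longrightarrow> w F = 0) \<Longrightarrow> kchain i w"
  unfolding kchain_def by blast

lemma kchain_multideg_part: "kchain i z \<Longrightarrow> kchain i (multideg_part a z)"
  by (erule kchain_mono) (simp add: multideg_part_def)

text \<open>
  A polynomial chain has only finitely many nonzero multigraded pieces, so the bounding chains of the
  pieces can be added up.
\<close>

lemma koszul_zero_imp_boundary:
  fixes z :: "'x::finite set \<Rightarrow> ('x, 'k::field) mpoly"
  assumes z: "kchain i z" "\<And>G. keys (kbd var z G) \<subseteq> U"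
    and nv: "\<And>F m. m \<in> keys (z F) \<Longrightarrow> \<not> koszul_nonzero TYPE('k) U i (m + mchi F)"
  shows "\<exists>w. \<forall>F. keys (z F - kbd var w F) \<subseteq> U"
proof -
  \<comment> \<open>the multidegrees in which \<open>z\<close> is nonzero\<close>
  define A where "A = (\<Union>F. (\<lambda>m. m + mchi F) ` keys (z F))"
  have finA: "finite A" by (auto simp: A_def)
  have "\<forall>a\<in>A. \<exists>w. supported a w \<and>
           (\<forall>F. multideg_part a z F \<noteq> kbd1 w F \<longrightarrow> a - mchi F \<in> U)"
  proof
    fix a assume "a \<in> A"
    then have "\<not> koszul_nonzero TYPE('k) U i a" using nv by (auto simp: A_def)
    moreover have "\<forall>G. kbd1 (multideg_part a z) G \<noteq> 0 \<longrightarrow> a - mchi G \<in> U"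
      using z(2) unfolding multideg_part_kbd[symmetric] by (auto simp: multideg_part_def in_keys_iff subset_iff)
    ultimately obtain w where "supported a w"
        "\<forall>F. multideg_part a z F \<noteq> kbd1 w F \<longrightarrow> a - mchi F \<in> U"
      by (rule koszul_zero_E[OF _ multideg_part_supp[of a z] kchain_multideg_part[OF z(1)], of U])
    then show "\<exists>w. supported a w \<and>
           (\<forall>F. multideg_part a z F \<noteq> kbd1 w F \<longrightarrow> a - mchi F \<in> U)" by blast
  qed
  then obtain w where w0: "\<forall>a\<in>A. supported a (w a) \<and>
           (\<forall>F. multideg_part a z F \<noteq> kbd1 (w a) F \<longrightarrow> a - mchi F \<in> U)"
    by (rule bchoice[THEN exE])
  have w: "supported a (w a)" if "a \<in> A" for a
    using w0 that by blast
  have w': "a - mchi F \<in> U" if "a \<in> A" "multideg_part a z F \<noteq> kbd1 (w a) F" for a F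
    using bspec[OF w0 that(1)] that(2) by simp
  define W where "W F = (\<Sum>a\<in>A. multideg_emb a (w a) F)" for F
  have cW: "multideg_part b W = (if b \<in> A then w b else (\<lambda>_. 0))" for b
  proof
    fix F
    have "multideg_part b W F = (\<Sum>a\<in>A. multideg_part b (multideg_emb a (w a)) F)"
      unfolding W_def by (rule multideg_part_sum)
    also have "\<dots> = (\<Sum>a\<in>A. if b = a then w a F else 0)"
      by (rule sum.cong) (simp_all add: multideg_part_emb[OF w])
    finally show "multideg_part b W F = (if b \<in> A then w b else (\<lambda>_. 0)) F"
      using finA by simp
  qed
  have "m \<in> U" if m: "m \<in> keys (z F - kbd var W F)" for F m
  proof -
    define a where "a = m + mchi F"
    have "multideg_part a z F - kbd1 (multideg_part a W) F \<noteq> 0"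
      using m lookup_eq_multideg_part[of "\<lambda>F. z F - kbd var W F" F m]
      unfolding multideg_part_diff multideg_part_kbd by (simp add: in_keys_iff a_def)
    moreover have "multideg_part a z F = 0" if "a \<notin> A"
    proof -
      have "m \<notin> keys (z F)" using that unfolding a_def A_def by blast
      then show ?thesis by (simp add: a_def in_keys_iff flip: lookup_eq_multideg_part)
    qed
    ultimately have "a \<in> A" "multideg_part a z F \<noteq> kbd1 (w a) F"
      by (auto simp: cW split: if_splits)
    then have "a - mchi F \<in> U" by (rule w')
    then show ?thesis by (simp add: a_def)
  qed
  then show ?thesis by blast
qed

lemma mdeg_add: "mdeg (m + n) = mdeg m + mdeg n"
  by (simp add: mdeg_def lookup_add sum.distrib)

lemma mdeg_mchi: "mdeg (mchi F) = card F"
  by (simp add: mdeg_def sum.If_cases)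

text \<open>
  Conversely, a homology class of a single multidegree is one of the polynomial Koszul complex, because
  the piece of multidegree \<open>a\<close> of a bounding chain would bound as well.
\<close>

lemma koszul_nonzero_imp_nonboundary:
  assumes "koszul_nonzero TYPE('k::field) U i a"
  obtains z :: "'x::finite set \<Rightarrow> ('x, 'k::field) mpoly"
    where "kchain i z" "\<And>G. keys (kbd var z G) \<subseteq> U"
      "\<And>F m. m \<in> keys (z F) \<Longrightarrow> m + mchi F = a"
      "\<And>w. \<exists>F. \<not> keys (z F - kbd var w F) \<subseteq> U"
proof -
  obtain c :: "'x set \<Rightarrow> 'k" where c: "supported a c" "kchain i c"
     and c0: "\<forall>G. kbd1 c G \<noteq> 0 \<longrightarrow> a - mchi G \<in> U"
     and nob0: "\<not> (\<exists>w. supported a w \<and> (\<forall>F. c F \<noteq> kbd1 w F \<longrightarrow> a - mchi F \<in> U))"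
    using assms unfolding koszul_nonzero_def by (elim exE conjE)
  define z where "z = multideg_emb a c"
  have cz: "multideg_part b z = (if b = a then c else (\<lambda>_. 0))" for b
    unfolding z_def by (rule multideg_part_emb[OF c(1)])
  have 1: "kchain i z" using c(2) by (rule kchain_mono) (simp add: z_def multideg_emb_def)
  have 2: "keys (kbd var z G) \<subseteq> U" for G
  proof
    fix m assume "m \<in> keys (kbd var z G)"
    then have "kbd1 (multideg_part (m + mchi G) z) G \<noteq> 0"
      using lookup_eq_multideg_part[of "kbd var z" G m] by (simp add: in_keys_iff multideg_part_kbd)
    then have "m + mchi G = a" "kbd1 c G \<noteq> 0" by (auto simp: cz split: if_splits)
    then show "m \<in> U" using c0 by force
  qed
  have 3: "m + mchi F = a" if "m \<in> keys (z F)" for F m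
    using that lookup_eq_multideg_part[of z F m] by (auto simp: in_keys_iff cz split: if_splits)
  have 4: "\<exists>F. \<not> keys (z F - kbd var w F) \<subseteq> U" for w
  proof (rule ccontr)
    assume "\<not> ?thesis"
    then have n: "keys (z F - kbd var w F) \<subseteq> U" for F by blast
    have "a - mchi F \<in> U" if "c F \<noteq> kbd1 (multideg_part a w) F" for F
    proof -
      have "multideg_part a (\<lambda>F. z F - kbd var w F) F \<noteq> 0"
        unfolding multideg_part_diff multideg_part_kbd using that by (simp add: cz)
      then have "a - mchi F \<in> keys (z F - kbd var w F)"
        by (simp add: multideg_part_def in_keys_iff split: if_splits)
      then show ?thesis using n by blast
    qed
    then show False using nob0 multideg_part_supp[of a w] by blast
  qed
  show ?thesis by (rule that[OF 1 2 3 4])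
qed

text \<open>
  In multidegree \<open>a \<noteq> 0\<close> some variable divides $x^a$, and the homotopy $e_v \wedge$ contracts the
  complex; in multidegree \<open>0\<close> only $e_\emptyset$ occurs.
\<close>

lemma koszul_acyclic:
  fixes z :: "'x::finite set \<Rightarrow> ('x, 'k::field) mpoly"
  assumes z: "kchain i z" "i > 0" "\<And>G. kbd var z G = 0"
  shows "\<exists>w. \<forall>F. z F = kbd var w F"
proof -
  have "\<not> koszul_nonzero TYPE('k) {} i a" for a :: "'x \<Rightarrow>\<^sub>0 nat"
  proof
    assume "koszul_nonzero TYPE('k) {} i a"
    then obtain c :: "'x set \<Rightarrow> 'k" where c: "supported a c" "kchain i c"
       and c0: "\<And>G. kbd1 c G = 0"
       and nob0: "\<not> (\<exists>w. supported a w \<and> (\<forall>F. c F = kbd1 w F))"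
      unfolding koszul_nonzero_def by auto
    show False
    proof (cases "\<exists>v. v \<in> keys a")
      case False
      have "c F = 0" for F
      proof (rule ccontr)
        assume "c F \<noteq> 0"
        then have "F \<subseteq> {}" "card F = i" using c False by (auto simp: kchain_def)
        with z(2) show False by auto
      qed
      then show False using nob0 by (metis kbd_zero)
    next
      case True
      then obtain v where v: "v \<in> keys a" by blast
      have "wedge v (kbd1 c) F = 0" for F by (simp add: wedge_def c0)
      then have "c F = kbd1 (wedge v c) F" for F
        using kbd_wedge[of "\<lambda>_. 1" v c F] by simp
      moreover have "F \<subseteq> keys a" if "wedge v c F \<noteq> 0" for F
      proof -
        have "c (F - {v}) \<noteq> 0" using that by (auto simp: wedge_def split: if_splits)
        then have "F - {v} \<subseteq> keys a" using c(1) by blast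
        then show ?thesis using v by blast
      qed
      ultimately show False using nob0 by blast
    qed
  qed
  then have "\<exists>w. \<forall>F. keys (z F - kbd var w F) \<subseteq> {}"
    by (intro koszul_zero_imp_boundary[OF z(1)]) (simp_all add: z(3))
  then show ?thesis by auto
qed

section \<open>Noetherianity of polynomial rings and of their free modules\<close>

interpretation ideal: Modules.module "(*) :: 'r \<Rightarrow> 'r \<Rightarrow> 'r::comm_ring_1"
  by standard (simp_all add: algebra_simps)

(* As a simplification rule it brackets products to the left, against mult.assoc. *)
declare ideal.scale_scale [simp del]

lemma ideal_gen_eq_span: "ideal_gen S = ideal.span S"
  by (simp add: ideal_gen_def)

definition vscale :: "'r::comm_ring_1 \<Rightarrow> (nat \<Rightarrow> 'r) \<Rightarrow> nat \<Rightarrow> 'r" where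
  "vscale c u = (\<lambda>b. c * u b)"

interpretation rvec: Modules.module "vscale :: 'r::comm_ring_1 \<Rightarrow> _"
proof
  fix a b :: 'r and x y :: "nat \<Rightarrow> 'r"
  show "vscale a (x + y) = vscale a x + vscale a y"
    by (rule ext) (simp only: vscale_def distrib_left plus_fun_apply)
  show "vscale (a + b) x = vscale a x + vscale b x"
    by (rule ext) (simp only: vscale_def distrib_right plus_fun_apply)
  show "vscale a (vscale b x) = vscale (a * b) x"
    by (rule ext) (simp only: vscale_def mult.assoc)
  show "vscale 1 x = x" by (simp only: vscale_def mult_1_left)
qed

lemma sum_fun_apply: "(\<Sum>i\<in>A. f i) x = (\<Sum>i\<in>A. f i x :: 'b::comm_monoid_add)"
  by (induction A rule: infinite_finite_induct) auto

lemma nat_seq_incseq_subseq: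
  fixes s :: "nat \<Rightarrow> nat"
  shows "\<exists>r. strict_mono r \<and> incseq (\<lambda>n. s (r n))"
proof -
  obtain r where r: "strict_mono r" "monoseq (\<lambda>n. s (r n))" using seq_monosub[of s] by blast
  show ?thesis
  proof (cases "incseq (\<lambda>n. s (r n))")
    case True
    then show ?thesis using r by blast
  next
    case False
    then have dec: "decseq (\<lambda>n. s (r n))" using r(2) monoseq_iff by blast
    define m where "m = (LEAST k. \<exists>n. s (r n) = k)"
    have "\<exists>n. s (r n) = m" unfolding m_def by (rule LeastI_ex) blast
    then obtain n0 where n0: "s (r n0) = m" by blast
    have le: "m \<le> s (r n)" for n unfolding m_def by (rule Least_le) blast
    have eq: "s (r (n0 + n)) = m" for n
      using le[of "n0 + n"] decseqD[OF dec, of n0 "n0 + n"] n0 by simp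
    have "strict_mono (\<lambda>n. r (n0 + n))" using r(1) by (simp add: strict_mono_def)
    moreover have "incseq (\<lambda>n. s (r (n0 + n)))" by (simp add: eq)
    ultimately show ?thesis by (intro exI[of _ "\<lambda>n. r (n0 + n)"]) auto
  qed
qed

text \<open>
  Pass to a monotone subsequence one coordinate at a time.
\<close>

lemma exponent_seq_incseq_subseq:
  fixes s :: "nat \<Rightarrow> 'x \<Rightarrow> nat"
  assumes "finite V"
  shows "\<exists>r. strict_mono r \<and> (\<forall>v\<in>V. incseq (\<lambda>n. s (r n) v))"
  using assms
proof (induction V)
  case empty
  show ?case by (rule exI[of _ "\<lambda>n. n"]) (simp add: strict_mono_def)
next
  case (insert v V)
  then obtain r where r: "strict_mono r" "\<forall>v\<in>V. incseq (\<lambda>n. s (r n) v)" by blast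
  obtain q where q: "strict_mono q" "incseq (\<lambda>n. s (r (q n)) v)"
    using nat_seq_incseq_subseq[of "\<lambda>n. s (r n) v"] by blast
  have "incseq (\<lambda>n. s (r (q n)) u)" if "u \<in> V" for u
    using r(2) that q(1) by (auto simp: incseq_def strict_mono_less_eq)
  then show ?case using q r(1)
    by (intro exI[of _ "\<lambda>n. r (q n)"]) (auto simp: strict_mono_def)
qed

text \<open>
  The minimal elements of \<open>A\<close> form an antichain for divisibility. As every infinite sequence of exponent
  vectors has an increasing subsequence, there are finitely many of them.
\<close>

lemma dickson:
  fixes A :: "('x::finite \<Rightarrow>\<^sub>0 nat) set"
  shows "\<exists>B. finite B \<and> B \<subseteq> A \<and> (\<forall>a\<in>A. \<exists>b\<in>B. \<exists>c. a = b + c)"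
proof -
  define B where "B = {a \<in> A. \<forall>b\<in>A. \<forall>c. a = b + c \<longrightarrow> c = 0}"
  have ex: "\<exists>b\<in>B. \<exists>c. a = b + c" if "a \<in> A" for a
    using that
  proof (induction "mdeg a" arbitrary: a rule: less_induct)
    case less
    show ?case
    proof (cases "a \<in> B")
      case True
      then show ?thesis by (metis add.right_neutral)
    next
      case False
      then obtain b c where b: "b \<in> A" "a = b + c" "c \<noteq> 0" using less.prems by (auto simp: B_def)
      then obtain v where "lookup c v \<noteq> 0" by (metis lookup_zero poly_mapping_eqI)
      then have "mdeg c > 0" unfolding mdeg_def by (metis UNIV_I bot_nat_0.not_eq_extremum finite sum_eq_0_iff)
      then have "mdeg b < mdeg a" using b by (simp add: mdeg_add)
      from less.hyps[OF this b(1)] show ?thesis using b(2) by (metis add.assoc)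
    qed
  qed
  have "finite B"
  proof (rule ccontr)
    assume "infinite B"
    then obtain s :: "nat \<Rightarrow> 'x \<Rightarrow>\<^sub>0 nat" where s: "inj s" "range s \<subseteq> B"
      using infinite_countable_subset[of B] by blast
    obtain r where r: "strict_mono r" "\<forall>v\<in>UNIV. incseq (\<lambda>n. lookup (s (r n)) v)"
      using exponent_seq_incseq_subseq[of UNIV "\<lambda>n. lookup (s n)"] by auto
    have le: "lookup (s (r 0)) v \<le> lookup (s (r 1)) v" for v
      using r(2) by (auto simp: incseq_def)
    have eq: "s (r 1) = s (r 0) + (s (r 1) - s (r 0))"
      using le by (intro poly_mapping_eqI) (simp add: lookup_add lookup_minus)
    have "s (r 1) \<in> B" "s (r 0) \<in> A" using s(2) by (auto simp: B_def)
    then have "s (r 1) - s (r 0) = 0" using eq unfolding B_def by blast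
    then have "s (r 1) = s (r 0)" using eq by simp
    then have "r 1 = r 0" using s(1) by (simp add: inj_eq)
    then show False using r(1) by (simp add: strict_mono_eq)
  qed
  then show ?thesis using ex by (intro exI[of _ B]) (auto simp: B_def)
qed

text \<open>
  Such a map is a monomial order in disguise: comparing values of \<open>\<phi>\<close> gives a well-order that is
  compatible with multiplication. Sending the variables to distinct primes is injective by unique
  factorization.
\<close>

lemma ex_monomial_weight:
  "\<exists>\<phi> :: ('x::finite \<Rightarrow>\<^sub>0 nat) \<Rightarrow> nat. inj \<phi> \<and> (\<forall>m n. \<phi> (m + n) = \<phi> m * \<phi> n) \<and> (\<forall>m. \<phi> m > 0)"
proof -
  obtain q :: "nat \<Rightarrow> nat" where q: "inj q" "range q \<subseteq> {p. prime p}"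
    using infinite_countable_subset[OF primes_infinite] by blast
  define p :: "'x \<Rightarrow> nat" where "p v = q (to_nat v)" for v
  have injp: "inj p" using q(1) by (auto intro!: injI simp: p_def inj_eq)
  have prp: "prime (p v)" for v using q(2) by (auto simp: p_def)
  define \<phi> where "\<phi> m = (\<Prod>v\<in>UNIV. p v ^ lookup m v)" for m
  have mult: "\<phi> (m + n) = \<phi> m * \<phi> n" for m n
    by (simp add: \<phi>_def lookup_add power_add prod.distrib)
  have pos: "\<phi> m > 0" for m
    using prp by (auto simp: \<phi>_def intro!: prod_pos prime_gt_0_nat)
  have eq: "\<phi> m = (\<Prod>a\<in>range p. a ^ lookup m (inv_into UNIV p a))" for m
    by (simp add: \<phi>_def prod.reindex[OF injp] inv_f_f[OF injp])
  have "multiplicity (p v) (\<phi> m) = lookup m v" for m v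
    unfolding eq by (subst multiplicity_prod_prime_powers) (use prp injp in auto)
  then have "m = n" if "\<phi> m = \<phi> n" for m n
    using that by (intro poly_mapping_eqI) metis
  then have "inj \<phi>" by (intro injI)
  with mult pos show ?thesis by blast
qed

lemma keys_single_mult_E:
  fixes q :: "('x \<Rightarrow>\<^sub>0 nat) \<Rightarrow>\<^sub>0 'k::comm_ring_1"
  assumes "n \<in> keys (single m c * q)"
  obtains k where "k \<in> keys q" "n = m + k"
proof (cases "\<exists>k. n = m + k")
  case True
  then obtain k where k: "n = m + k" by blast
  then have "lookup q k \<noteq> 0" using assms by (auto simp: in_keys_iff lookup_single_mult)
  then show ?thesis using k that by (auto simp: in_keys_iff)
next
  case False
  then show ?thesis using assms lookup_single_mult_0[of n m c q] by (auto simp: in_keys_iff)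
qed

text \<open>
  Division with respect to the monomial order: the finitely many minimal leading monomials of elements
  of \<open>J\<close> suffice to cancel the leading term of any other element.
\<close>

theorem hilbert_basis_ideal:
  fixes J :: "('x::finite, 'k::field) mpoly set"
  assumes J: "ideal.subspace J"
  shows "\<exists>T. finite T \<and> T \<subseteq> J \<and> J \<subseteq> ideal.span T"
proof -
  obtain \<phi> :: "('x \<Rightarrow>\<^sub>0 nat) \<Rightarrow> nat" where \<phi>: "inj \<phi>" "\<And>m n. \<phi> (m + n) = \<phi> m * \<phi> n" "\<And>m. \<phi> m > 0"
    using ex_monomial_weight by blast
  define lead where "lead f m \<longleftrightarrow> m \<in> keys f \<and> (\<forall>n\<in>keys f. \<phi> n \<le> \<phi> m)"
    for f :: "('x, 'k) mpoly" and m
  define LM where "LM = {m. \<exists>f\<in>J. lead f m}"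
  obtain B where B: "finite B" "B \<subseteq> LM" "\<forall>a\<in>LM. \<exists>b\<in>B. \<exists>c. a = b + c"
    using dickson[of LM] by blast
  have "\<forall>b\<in>B. \<exists>f. f \<in> J \<and> lead f b" using B(2) by (auto simp: LM_def)
  then obtain g where g: "\<forall>b\<in>B. g b \<in> J \<and> lead (g b) b" by (rule bchoice[THEN exE])
  have main: "f \<in> ideal.span (g ` B)" if "f \<in> J" "\<forall>n\<in>keys f. \<phi> n < N" for f N
    using that
  proof (induction N arbitrary: f)
    case 0
    then have "f = 0" by (intro poly_mapping_eqI) (auto simp: in_keys_iff)
    then show ?case by (simp add: ideal.span_zero)
  next
    case (Suc N)
    show ?case
    proof (cases "\<exists>m\<in>keys f. \<phi> m = N")
      case False
      then have "\<forall>n\<in>keys f. \<phi> n < N" using Suc.prems(2) less_antisym by blast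
      then show ?thesis using Suc by blast
    next
      case True
      then obtain m where m: "m \<in> keys f" "\<phi> m = N" by blast
      then have "lead f m" using Suc.prems(2) by (auto simp: lead_def)
      then have "m \<in> LM" using Suc.prems(1) by (auto simp: LM_def)
      then obtain b c where b: "b \<in> B" "m = b + c" using B(3) by blast
      have gb: "g b \<in> J" "lead (g b) b" using g b(1) by auto
      define l where "l = lookup (g b) b"
      have "l \<noteq> 0" using gb(2) by (simp add: l_def lead_def in_keys_iff)
      \<comment> \<open>the multiple of \<open>g b\<close> with the same leading term as \<open>f\<close>\<close>
      define h where "h = single c (lookup f m / l)"
      have hg: "h * g b \<in> ideal.span (g ` B)"
        using b(1) by (intro ideal.span_scale ideal.span_base) auto
      have hJ: "h * g b \<in> J" using J gb(1) by (rule ideal.subspace_scale)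
      have hm: "lookup (h * g b) m = lookup f m"
        using \<open>l \<noteq> 0\<close> unfolding h_def b(2)
        by (subst (2) add.commute) (simp add: lookup_single_mult l_def)
      have "\<phi> n < N" if n: "n \<in> keys (f - h * g b)" for n
      proof -
        have "n \<noteq> m" using n hm by (auto simp: in_keys_iff lookup_minus)
        then have ne: "\<phi> n \<noteq> N" using m(2) \<phi>(1) by (auto simp: inj_eq)
        have "n \<in> keys f \<or> n \<in> keys (h * g b)"
          using n by (auto simp: in_keys_iff lookup_minus)
        then have "\<phi> n \<le> N"
        proof
          assume "n \<in> keys f"
          then show ?thesis using Suc.prems(2) by auto
        next
          assume "n \<in> keys (h * g b)"
          then obtain k where k: "k \<in> keys (g b)" "n = c + k"
            unfolding h_def by (rule keys_single_mult_E)
          then have "\<phi> k \<le> \<phi> b" using gb(2) by (auto simp: lead_def)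
          then have "\<phi> c * \<phi> k \<le> \<phi> c * \<phi> b" by (rule mult_le_mono2)
          then show ?thesis using k(2) m(2) b(2) by (metis \<phi>(2) mult.commute)
        qed
        with ne show ?thesis by simp
      qed
      then have "f - h * g b \<in> ideal.span (g ` B)"
        using Suc.IH ideal.subspace_diff[OF J Suc.prems(1) hJ] by blast
      then have "(f - h * g b) + h * g b \<in> ideal.span (g ` B)" using hg by (rule ideal.span_add)
      then show ?thesis by simp
    qed
  qed
  have "f \<in> ideal.span (g ` B)" if "f \<in> J" for f
  proof -
    have "\<forall>n\<in>keys f. \<phi> n < Suc (Max (\<phi> ` keys f))"
      by (auto intro!: le_imp_less_Suc Max_ge)
    then show ?thesis using main that by blast
  qed
  then show ?thesis using B(1) g by (intro exI[of _ "g ` B"]) auto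
qed

text \<open>
  The last coordinates of the elements of \<open>N\<close> form a finitely generated ideal, and subtracting a
  combination of lifts of its generators leaves an element of a smaller free module.
\<close>

theorem hilbert_basis_submodule:
  fixes N :: "(nat \<Rightarrow> ('x::finite, 'k::field) mpoly) set"
  assumes "rvec.subspace N" "\<And>u b. u \<in> N \<Longrightarrow> b \<ge> r \<Longrightarrow> u b = 0"
  shows "\<exists>T. finite T \<and> T \<subseteq> N \<and> N \<subseteq> rvec.span T"
  using assms
proof (induction r arbitrary: N)
  case 0
  then have "N \<subseteq> {0}" by (auto simp: fun_eq_iff)
  then show ?case by (intro exI[of _ "{}"]) (simp add: rvec.span_empty)
next
  case (Suc r)
  define J where "J = (\<lambda>u. u r) ` N"
  have "ideal.subspace J"
  proof (rule ideal.subspaceI)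
    show "0 \<in> J" unfolding J_def by (rule image_eqI[OF _ rvec.subspace_0[OF Suc.prems(1)]]) simp
  next
    fix x y assume "x \<in> J" "y \<in> J"
    then obtain u w where "u \<in> N" "w \<in> N" "x = u r" "y = w r" unfolding J_def by blast
    then show "x + y \<in> J"
      unfolding J_def by (intro image_eqI[OF _ rvec.subspace_add[OF Suc.prems(1), of u w]]) simp_all
  next
    fix c x assume "x \<in> J"
    then obtain u where "u \<in> N" "x = u r" unfolding J_def by blast
    then show "c * x \<in> J"
      unfolding J_def by (intro image_eqI[OF _ rvec.subspace_scale[OF Suc.prems(1), of u c]]) (simp_all add: vscale_def)
  qed
  then have "\<exists>S. finite S \<and> S \<subseteq> J \<and> J \<subseteq> ideal.span S" by (rule hilbert_basis_ideal)
  then obtain S where S: "finite S" "S \<subseteq> J" "J \<subseteq> ideal.span S" by (elim exE conjE)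
  have "\<forall>s\<in>S. \<exists>u. u \<in> N \<and> u r = s" using S(2) by (auto simp: J_def)
  then obtain h where h: "\<forall>s\<in>S. h s \<in> N \<and> h s r = s" by (rule bchoice[THEN exE])
  define N' where "N' = {u \<in> N. u r = 0}"
  have sub': "rvec.subspace N'"
    using Suc.prems(1) unfolding N'_def rvec.subspace_def by (auto simp: vscale_def)
  have supp': "u b = 0" if "u \<in> N'" "b \<ge> r" for u b
    using that Suc.prems(2)[of u b] by (cases "b = r") (auto simp: N'_def)
  obtain T where T: "finite T" "T \<subseteq> N'" "N' \<subseteq> rvec.span T"
  proof -
    have "\<exists>T. finite T \<and> T \<subseteq> N' \<and> N' \<subseteq> rvec.span T"
      by (rule Suc.IH[of N', OF sub']) (erule supp')
    then show ?thesis using that by (elim exE conjE)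
  qed
  have "u \<in> rvec.span (h ` S \<union> T)" if u: "u \<in> N" for u
  proof -
    have "u r \<in> ideal.span S" using u S(3) by (auto simp: J_def)
    then obtain k where k: "u r = (\<Sum>s\<in>S. k s * s)" unfolding ideal.span_finite[OF S(1)] by blast
    define w where "w = (\<Sum>s\<in>S. vscale (k s) (h s))"
    have wN: "w \<in> N" unfolding w_def
      using h by (intro rvec.subspace_sum[OF Suc.prems(1)] rvec.subspace_scale[OF Suc.prems(1)]) auto
    have ws: "w \<in> rvec.span (h ` S \<union> T)" unfolding w_def
      by (intro rvec.span_sum rvec.span_scale rvec.span_base) auto
    have "w r = u r" unfolding w_def k sum_fun_apply using h by (auto simp: vscale_def intro!: sum.cong)
    then have "u - w \<in> N'" using rvec.subspace_diff[OF Suc.prems(1) u wN] by (simp add: N'_def)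
    then have "u - w \<in> rvec.span (h ` S \<union> T)" using T(3) rvec.span_mono[of T "h ` S \<union> T"] by blast
    from rvec.span_add[OF this ws] show ?thesis by simp
  qed
  then show ?case using S T h by (intro exI[of _ "h ` S \<union> T"]) (auto simp: N'_def)
qed

section \<open>Zero divisors modulo an ideal\<close>

lemma noetherian_generating_subset:
  fixes S :: "('x::finite, 'k::field) mpoly set"
  shows "\<exists>T. finite T \<and> T \<subseteq> S \<and> S \<subseteq> ideal.span T"
proof -
  obtain T0 where T0: "finite T0" "T0 \<subseteq> ideal.span S" "ideal.span S \<subseteq> ideal.span T0"
    using hilbert_basis_ideal[OF ideal.subspace_span] by blast
  have "\<forall>t\<in>T0. \<exists>U. finite U \<and> U \<subseteq> S \<and> t \<in> ideal.span U"
  proof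
    fix t assume "t \<in> T0"
    then have "t \<in> ideal.span S" using T0(2) by blast
    then obtain U r where U: "finite U" "U \<subseteq> S" "t = (\<Sum>a\<in>U. r a * a)"
      unfolding ideal.span_explicit by blast
    then have "t \<in> ideal.span U" by (auto intro: ideal.span_sum ideal.span_scale ideal.span_base)
    then show "\<exists>U. finite U \<and> U \<subseteq> S \<and> t \<in> ideal.span U" using U by blast
  qed
  then obtain U where U: "\<forall>t\<in>T0. finite (U t) \<and> U t \<subseteq> S \<and> t \<in> ideal.span (U t)"
    by (rule bchoice[THEN exE])
  define T where "T = (\<Union>t\<in>T0. U t)"
  have "T0 \<subseteq> ideal.span T"
  proof
    fix t assume t: "t \<in> T0"
    then have "ideal.span (U t) \<subseteq> ideal.span T" by (intro ideal.span_mono) (auto simp: T_def)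
    with U t show "t \<in> ideal.span T" by blast
  qed
  then have "ideal.span T0 \<subseteq> ideal.span T" by (rule ideal.span_minimal) (rule ideal.subspace_span)
  then have "S \<subseteq> ideal.span T" using T0(3) ideal.span_superset by blast
  moreover have "finite T" "T \<subseteq> S" using T0(1) U by (auto simp: T_def)
  ultimately show ?thesis by blast
qed

text \<open>
  The union of a chain of ideals is generated by finitely many elements, which already lie in one
  member of the chain; hence Zorn's lemma applies.
\<close>

lemma noetherian_maximal:
  fixes C :: "('x::finite, 'k::field) mpoly set set"
  assumes "C \<noteq> {}" "\<And>J. J \<in> C \<Longrightarrow> ideal.subspace J"
  shows "\<exists>M\<in>C. \<forall>X\<in>C. M \<subseteq> X \<longrightarrow> X = M"
proof (rule subset_Zorn_nonempty[OF assms(1)])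
  fix D assume D: "D \<noteq> {}" "subset.chain C D"
  obtain T where T: "finite T" "T \<subseteq> \<Union>D" "\<Union>D \<subseteq> ideal.span T"
    using noetherian_generating_subset by blast
  obtain X where X: "X \<in> D" "T \<subseteq> X"
    using finite_subset_Union_chain[OF T(1,2) D] by blast
  have "X \<in> C" using D(2) X(1) by (auto simp: subset.chain_def)
  then have "ideal.span T \<subseteq> X" using X(2) assms(2) ideal.span_minimal by blast
  then have "\<Union>D = X" using T(3) X(1) by blast
  then show "\<Union>D \<in> C" using \<open>X \<in> C\<close> by simp
qed

definition is_prime_ideal :: "'r::comm_ring_1 set \<Rightarrow> bool" where
  "is_prime_ideal P \<longleftrightarrow> ideal.subspace P \<and> 1 \<notin> P \<and> (\<forall>a b. a * b \<in> P \<longrightarrow> a \<in> P \<or> b \<in> P)"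

lemma prime_ideal_prod:
  assumes "is_prime_ideal P" "finite K" "(\<Prod>k\<in>K. a k) \<in> P"
  shows "\<exists>k\<in>K. a k \<in> P"
  using assms(2,3)
proof (induction K)
  case empty
  then show ?case using assms(1) by (simp add: is_prime_ideal_def)
next
  case (insert k K)
  then have "a k * (\<Prod>k\<in>K. a k) \<in> P" by simp
  then have "a k \<in> P \<or> (\<Prod>k\<in>K. a k) \<in> P" using assms(1) unfolding is_prime_ideal_def by blast
  then show ?case using insert.IH by blast
qed

lemma ideal_prod_mem:
  assumes "ideal.subspace P" "finite K" "k \<in> K" "a k \<in> P"
  shows "(\<Prod>k\<in>K. a k) \<in> P"
  using ideal.subspace_scale[OF assms(1,4), of "\<Prod>k\<in>K - {k}. a k"] prod.remove[OF assms(2,3), of a]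
  by (simp add: mult.commute)

text \<open>
  In a cover of minimal size every prime has an element of \<open>A\<close> that lies in no other member. The sum of
  one of these elements and the product of all others then lies in no member of the cover.
\<close>

lemma prime_avoidance:
  assumes A: "ideal.subspace A" and H: "finite H" "\<And>h. h \<in> H \<Longrightarrow> is_prime_ideal (P h)"
    and cover: "A \<subseteq> (\<Union>h\<in>H. P h)"
  shows "\<exists>h\<in>H. A \<subseteq> P h"
proof -
  obtain K where K: "K \<subseteq> H \<and> A \<subseteq> (\<Union>h\<in>K. P h)"
     and min: "\<And>K'. K' \<subseteq> H \<and> A \<subseteq> (\<Union>h\<in>K'. P h) \<Longrightarrow> card K \<le> card K'"
    using ex_has_least_nat[of "\<lambda>K. K \<subseteq> H \<and> A \<subseteq> (\<Union>h\<in>K. P h)" H card] cover by blast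
  have finK: "finite K" using K H(1) finite_subset by blast
  have sub: "ideal.subspace (P k)" if "k \<in> K" for k
    using H(2)[of k] K that by (auto simp: is_prime_ideal_def)
  have "\<forall>k\<in>K. \<exists>a. a \<in> A \<and> (\<forall>k'\<in>K - {k}. a \<notin> P k')"
  proof
    fix k assume "k \<in> K"
    then have "card (K - {k}) < card K" using finK by (intro card_Diff1_less)
    then have "\<not> A \<subseteq> (\<Union>h\<in>K - {k}. P h)" using min[of "K - {k}"] K by (meson Diff_subset leD subset_trans)
    then show "\<exists>a. a \<in> A \<and> (\<forall>k'\<in>K - {k}. a \<notin> P k')" by blast
  qed
  then obtain a where a: "\<forall>k\<in>K. a k \<in> A \<and> (\<forall>k'\<in>K - {k}. a k \<notin> P k')"
    by (rule bchoice[THEN exE])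
  have aP: "a k \<in> P k" if "k \<in> K" for k using a K that by blast
  have "K \<noteq> {}" using K ideal.subspace_0[OF A] by blast
  then obtain k0 where k0: "k0 \<in> K" by blast
  show ?thesis
  proof (cases "K - {k0} = {}")
    case True
    then have "K = {k0}" using k0 by blast
    then show ?thesis using K by blast
  next
    case False
    then obtain k1 where k1: "k1 \<in> K - {k0}" by blast
    define b where "b = (\<Prod>k\<in>K - {k0}. a k)"
    have fin': "finite (K - {k0})" using finK by simp
    have "b \<in> A" unfolding b_def using a k1 by (intro ideal_prod_mem[OF A fin' k1]) blast
    moreover have "a k0 \<in> A" using a k0 by blast
    ultimately have "a k0 + b \<in> A" by (intro ideal.subspace_add[OF A])
    then obtain k where k: "k \<in> K" "a k0 + b \<in> P k" using K by blast
    show ?thesis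
    proof (cases "k = k0")
      case True
      have "a k0 + b - a k0 \<in> P k0"
        using k aP[OF k0] True by (intro ideal.subspace_diff[OF sub[OF k0]]) simp_all
      then have "b \<in> P k0" by simp
      then have "\<exists>k\<in>K - {k0}. a k \<in> P k0"
        unfolding b_def using prime_ideal_prod[OF H(2) fin'] k0 K by blast
      then show ?thesis using a k0 by blast
    next
      case False
      then have "k \<in> K - {k0}" using k(1) by blast
      then have "b \<in> P k" unfolding b_def using aP[OF k(1)] by (intro ideal_prod_mem[OF sub[OF k(1)] fin'])
      then have "a k0 + b - b \<in> P k"
        using k by (intro ideal.subspace_diff[OF sub[OF k(1)]])
      then have "a k0 \<in> P k" by simp
      then show ?thesis using a k0 \<open>k \<in> K - {k0}\<close> by blast
    qed
  qed
qed

text \<open>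
  Consider the annihilators of nonzero classes modulo \<open>J\<close>. Those that are maximal among them are prime
  and finite in number, and they cover \<open>A\<close>; prime avoidance puts \<open>A\<close> inside one of them.
\<close>

theorem zero_divisors_annihilate_common:
  fixes J A :: "('x::finite, 'k::field) mpoly set"
  assumes J: "ideal.subspace J" and A: "ideal.subspace A"
    and zd: "\<And>f. f \<in> A \<Longrightarrow> \<exists>g. g \<notin> J \<and> f * g \<in> J"
  shows "\<exists>g. g \<notin> J \<and> (\<forall>f\<in>A. f * g \<in> J)"
proof -
  define col where "col g = {f. f * g \<in> J}" for g
  have sub: "ideal.subspace (col g)" for g
  proof (rule ideal.subspaceI)
    show "0 \<in> col g" using ideal.subspace_0[OF J] by (simp add: col_def)
    show "x + y \<in> col g" if "x \<in> col g" "y \<in> col g" for x y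
      using ideal.subspace_add[OF J, of "x * g" "y * g"] that by (simp add: col_def distrib_right)
    show "c * x \<in> col g" if "x \<in> col g" for c x
      using ideal.subspace_scale[OF J, of "x * g" c] that by (simp add: col_def mult.assoc)
  qed
  define Gm where "Gm = {g. g \<notin> J \<and> (\<forall>h. h \<notin> J \<longrightarrow> col g \<subseteq> col h \<longrightarrow> col h = col g)}"
  have ex_max: "\<exists>h\<in>Gm. col g \<subseteq> col h" if "g \<notin> J" for g
  proof -
    define C where "C = {col h | h. h \<notin> J \<and> col g \<subseteq> col h}"
    have "col g \<in> C" using that unfolding C_def by blast
    moreover have "ideal.subspace X" if "X \<in> C" for X using that sub unfolding C_def by blast
    ultimately obtain M where M: "M \<in> C" "\<forall>X\<in>C. M \<subseteq> X \<longrightarrow> X = M"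
      using noetherian_maximal[of C] by blast
    then obtain h where h: "M = col h" "h \<notin> J" "col g \<subseteq> col h" unfolding C_def by blast
    have "col h' = col h" if "h' \<notin> J" "col h \<subseteq> col h'" for h'
    proof -
      have "col h' \<in> C" using that h unfolding C_def by blast
      then show ?thesis using M(2) that h(1) by blast
    qed
    then have "h \<in> Gm" using h(2) unfolding Gm_def by blast
    with h(3) show ?thesis by blast
  qed
  have prime: "is_prime_ideal (col g)" if g: "g \<in> Gm" for g
  proof -
    have gJ: "g \<notin> J" and mx: "\<And>h. h \<notin> J \<Longrightarrow> col g \<subseteq> col h \<Longrightarrow> col h = col g"
      using g unfolding Gm_def by blast+
    have "a \<in> col g" if ab: "a * b \<in> col g" and b: "b \<notin> col g" for a b
    proof -
      have "b * g \<notin> J" using b by (simp add: col_def)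
      moreover have "col g \<subseteq> col (b * g)"
      proof
        fix f assume "f \<in> col g"
        then have "f * g \<in> J" by (simp add: col_def)
        then have "b * (f * g) \<in> J" by (rule ideal.subspace_scale[OF J])
        then show "f \<in> col (b * g)" by (simp add: col_def mult.left_commute[of f b g])
      qed
      ultimately have "col (b * g) = col g" by (rule mx)
      moreover have "a \<in> col (b * g)" using ab unfolding col_def mem_Collect_eq mult.assoc .
      ultimately show ?thesis by simp
    qed
    then show ?thesis using sub[of g] gJ unfolding is_prime_ideal_def by (auto simp: col_def)
  qed
  obtain G0 where G0: "finite G0" "G0 \<subseteq> Gm" "Gm \<subseteq> ideal.span G0"
    using noetherian_generating_subset[of Gm] by blast
  \<comment> \<open>A product of annihilators, one for each element of \<open>G0\<close>, annihilates \<open>Gm\<close>. So every prime in question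
    contains, and by maximality equals, one that belongs to \<open>G0\<close>.\<close>
  have repr: "\<exists>h\<in>G0. col h = col g" if g: "g \<in> Gm" for g
  proof (rule ccontr)
    assume "\<not> ?thesis"
    then have "\<forall>h\<in>G0. \<exists>a. a \<in> col h \<and> a \<notin> col g"
    proof (intro ballI)
      fix h assume h: "h \<in> G0"
      then have "h \<in> Gm" using G0(2) by blast
      have "\<not> col h \<subseteq> col g"
      proof
        assume "col h \<subseteq> col g"
        moreover have "g \<notin> J" using g by (simp add: Gm_def)
        ultimately have "col g = col h" using \<open>h \<in> Gm\<close> unfolding Gm_def by simp
        with \<open>\<not> (\<exists>h\<in>G0. col h = col g)\<close> h show False by blast
      qed
      then show "\<exists>a. a \<in> col h \<and> a \<notin> col g" by blast
    qed
    then obtain a where a: "\<forall>h\<in>G0. a h \<in> col h \<and> a h \<notin> col g" by (rule bchoice[THEN exE])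
    define p where "p = (\<Prod>h\<in>G0. a h)"
    have "ideal.subspace {x. p * x \<in> J}"
    proof (rule ideal.subspaceI)
      show "0 \<in> {x. p * x \<in> J}" using ideal.subspace_0[OF J] by simp
      show "x + y \<in> {x. p * x \<in> J}" if "x \<in> {x. p * x \<in> J}" "y \<in> {x. p * x \<in> J}" for x y
        using ideal.subspace_add[OF J, of "p * x" "p * y"] that by (simp add: distrib_left)
      show "c * x \<in> {x. p * x \<in> J}" if "x \<in> {x. p * x \<in> J}" for c x
        using ideal.subspace_scale[OF J, of "p * x" c] that by (simp add: mult.left_commute[of p c x])
    qed
    moreover have "G0 \<subseteq> {x. p * x \<in> J}"
    proof
      fix h assume h: "h \<in> G0"
      have "p \<in> col h" unfolding p_def using a h by (intro ideal_prod_mem[OF sub G0(1) h]) blast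
      then show "h \<in> {x. p * x \<in> J}" by (simp add: col_def)
    qed
    ultimately have "ideal.span G0 \<subseteq> {x. p * x \<in> J}" by (intro ideal.span_minimal)
    then have "p \<in> col g" using g G0(3) by (auto simp: col_def)
    then have "\<exists>h\<in>G0. a h \<in> col g" unfolding p_def by (rule prime_ideal_prod[OF prime[OF g] G0(1)])
    with a show False by blast
  qed
  have "A \<subseteq> (\<Union>h\<in>G0. col h)"
  proof
    fix f assume "f \<in> A"
    then obtain g where g: "g \<notin> J" "f * g \<in> J" using zd by blast
    then obtain h where h: "h \<in> Gm" "col g \<subseteq> col h" using ex_max by blast
    moreover have "f \<in> col g" using g by (simp add: col_def)
    ultimately show "f \<in> (\<Union>h\<in>G0. col h)" using repr[OF h(1)] by blast
  qed
  then obtain h where "h \<in> G0" "A \<subseteq> col h"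
    using prime_avoidance[OF A G0(1), of col] prime G0(2) by blast
  then show ?thesis using G0(2) by (intro exI[of _ h]) (auto simp: col_def Gm_def)
qed

section \<open>Depth and the vanishing of Koszul homology\<close>

text \<open>
  $H_i$ of the Koszul complex of $R/J$ vanishes for all $i > n - d$, where \<open>n\<close> is the number of
  variables. Cycles and boundaries of $R/J$ are represented by chains over \<open>R\<close> modulo \<open>J\<close>. For
  \<open>J\<close> inside the maximal ideal this will turn out to mean that the depth of $R/J$ is at least \<open>d\<close>.
\<close>

definition koszul_vanish :: "('x::finite, 'k::field) mpoly set \<Rightarrow> nat \<Rightarrow> bool" where
  "koszul_vanish J d \<longleftrightarrow> (\<forall>i z. i + d > CARD('x) \<longrightarrow> kchain i z \<longrightarrow> (\<forall>G. kbd var z G \<in> J) \<longrightarrow>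
     (\<exists>w. \<forall>F. z F - kbd var w F \<in> J))"

lemma inj_var: "inj (var :: 'x \<Rightarrow> ('x, 'k::field) mpoly)"
  by (rule injI) (auto simp: var_def dest!: arg_cong[of _ _ keys])

lemma max_ideal_explicit:
  fixes f :: "('x::finite, 'k::field) mpoly"
  assumes "f \<in> max_ideal"
  obtains a where "f = (\<Sum>v\<in>UNIV. a v * var v)"
proof -
  have "f \<in> ideal.span (range var)" using assms by (simp add: max_ideal_def ideal_gen_eq_span)
  then obtain u where "f = (\<Sum>y\<in>range var. u y * y)"
    unfolding ideal.span_finite[OF finite_imageI[OF finite]] by blast
  then have "f = (\<Sum>v\<in>UNIV. u (var v) * var v)" by (simp add: sum.reindex[OF inj_var])
  then show ?thesis by (rule that)
qed

lemma subspace_max_ideal: "ideal.subspace (max_ideal :: ('x::finite, 'k::field) mpoly set)"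
  by (simp add: max_ideal_def ideal_gen_eq_span)

lemma var_in_max_ideal: "var v \<in> max_ideal"
  by (auto simp: max_ideal_def ideal_gen_eq_span intro: ideal.span_base)

lemma kbd_in_ideal:
  fixes J :: "'r::comm_ring_1 set"
  assumes "ideal.subspace J" "\<And>F. z F \<in> J"
  shows "kbd x z G \<in> J"
  unfolding kbd_def using assms by (auto intro: ideal.subspace_sum ideal.subspace_scale)

lemma wedge_in_ideal:
  fixes J :: "'r::comm_ring_1 set"
  assumes "ideal.subspace J" "\<And>F. z F \<in> J"
  shows "wedge v z G \<in> J"
  unfolding wedge_def using assms by (auto intro: ideal.subspace_0 ideal.subspace_scale)

text \<open>
  Every element of the ideal of the variables acts as zero on Koszul homology.
\<close>

lemma koszul_homotopy:
  fixes z :: "'x::finite set \<Rightarrow> ('x, 'k::field) mpoly"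
  assumes "f = (\<Sum>v\<in>UNIV. a v * var v)"
  shows "kbd var (\<lambda>F. \<Sum>v\<in>UNIV. a v * wedge v z F) F + (\<Sum>v\<in>UNIV. a v * wedge v (kbd var z) F) = f * z F"
proof -
  have "kbd var (\<lambda>F. \<Sum>v\<in>UNIV. a v * wedge v z F) F + (\<Sum>v\<in>UNIV. a v * wedge v (kbd var z) F) =
     (\<Sum>v\<in>UNIV. a v * (kbd var (wedge v z) F + wedge v (kbd var z) F))"
    by (simp add: kbd_sum kbd_scale distrib_left sum.distrib)
  also have "\<dots> = (\<Sum>v\<in>UNIV. a v * var v * z F)" by (simp add: kbd_wedge mult.assoc)
  finally show ?thesis by (simp add: assms sum_distrib_right)
qed

lemma span_insert_ideal:
  fixes J :: "'r::comm_ring_1 set"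
  assumes "ideal.subspace J"
  shows "y \<in> ideal_gen (J \<union> {f}) \<longleftrightarrow> (\<exists>k. y - k * f \<in> J)"
proof -
  have "J \<union> {f} = insert f J" by blast
  then show ?thesis
    using ideal.span_breakdown_eq[of y f J] ideal.span_eq_iff[of J] assms by (simp add: ideal_gen_eq_span del: ideal.span_eq_iff)
qed

lemma subspace_ideal_gen: "ideal.subspace (ideal_gen S)"
  by (simp add: ideal_gen_eq_span)

lemma kchain_wedge: "kchain i z \<Longrightarrow> kchain (Suc i) (wedge v z)"
  unfolding kchain_def
proof (intro allI impI)
  fix F assume z: "\<forall>F. z F \<noteq> 0 \<longrightarrow> card F = i" and nz: "wedge v z F \<noteq> 0"
  from nz have "v \<in> F" "z (F - {v}) \<noteq> 0" by (simp_all add: wedge_def split: if_splits) (metis mult_zero_right)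
  with z have "card (F - {v}) = i" by blast
  then show "card F = Suc i" using \<open>v \<in> F\<close> by (metis card.remove finite)
qed

text \<open>
  In the long exact sequence of multiplication by \<open>f\<close> on $R/J$ the maps induced by \<open>f\<close> vanish, so
  $H_i(R/J)$ is a quotient of $H_{i+1}(R/(J + f))$. The homotopy for \<open>f\<close>, applied to \<open>z\<close>, is an explicit
  preimage of the class of \<open>z\<close>.
\<close>

lemma koszul_vanish_lift:
  fixes J :: "('x::finite, 'k::field) mpoly set"
  assumes J: "ideal.subspace J" and f: "f \<in> max_ideal" and nzd: "\<And>g. f * g \<in> J \<Longrightarrow> g \<in> J"
    and Q: "koszul_vanish (ideal_gen (J \<union> {f})) d"
  shows "koszul_vanish J (Suc d)"
  unfolding koszul_vanish_def
proof (intro allI impI)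
  fix i and z :: "'x set \<Rightarrow> ('x, 'k) mpoly"
  assume i: "CARD('x) < i + Suc d" and z: "kchain i z" and cyc: "\<forall>G. kbd var z G \<in> J"
  obtain a where a: "f = (\<Sum>v\<in>UNIV. a v * var v)" using f by (rule max_ideal_explicit)
  define h where "h F = (\<Sum>v\<in>UNIV. a v * wedge v z F)" for F
  define h' where "h' F = (\<Sum>v\<in>UNIV. a v * wedge v (kbd var z) F)" for F
  have hom: "kbd var h F + h' F = f * z F" for F
    unfolding h_def h'_def by (rule koszul_homotopy[OF a])
  have h'J: "h' F \<in> J" for F unfolding h'_def
    using cyc by (intro ideal.subspace_sum[OF J] ideal.subspace_scale[OF J] wedge_in_ideal[OF J]) blast
  have "kchain (Suc i) h"
    unfolding kchain_def
  proof (intro allI impI)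
    fix F assume "h F \<noteq> 0"
    then obtain v where "wedge v z F \<noteq> 0" unfolding h_def by (metis (no_types, lifting) mult_zero_right sum.not_neutral_contains_not_neutral)
    then show "card F = Suc i" using kchain_wedge[OF z] unfolding kchain_def by blast
  qed
  moreover have "kbd var h G \<in> ideal_gen (J \<union> {f})" for G
    unfolding span_insert_ideal[OF J]
  proof (rule exI[of _ "z G"])
    have "kbd var h G - z G * f = - h' G" using hom[of G] by (simp add: algebra_simps add_eq_0_iff)
    then show "kbd var h G - z G * f \<in> J" using ideal.subspace_neg[OF J h'J] by simp
  qed
  moreover have "CARD('x) < Suc i + d" using i by simp
  ultimately obtain w where "\<forall>F. h F - kbd var w F \<in> ideal_gen (J \<union> {f})"
    using Q unfolding koszul_vanish_def by blast
  then have "\<forall>F. \<exists>k. h F - kbd var w F - k * f \<in> J" unfolding span_insert_ideal[OF J] .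
  then obtain u where u: "\<forall>F. h F - kbd var w F - u F * f \<in> J" by (rule choice[THEN exE])
  have "z F - kbd var u F \<in> J" for F
  proof (rule nzd)
    have "kbd var (\<lambda>F. h F - kbd var w F - f * u F) F \<in> J"
      using u by (intro kbd_in_ideal[OF J]) (simp add: mult.commute)
    then have "kbd var h F - f * kbd var u F \<in> J"
      unfolding kbd_diff kbd_kbd kbd_scale by simp
    then have "(kbd var h F - f * kbd var u F) + h' F \<in> J" using h'J by (intro ideal.subspace_add[OF J])
    moreover have "(kbd var h F - f * kbd var u F) + h' F = f * (z F - kbd var u F)"
      using hom[of F] by (simp add: algebra_simps)
    ultimately show "f * (z F - kbd var u F) \<in> J" by simp
  qed
  then show "\<exists>w. \<forall>F. z F - kbd var w F \<in> J" by blast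
qed

text \<open>
  The part of the same exact sequence that presents $H_i(R/(J + f))$ as an extension of a submodule of
  $H_{i-1}(R/J)$ by a quotient of $H_i(R/J)$.
\<close>

lemma koszul_vanish_quotient:
  fixes J :: "('x::finite, 'k::field) mpoly set"
  assumes J: "ideal.subspace J" and nzd: "\<And>g. f * g \<in> J \<Longrightarrow> g \<in> J"
    and Q: "koszul_vanish J (Suc d)"
  shows "koszul_vanish (ideal_gen (J \<union> {f})) d"
  unfolding koszul_vanish_def
proof (intro allI impI)
  fix i and z :: "'x set \<Rightarrow> ('x, 'k) mpoly"
  let ?J = "ideal_gen (J \<union> {f})"
  assume i: "CARD('x) < i + d" and z: "kchain i z" and cyc: "\<forall>G. kbd var z G \<in> ?J"
  have "\<forall>G. \<exists>k. kbd var z G - k * f \<in> J" using cyc unfolding span_insert_ideal[OF J] .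
  then obtain y0 where y0: "\<forall>G. kbd var z G - y0 G * f \<in> J" by (rule choice[THEN exE])
  define y where "y G = (if Suc (card G) = i then y0 G else 0)" for G
  have z_restrict: "kbd var z G = (if Suc (card G) = i then kbd var z G else 0)" for G
  proof -
    have "z = (\<lambda>F. if card F = i then z F else 0)" using z by (auto simp: kchain_def fun_eq_iff)
    then show ?thesis using kbd_restrict_card[of var i z G] by simp
  qed
  have y: "kbd var z G - f * y G \<in> J" for G
    using y0 z_restrict[of G] ideal.subspace_0[OF J] by (auto simp: y_def mult.commute)
  have fy: "kbd var y G \<in> J" for G
  proof (rule nzd)
    have "kbd var (\<lambda>G. kbd var z G - f * y G) G \<in> J" using y by (rule kbd_in_ideal[OF J])
    then have "- (f * kbd var y G) \<in> J" unfolding kbd_diff kbd_kbd kbd_scale by simp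
    then show "f * kbd var y G \<in> J" using ideal.subspace_neg[OF J] by fastforce
  qed
  have "\<exists>u. kchain i u \<and> (\<forall>G. y G - kbd var u G \<in> J)"
  proof (cases i)
    case 0
    then show ?thesis using ideal.subspace_0[OF J]
      by (intro exI[of _ "\<lambda>_. 0"]) (auto simp: y_def kchain_def)
  next
    case (Suc i')
    have "kchain i' y" using Suc by (auto simp: y_def kchain_def split: if_splits)
    moreover have "CARD('x) < i' + Suc d" using i Suc by simp
    ultimately obtain u0 where u0: "\<forall>G. y G - kbd var u0 G \<in> J"
      using Q fy unfolding koszul_vanish_def by blast
    \<comment> \<open>The bounding chain may have parts in other homological degrees; they contribute nothing to \<open>y\<close>.\<close>
    define u where "u F = (if card F = i then u0 F else 0)" for F
    have "y G - kbd var u G \<in> J" for G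
      using u0[rule_format, of G] ideal.subspace_0[OF J] unfolding u_def kbd_restrict_card
      by (cases "Suc (card G) = i") (simp_all add: y_def)
    moreover have "kchain i u" by (auto simp: u_def kchain_def split: if_splits)
    ultimately show ?thesis by blast
  qed
  then obtain u where u: "kchain i u" "\<forall>G. y G - kbd var u G \<in> J" by blast
  have "kchain i (\<lambda>F. z F - f * u F)"
    using z u(1) unfolding kchain_def by (metis diff_zero mult_zero_right)
  moreover have "kbd var (\<lambda>F. z F - f * u F) G \<in> J" for G
  proof -
    have "(kbd var z G - f * y G) + f * (y G - kbd var u G) \<in> J"
      using y u(2) by (intro ideal.subspace_add[OF J] ideal.subspace_scale[OF J]) blast+
    then show ?thesis unfolding kbd_diff kbd_scale by (simp add: algebra_simps)
  qed
  moreover have "CARD('x) < i + Suc d" using i by simp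
  ultimately obtain w where w: "\<forall>F. (z F - f * u F) - kbd var w F \<in> J"
    using Q unfolding koszul_vanish_def by blast
  have "z F - kbd var w F \<in> ?J" for F
    unfolding span_insert_ideal[OF J] using w by (intro exI[of _ "u F"]) (simp add: algebra_simps)
  then show "\<exists>w. \<forall>F. z F - kbd var w F \<in> ?J" by blast
qed

lemma koszul_vanish_0: "ideal.subspace J \<Longrightarrow> koszul_vanish (J :: ('x::finite, 'k::field) mpoly set) 0"
  unfolding koszul_vanish_def
proof (intro allI impI)
  fix i and z :: "'x set \<Rightarrow> ('x, 'k) mpoly"
  assume J: "ideal.subspace J" and "CARD('x) < i + 0" "kchain i z"
  then have "z F = 0" for F
    using card_mono[of UNIV F] by (auto simp: kchain_def)
  then show "\<exists>w. \<forall>F. z F - kbd var w F \<in> J"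
    using ideal.subspace_0[OF J] by (intro exI[of _ "\<lambda>_. 0"]) simp
qed

text \<open>
  A class that is annihilated by all variables is the same as a class in $H_n$. Where $H_n$ vanishes, the
  ideal of the variables therefore does not consist of zero divisors only.
\<close>

lemma koszul_vanish_ex_nzd:
  fixes J :: "('x::finite, 'k::field) mpoly set"
  assumes J: "ideal.subspace J" and Q: "koszul_vanish J (Suc d)"
  shows "\<exists>f\<in>max_ideal. \<forall>g. f * g \<in> J \<longrightarrow> g \<in> J"
proof (rule ccontr)
  assume "\<not> ?thesis"
  then have "\<And>f. f \<in> max_ideal \<Longrightarrow> \<exists>g. g \<notin> J \<and> f * g \<in> J" by blast
  then obtain g where g: "g \<notin> J" "\<forall>f\<in>max_ideal. f * g \<in> J"
    using zero_divisors_annihilate_common[OF J subspace_max_ideal] by blast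
  \<comment> \<open>The entries of the boundary of \<open>z\<close> are the products of \<open>g\<close> with the variables, up to sign.\<close>
  define z :: "'x set \<Rightarrow> ('x, 'k) mpoly" where "z F = (if F = UNIV then g else 0)" for F
  have "kchain (CARD('x)) z" by (auto simp: kchain_def z_def split: if_splits)
  moreover have "\<forall>G. kbd var z G \<in> J"
    unfolding kbd_def
  proof (intro allI, rule ideal.subspace_sum[OF J])
    fix G v
    have "var v * g \<in> J" using g(2) var_in_max_ideal by blast
    then show "ksign v G * var v * z (insert v G) \<in> J"
      using ideal.subspace_0[OF J] ideal.subspace_scale[OF J, of "var v * g" "ksign v G"]
      by (auto simp: z_def mult.assoc)
  qed
  moreover have "CARD('x) < CARD('x) + Suc d" by simp
  ultimately obtain w where "\<forall>F. z F - kbd var w F \<in> J"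
    using Q unfolding koszul_vanish_def by blast
  then have "z UNIV - kbd var w UNIV \<in> J" by blast
  then show False using g(1) by (simp add: z_def kbd_def)
qed

lemma max_ideal_iff:
  fixes p :: "('x::finite, 'k::field) mpoly"
  shows "p \<in> max_ideal \<longleftrightarrow> lookup p 0 = 0"
proof
  assume "p \<in> max_ideal"
  then obtain a where "p = (\<Sum>v\<in>UNIV. a v * var v)" by (rule max_ideal_explicit)
  then have "lookup p 0 = (\<Sum>v\<in>UNIV. lookup (var v * a v) 0)"
    by (simp add: lookup_sum mult.commute)
  then show "lookup p 0 = 0" by (simp add: lookup_var_mult)
next
  assume p0: "lookup p 0 = 0"
  have "(\<Sum>k\<in>keys p. single k (lookup p k)) \<in> max_ideal"
  proof (rule ideal.subspace_sum[OF subspace_max_ideal])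
    fix k assume "k \<in> keys p"
    then have "k \<noteq> 0" using p0 by (auto simp: in_keys_iff)
    then obtain v where v: "lookup k v \<noteq> 0" by (metis lookup_zero poly_mapping_eqI)
    have "k = (k - single v 1) + single v 1"
      using v by (intro poly_mapping_eqI) (auto simp: lookup_add lookup_minus lookup_single when_def)
    then have "single k (lookup p k) =
        single (k - single v 1) (lookup p k) * var v"
      unfolding var_def mult_single by simp
    then show "single k (lookup p k) \<in> max_ideal"
      using ideal.subspace_scale[OF subspace_max_ideal var_in_max_ideal[of v]] by simp
  qed
  then show "p \<in> max_ideal" by (simp flip: poly_mapping_sum_singles)
qed

lemma one_notin_max_ideal: "1 \<notin> (max_ideal :: ('x::finite, 'k::field) mpoly set)"
  by (simp add: max_ideal_iff)

lemma ideal_gen_Un_ideal_gen: "ideal_gen (ideal_gen A \<union> B) = ideal_gen (A \<union> B)"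
  unfolding ideal_gen_eq_span ideal.span_Un by (simp add: ideal.span_span)

lemma ideal_gen_take_Suc_Cons: "ideal_gen (J \<union> set (take (Suc i) (f # fs))) = ideal_gen (ideal_gen (J \<union> {f}) \<union> set (take i fs))"
  by (simp add: ideal_gen_Un_ideal_gen Un_insert_left Un_insert_right)

lemma regular_imp_koszul_vanish:
  fixes J :: "('x::finite, 'k::field) mpoly set"
  assumes "ideal.subspace J" "set fs \<subseteq> max_ideal" "quot_regular_seq J fs"
  shows "koszul_vanish J (length fs)"
  using assms
proof (induction fs arbitrary: J)
  case Nil
  then show ?case by (simp add: koszul_vanish_0)
next
  case (Cons f fs)
  note reg = Cons.prems(3)[unfolded quot_regular_seq_def, THEN conjunct1, rule_format]
  have JJ: "ideal_gen J = J" using Cons.prems(1) by (simp add: ideal_gen_eq_span)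
  have nzd: "g \<in> J" if "f * g \<in> J" for g
    using reg[of 0 g] that by (simp add: JJ)
  have "quot_regular_seq (ideal_gen (J \<union> {f})) fs"
    unfolding quot_regular_seq_def
  proof (intro conjI allI impI)
    fix i g assume "i < length fs" "fs ! i * g \<in> ideal_gen (ideal_gen (J \<union> {f}) \<union> set (take i fs))"
    then show "g \<in> ideal_gen (ideal_gen (J \<union> {f}) \<union> set (take i fs))"
      using reg[of "Suc i" g] unfolding ideal_gen_take_Suc_Cons by simp
  next
    show "ideal_gen (ideal_gen (J \<union> {f}) \<union> set fs) \<noteq> UNIV"
      using Cons.prems(3)[unfolded quot_regular_seq_def, THEN conjunct2]
      by (simp add: ideal_gen_Un_ideal_gen)
  qed
  then have "koszul_vanish (ideal_gen (J \<union> {f})) (length fs)"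
    using Cons.prems(2) by (intro Cons.IH subspace_ideal_gen) auto
  then show ?case
    using koszul_vanish_lift[OF Cons.prems(1), of f "length fs"] nzd Cons.prems(2) by simp
qed

lemma koszul_vanish_imp_regular:
  fixes J :: "('x::finite, 'k::field) mpoly set"
  assumes "ideal.subspace J" "J \<subseteq> max_ideal" "koszul_vanish J d"
  shows "\<exists>fs. length fs = d \<and> set fs \<subseteq> max_ideal \<and> quot_regular_seq J fs"
  using assms
proof (induction d arbitrary: J)
  case 0
  then have "ideal_gen J = J" by (simp add: ideal_gen_eq_span)
  then show ?case using 0 one_notin_max_ideal
    by (intro exI[of _ "[]"]) (auto simp: quot_regular_seq_def)
next
  case (Suc d)
  obtain f where f: "f \<in> max_ideal" and nzd: "\<And>g. f * g \<in> J \<Longrightarrow> g \<in> J"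
    using koszul_vanish_ex_nzd[OF Suc.prems(1,3)] by blast
  let ?J = "ideal_gen (J \<union> {f})"
  have "?J \<subseteq> max_ideal"
    unfolding ideal_gen_eq_span using Suc.prems(2) f by (intro ideal.span_minimal subspace_max_ideal) auto
  then obtain fs where fs: "length fs = d" "set fs \<subseteq> max_ideal" "quot_regular_seq ?J fs"
    using Suc.IH[OF subspace_ideal_gen _ koszul_vanish_quotient[OF Suc.prems(1) nzd Suc.prems(3)]] by blast
  note reg = fs(3)[unfolded quot_regular_seq_def, THEN conjunct1, rule_format]
  have JJ: "ideal_gen J = J" using Suc.prems(1) by (simp add: ideal_gen_eq_span)
  have "quot_regular_seq J (f # fs)"
    unfolding quot_regular_seq_def
  proof (intro conjI allI impI)
    fix i g assume i: "i < length (f # fs)" "(f # fs) ! i * g \<in> ideal_gen (J \<union> set (take i (f # fs)))"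
    show "g \<in> ideal_gen (J \<union> set (take i (f # fs)))"
    proof (cases i)
      case 0
      then show ?thesis using i nzd by (simp add: JJ)
    next
      case (Suc i')
      then show ?thesis using i reg[of i' g] unfolding Suc ideal_gen_take_Suc_Cons by simp
    qed
  next
    show "ideal_gen (J \<union> set (f # fs)) \<noteq> UNIV"
      using fs(3)[unfolded quot_regular_seq_def, THEN conjunct2]
      by (simp add: ideal_gen_Un_ideal_gen)
  qed
  then show ?case using fs f by (intro exI[of _ "f # fs"]) auto
qed

text \<open>
  Any regular sequence on $R/J$ is replaced by one of the same length on $R/J'$.
\<close>

lemma quot_depth_mono:
  fixes J J' :: "('x::finite, 'k::field) mpoly set"
  assumes "ideal.subspace J" "ideal.subspace J'" "J' \<subseteq> max_ideal"
    and "\<And>d. koszul_vanish J d \<Longrightarrow> koszul_vanish J' d"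
  shows "quot_depth J \<le> quot_depth J'"
  unfolding quot_depth_def
proof (rule SUP_least)
  fix fs assume "fs \<in> {fs. set fs \<subseteq> max_ideal \<and> quot_regular_seq J fs}"
  then have "koszul_vanish J' (length fs)" using assms(1,4) regular_imp_koszul_vanish by blast
  then obtain fs' where "length fs' = length fs" "set fs' \<subseteq> max_ideal \<and> quot_regular_seq J' fs'"
    using koszul_vanish_imp_regular[OF assms(2,3)] by blast
  then show "enat (length fs) \<le> (SUP fs \<in> {fs. set fs \<subseteq> max_ideal \<and> quot_regular_seq J' fs}. enat (length fs))"
    by (intro SUP_upper2[of fs']) auto
qed

section \<open>Betti numbers and Koszul homology\<close>

text \<open>
  The component of degree \<open>t\<close>. Degrees are integers, so that the components of negative degree, which
  arise from shifts, are simply zero.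
\<close>

definition hom_part :: "int \<Rightarrow> ('x::finite, 'k::field) mpoly \<Rightarrow> ('x, 'k) mpoly" where
  "hom_part t p = Poly_Mapping.mapp (\<lambda>m c. if int (mdeg m) = t then c else 0) p"

lemma lookup_hom_part:
  "lookup (hom_part t p) m = (if int (mdeg m) = t then lookup p m else 0)"
  by (auto simp: hom_part_def lookup_mapp when_def in_keys_iff)

lemma hom_part_add: "hom_part t (p + q) = hom_part t p + hom_part t q"
  by (rule poly_mapping_eqI) (simp add: lookup_hom_part lookup_add)

lemma hom_part_zero [simp]: "hom_part t 0 = 0"
  by (rule poly_mapping_eqI) (simp add: lookup_hom_part)

lemma hom_part_sum: "hom_part t (\<Sum>i\<in>A. f i) = (\<Sum>i\<in>A. hom_part t (f i))"
  by (induction A rule: infinite_finite_induct) (simp_all add: hom_part_add)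

lemma hom_part_hom_part [simp]: "hom_part t (hom_part t p) = hom_part t p"
  by (rule poly_mapping_eqI) (simp add: lookup_hom_part)

definition is_hom :: "int \<Rightarrow> ('x::finite, 'k::field) mpoly \<Rightarrow> bool" where
  "is_hom t p \<longleftrightarrow> hom_part t p = p"

lemma is_hom_hom_part [simp]: "is_hom t (hom_part t p)" by (simp add: is_hom_def)

lemma is_hom_zero [simp]: "is_hom t 0" by (simp add: is_hom_def)

lemma is_hom_iff: "is_hom t p \<longleftrightarrow> (\<forall>m\<in>keys p. int (mdeg m) = t)"
  by (auto simp: is_hom_def poly_mapping_eq_iff fun_eq_iff lookup_hom_part in_keys_iff)

lemma is_hom_int_iff_homogeneous:
  "is_hom (int s - int t) p \<longleftrightarrow> (if t \<le> s then homogeneous (s - t) p else p = 0)"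
proof -
  have "int (mdeg m) = int s - int t \<longleftrightarrow> t \<le> s \<and> mdeg m = s - t" for m :: "'a \<Rightarrow>\<^sub>0 nat" by auto
  then show ?thesis
    by (auto simp: is_hom_iff homogeneous_def poly_mapping_eq_iff fun_eq_iff in_keys_iff)
qed

lemma hom_part_single_mult:
  "hom_part t (single m c * q) = single m c * hom_part (t - int (mdeg m)) q"
proof (rule poly_mapping_eqI)
  fix n
  show "lookup (hom_part t (single m c * q)) n =
      lookup (single m c * hom_part (t - int (mdeg m)) q) n"
  proof (cases "\<exists>k. n = m + k")
    case True
    then obtain k where "n = m + k" by blast
    then show ?thesis by (auto simp: lookup_hom_part lookup_single_mult mdeg_add)
  next
    case False
    then show ?thesis by (simp add: lookup_hom_part lookup_single_mult_0)
  qed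
qed

lemma hom_part_mult:
  assumes "is_hom s p"
  shows "hom_part t (p * q) = p * hom_part (t - s) q"
proof -
  have "hom_part t (p * q) =
     (\<Sum>k\<in>keys p. hom_part t (single k (lookup p k) * q))"
    by (subst (1) poly_mapping_sum_singles[of p]) (simp add: sum_distrib_right hom_part_sum)
  also have "\<dots> = (\<Sum>k\<in>keys p. single k (lookup p k) * hom_part (t - s) q)"
    using assms by (intro sum.cong) (auto simp: is_hom_iff hom_part_single_mult)
  also have "\<dots> = p * hom_part (t - s) q"
    by (subst (3) poly_mapping_sum_singles[of p]) (simp add: sum_distrib_right)
  finally show ?thesis .
qed

lemma mdeg_single: "mdeg (single v n) = n"
  by (simp add: mdeg_def lookup_single when_def)

lemma is_hom_var: "is_hom 1 (var v)"
  by (auto simp: is_hom_iff var_def mdeg_single)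

lemma hom_part_ksign_mult: "hom_part t (ksign v F * p) = ksign v F * hom_part t p"
  by (rule poly_mapping_eqI) (simp add: lookup_hom_part lookup_ksign_mult)

lemma kbd_hom_part: "kbd var (\<lambda>F. hom_part (t - 1) (z F)) G = hom_part t (kbd var z G)"
  by (simp add: kbd_def hom_part_sum mult.assoc hom_part_ksign_mult hom_part_mult[OF is_hom_var])

text \<open>
  The image of the Koszul differential in homological degree \<open>0\<close> is the ideal of the variables.
\<close>

lemma max_ideal_boundary:
  fixes f :: "('x::finite, 'k::field) mpoly"
  assumes "f \<in> max_ideal"
  shows "\<exists>s. \<forall>F. (if F = {} then f else 0) = kbd var s F"
proof -
  obtain a where a: "f = (\<Sum>v\<in>UNIV. a v * var v)" using assms by (rule max_ideal_explicit)
  define e :: "'x set \<Rightarrow> ('x, 'k) mpoly" where "e F = (if F = {} then 1 else 0)" for F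
  have "kbd var e = (\<lambda>_. 0)" by (rule ext) (simp add: kbd_def e_def)
  then have "wedge v (kbd var e) F = 0" for v F by (simp add: wedge_def)
  then have "kbd var (\<lambda>F. \<Sum>v\<in>UNIV. a v * wedge v e F) F = (if F = {} then f else 0)" for F
    using koszul_homotopy[OF a, of e F] by (simp add: e_def)
  then show ?thesis by (intro exI[of _ "\<lambda>F. \<Sum>v\<in>UNIV. a v * wedge v e F"]) simp
qed

text \<open>
  Application of an \<open>r\<close> by \<open>s\<close> matrix to a vector, with vectors encoded as functions that vanish beyond
  their length. Coordinatewise application to families of Koszul chains then needs no length
  bookkeeping.
\<close>

definition mat_app :: "nat \<Rightarrow> nat \<Rightarrow> (nat \<Rightarrow> nat \<Rightarrow> 'r::comm_ring_1) \<Rightarrow> (nat \<Rightarrow> 'r) \<Rightarrow> nat \<Rightarrow> 'r" where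
  "mat_app r s M u a = (if a < r then \<Sum>b<s. M a b * u b else 0)"

text \<open>
  An ideal as a submodule of the free module of rank one.
\<close>

abbreviation (input) "rank_one J \<equiv> {u :: nat \<Rightarrow> _. (\<forall>b\<ge>1. u b = 0) \<and> u 0 \<in> J}"

abbreviation (input) "mat_ker r s M \<equiv> {u. (\<forall>b\<ge>s. u b = 0) \<and> (\<forall>a. mat_app r s M u a = 0)}"

lemma mat_app_kbd:
  "kbd x (\<lambda>F. mat_app r s M (\<lambda>b. u b F) a) G = mat_app r s M (\<lambda>b. kbd x (u b) G) a"
  by (simp add: mat_app_def kbd_sum kbd_scale)

lemma mat_app_diff: "mat_app r s M (\<lambda>b. u b - w b) a = mat_app r s M u a - mat_app r s M w a"
  by (simp add: mat_app_def right_diff_distrib sum_subtractf)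

lemma mat_app_zero: "mat_app r s M (\<lambda>b. 0) a = 0"
  by (simp add: mat_app_def)

lemma mat_app_cong: "(\<And>b. b < s \<Longrightarrow> u b = w b) \<Longrightarrow> mat_app r s M u = mat_app r s M w"
  by (rule ext) (auto simp: mat_app_def)

lemma hom_part_mat_app:
  assumes "a < r" "\<And>b. b < s \<Longrightarrow> is_hom (int (d' b) - int (d a)) (M a b)"
  shows "hom_part (t - int (d a)) (mat_app r s M u a) = mat_app r s M (\<lambda>b. hom_part (t - int (d' b)) (u b)) a"
proof -
  have "hom_part (t - int (d a)) (M a b * u b) = M a b * hom_part (t - int (d' b)) (u b)" if "b < s" for b
    using hom_part_mult[OF assms(2)[OF that], of "t - int (d a)" "u b"] by (simp add: algebra_simps)
  then show ?thesis using assms(1) by (simp add: mat_app_def hom_part_sum)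
qed

text \<open>
  A minimal graded free resolution of $R/J$ in terms of functions: \<open>M i\<close> is the matrix of
  $F_{i+1} \to F_i$, \<open>r i\<close> the rank of $F_i$, and \<open>d i b\<close> the degree of its \<open>b\<close>-th basis element. The
  image of \<open>M i\<close> will be written $N_i \subseteq F_i$, so that $F_0/N_0 = R/J$ and
  $F_{i+1}/N_{i+1} \cong N_i$.
\<close>

locale minimal_resolution =
  fixes J :: "('x::finite, 'k::field) mpoly set" and r :: "nat \<Rightarrow> nat" and d :: "nat \<Rightarrow> nat \<Rightarrow> nat"
    and M :: "nat \<Rightarrow> nat \<Rightarrow> nat \<Rightarrow> ('x, 'k) mpoly"
  assumes r0: "r 0 = 1" and d0: "d 0 0 = 0"
    and hom: "\<And>i a b. a < r i \<Longrightarrow> b < r (Suc i) \<Longrightarrow> is_hom (int (d (Suc i) b) - int (d i a)) (M i a b)"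
    and min: "\<And>i a b. a < r i \<Longrightarrow> b < r (Suc i) \<Longrightarrow> M i a b \<in> max_ideal"
    and exact0: "range (mat_app (r 0) (r 1) (M 0)) = rank_one J"
    and exact: "\<And>i. range (mat_app (r (Suc i)) (r (Suc (Suc i))) (M (Suc i))) =
       mat_ker (r i) (r (Suc i)) (M i)"
begin

abbreviation "ap i \<equiv> mat_app (r i) (r (Suc i)) (M i)"

text \<open>
  The Koszul homology $H_p(F_i/N_i)$ is nonzero in degree \<open>j\<close>.
\<close>

definition homol_nonzero :: "nat \<Rightarrow> nat \<Rightarrow> int \<Rightarrow> bool" where
  "homol_nonzero i p j \<longleftrightarrow> (\<exists>z :: nat \<Rightarrow> 'x set \<Rightarrow> ('x, 'k) mpoly.
     (\<forall>b F. b \<ge> r i \<longrightarrow> z b F = 0) \<and> (\<forall>b. kchain p (z b)) \<and>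
     (\<forall>b F. is_hom (j - int (d i b) - int p) (z b F)) \<and>
     (\<forall>G. (\<lambda>b. kbd var (z b) G) \<in> range (ap i)) \<and>
     (\<forall>w. \<exists>F. (\<lambda>b. z b F - kbd var (w b) F) \<notin> range (ap i)))"

lemma range_ap_zero: "(\<lambda>b. 0) \<in> range (ap i)"
  by (rule image_eqI[of _ _ "\<lambda>b. 0"]) (auto simp: mat_app_zero)

lemma range_ap_max_ideal: "u \<in> range (ap i) \<Longrightarrow> u a \<in> max_ideal"
  using min by (auto simp: mat_app_def ideal.subspace_0[OF subspace_max_ideal] mult.commute
      intro!: ideal.subspace_sum[OF subspace_max_ideal] ideal.subspace_scale[OF subspace_max_ideal])

lemma hom_part_ap:
  "a < r i \<Longrightarrow> hom_part (t - int (d i a)) (ap i u a) = ap i (\<lambda>b. hom_part (t - int (d (Suc i) b)) (u b)) a"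
  by (rule hom_part_mat_app) (auto intro: hom)

text \<open>
  Together with the next lemma this is dimension shifting along
  $0 \to N_i \to F_i \to F_i/N_i \to 0$: the Koszul homology of $F_i$ vanishes in positive homological
  degrees, so $H_{p+1}(F_i/N_i) \cong H_p(N_i) \cong H_p(F_{i+1}/N_{i+1})$. Here the connecting
  homomorphism is applied to \<open>z\<close>: the boundary of \<open>z\<close> has values in $N_i$ and lifts to \<open>u\<close>.
\<close>

lemma homol_nonzero_shift_up:
  assumes "homol_nonzero i (Suc p) j"
  shows "homol_nonzero (Suc i) p j"
proof -
  obtain z where zs: "\<forall>b F. b \<ge> r i \<longrightarrow> z b F = 0" and zc: "\<forall>b. kchain (Suc p) (z b)"
    and zh: "\<forall>b F. is_hom (j - int (d i b) - int (Suc p)) (z b F)"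
    and zb: "\<forall>G. (\<lambda>b. kbd var (z b) G) \<in> range (ap i)"
    and zn: "\<forall>w. \<exists>F. (\<lambda>b. z b F - kbd var (w b) F) \<notin> range (ap i)"
    using assms unfolding homol_nonzero_def by (elim exE conjE)
  have "\<forall>G. \<exists>x. (\<lambda>b. kbd var (z b) G) = ap i x" using zb by blast
  then obtain X where X: "\<forall>G. (\<lambda>b. kbd var (z b) G) = ap i (X G)" by (rule choice[THEN exE])
  define u where "u b G = (if b < r (Suc i) \<and> card G = p then hom_part (j - int (d (Suc i) b) - int p) (X G b) else 0)" for b G
  have z_restrict: "kbd var (z a) G = 0" if "card G \<noteq> p" for a G
  proof -
    have "kchain (Suc p) (z a)" using zc by blast
    then have "z a = (\<lambda>F. if card F = Suc p then z a F else 0)" unfolding kchain_def by (intro ext) metis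
    then show ?thesis using kbd_restrict_card[of var "Suc p" "z a" G] that by simp
  qed
  have ap_u: "ap i (\<lambda>b. u b G) a = kbd var (z a) G" for a G
  proof (cases "a < r i \<and> card G = p")
    case False
    then consider "a \<ge> r i" | "card G \<noteq> p" by linarith
    then show ?thesis
    proof cases
      case 1
      then have "z a = (\<lambda>_. 0)" using zs by blast
      then show ?thesis using 1 by (simp add: mat_app_def)
    next
      case 2
      then show ?thesis using z_restrict[of G a] by (simp add: u_def mat_app_zero)
    qed
  next
    case True
    have "ap i (\<lambda>b. u b G) = ap i (\<lambda>b. hom_part ((j - int p) - int (d (Suc i) b)) (X G b))"
      by (rule mat_app_cong) (use True in \<open>simp add: u_def algebra_simps\<close>)
    then have "ap i (\<lambda>b. u b G) a = hom_part ((j - int p) - int (d i a)) (ap i (X G) a)"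
      using hom_part_ap[of a i "j - int p" "X G"] True by simp
    also have "ap i (X G) a = kbd var (z a) G" using X by (metis (no_types))
    also have "hom_part ((j - int p) - int (d i a)) (kbd var (z a) G) =
       kbd var (\<lambda>F. hom_part ((j - int p) - int (d i a) - 1) (z a F)) G" by (simp add: kbd_hom_part)
    also have "(\<lambda>F. hom_part ((j - int p) - int (d i a) - 1) (z a F)) = z a"
      using zh by (auto simp: is_hom_def fun_eq_iff algebra_simps)
    finally show ?thesis .
  qed
  have 1: "\<forall>b F. b \<ge> r (Suc i) \<longrightarrow> u b F = 0" by (simp add: u_def)
  have 2: "\<forall>b. kchain p (u b)" by (auto simp: kchain_def u_def split: if_splits)
  have 3: "\<forall>b F. is_hom (j - int (d (Suc i) b) - int p) (u b F)" by (simp add: u_def)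
  have 4: "\<forall>G. (\<lambda>b. kbd var (u b) G) \<in> range (ap (Suc i))"
  proof
    fix G
    have "ap i (\<lambda>b. kbd var (u b) G) a = 0" for a
      unfolding mat_app_kbd[symmetric] ap_u by (rule kbd_kbd)
    moreover have "kbd var (u b) G = 0" if "b \<ge> r (Suc i)" for b
    proof -
      have "u b = (\<lambda>_. 0)" using 1 that by blast
      then show ?thesis by simp
    qed
    ultimately show "(\<lambda>b. kbd var (u b) G) \<in> range (ap (Suc i))" unfolding exact by blast
  qed
  have 5: "\<forall>w. \<exists>F. (\<lambda>b. u b F - kbd var (w b) F) \<notin> range (ap (Suc i))"
  proof (rule ccontr)
    assume "\<not> ?thesis"
    then obtain w where w: "\<forall>F. (\<lambda>b. u b F - kbd var (w b) F) \<in> range (ap (Suc i))" by blast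
    define W where "W a F = (if card F = Suc p then ap i (\<lambda>b. w b F) a else 0)" for a F
    have kW: "kbd var (z a) G = kbd var (W a) G" for a G
    proof -
      have "ap i (\<lambda>b. u b G - kbd var (w b) G) a = 0" using w unfolding exact by blast
      then have "kbd var (z a) G = kbd var (\<lambda>F. ap i (\<lambda>b. w b F) a) G"
        unfolding mat_app_diff ap_u mat_app_kbd by simp
      then show ?thesis using z_restrict[of G a] unfolding W_def kbd_restrict_card by simp
    qed
    have "\<forall>a. \<exists>s. \<forall>F. z a F - W a F = kbd var s F"
    proof
      fix a
      show "\<exists>s. \<forall>F. z a F - W a F = kbd var s F"
      proof (rule koszul_acyclic)
        show "kchain (Suc p) (\<lambda>F. z a F - W a F)"
          unfolding kchain_def
        proof (intro allI impI, rule ccontr)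
          fix F assume nz: "z a F - W a F \<noteq> 0" and F: "card F \<noteq> Suc p"
          have "z a F = 0" using zc F unfolding kchain_def by blast
          with nz F show False by (simp add: W_def)
        qed
        show "kbd var (\<lambda>F. z a F - W a F) G = 0" for G unfolding kbd_diff by (simp add: kW)
      qed simp
    qed
    then obtain s where s: "\<forall>a F. z a F - W a F = kbd var (s a) F" by (rule choice[THEN exE])
    have "(\<lambda>b. z b F - kbd var (s b) F) \<in> range (ap i)" for F
    proof -
      have "(\<lambda>b. z b F - kbd var (s b) F) = (\<lambda>b. W b F)"
        using s by (auto simp: fun_eq_iff algebra_simps)
      also have "\<dots> \<in> range (ap i)"
      proof (cases "card F = Suc p")
        case True
        then have "(\<lambda>b. W b F) = ap i (\<lambda>b. w b F)" by (simp add: W_def fun_eq_iff)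
        then show ?thesis by simp
      next
        case False
        then show ?thesis using range_ap_zero by (simp add: W_def)
      qed
      finally show ?thesis .
    qed
    with zn show False by blast
  qed
  show ?thesis unfolding homol_nonzero_def using 1 2 3 4 5 by (intro exI[of _ u] conjI)
qed

text \<open>
  The inverse of the connecting homomorphism. For \<open>p = 0\<close> the vanishing of homology is not available;
  there minimality of the resolution takes over, because the image of \<open>u\<close> has entries in the ideal of
  the variables and is therefore a Koszul boundary.
\<close>

lemma homol_nonzero_shift_down:
  assumes "homol_nonzero (Suc i) p j"
  shows "homol_nonzero i (Suc p) j"
proof -
  obtain u where us: "\<forall>b F. b \<ge> r (Suc i) \<longrightarrow> u b F = 0" and uc: "\<forall>b. kchain p (u b)"
    and uh: "\<forall>b F. is_hom (j - int (d (Suc i) b) - int p) (u b F)"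
    and ub: "\<forall>G. (\<lambda>b. kbd var (u b) G) \<in> range (ap (Suc i))"
    and un: "\<forall>w. \<exists>F. (\<lambda>b. u b F - kbd var (w b) F) \<notin> range (ap (Suc i))"
    using assms unfolding homol_nonzero_def by (elim exE conjE)
  define y where "y a F = ap i (\<lambda>b. u b F) a" for a F
  have kby: "kbd var (y a) G = 0" for a G
  proof -
    have "ap i (\<lambda>b. kbd var (u b) G) a = 0" using ub unfolding exact by blast
    then show ?thesis unfolding y_def mat_app_kbd .
  qed
  have yc: "kchain p (y a)" for a
    unfolding kchain_def
  proof (intro allI impI)
    fix F assume nz: "y a F \<noteq> 0"
    show "card F = p"
    proof (rule ccontr)
      assume "card F \<noteq> p"
      then have "(\<lambda>b. u b F) = (\<lambda>b. 0)" using uc unfolding kchain_def by blast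
      then show False using nz by (simp add: y_def mat_app_zero)
    qed
  qed
  have yh: "hom_part (j - int (d i a) - int p) (y a F) = y a F" if "a < r i" for a F
  proof -
    have "(\<lambda>b. hom_part ((j - int p) - int (d (Suc i) b)) (u b F)) = (\<lambda>b. u b F)"
      using uh by (auto simp: is_hom_def fun_eq_iff algebra_simps)
    then show ?thesis unfolding y_def using hom_part_ap[OF that, of "j - int p" "\<lambda>b. u b F"]
      by (simp add: algebra_simps)
  qed
  have "\<forall>a. \<exists>s. \<forall>F. y a F = kbd var s F"
  proof
    fix a
    show "\<exists>s. \<forall>F. y a F = kbd var s F"
    proof (cases "p = 0")
      case False
      then show ?thesis using yc kby by (intro koszul_acyclic[of p]) auto
    next
      case True
      have "y a {} \<in> max_ideal" unfolding y_def by (rule range_ap_max_ideal) blast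
      moreover have yF: "(if F = {} then y a {} else 0) = y a F" for F
      proof (cases "F = {}")
        case False
        then have "card F \<noteq> p" using True by simp
        then have "y a F = 0" using yc[of a] unfolding kchain_def by blast
        then show ?thesis using False by simp
      qed simp
      ultimately show ?thesis using max_ideal_boundary[of "y a {}"] unfolding yF by blast
    qed
  qed
  then obtain s where s: "\<forall>a F. y a F = kbd var (s a) F" by (rule choice[THEN exE])
  define z where "z a F = (if card F = Suc p then (if a < r i then hom_part (j - int (d i a) - int (Suc p)) (s a F) else 0) else 0)" for a F
  have kz: "kbd var (z a) G = y a G" for a G
  proof (cases "card G = p")
    case False
    then have "y a G = 0" using yc[of a] by (auto simp: kchain_def)
    then show ?thesis using False unfolding z_def kbd_restrict_card by simp
  next
    case True
    show ?thesis
    proof (cases "a < r i")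
      case False
      then have "z a = (\<lambda>_. 0)" by (simp add: z_def fun_eq_iff)
      then show ?thesis using False by (simp add: y_def mat_app_def)
    next
      case a: True
      have "kbd var (z a) G = kbd var (\<lambda>F. hom_part (j - int (d i a) - int p - 1) (s a F)) G"
        unfolding z_def kbd_restrict_card using True a by (simp add: algebra_simps)
      also have "\<dots> = hom_part (j - int (d i a) - int p) (kbd var (s a) G)" by (rule kbd_hom_part)
      also have "\<dots> = y a G" using s yh[OF a] by simp
      finally show ?thesis .
    qed
  qed
  have 1: "\<forall>b F. b \<ge> r i \<longrightarrow> z b F = 0" by (simp add: z_def)
  have 2: "\<forall>b. kchain (Suc p) (z b)" by (auto simp: kchain_def z_def split: if_splits)
  have 3: "\<forall>b F. is_hom (j - int (d i b) - int (Suc p)) (z b F)" by (simp add: z_def)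
  have 4: "\<forall>G. (\<lambda>b. kbd var (z b) G) \<in> range (ap i)"
    unfolding kz y_def by blast
  have 5: "\<forall>w. \<exists>F. (\<lambda>b. z b F - kbd var (w b) F) \<notin> range (ap i)"
  proof (rule ccontr)
    assume "\<not> ?thesis"
    then obtain w where "\<forall>F. (\<lambda>b. z b F - kbd var (w b) F) \<in> range (ap i)" by blast
    then have "\<forall>F. \<exists>x. (\<lambda>b. z b F - kbd var (w b) F) = ap i x" by blast
    then obtain x where x: "\<forall>F. (\<lambda>b. z b F - kbd var (w b) F) = ap i (x F)" by (rule choice[THEN exE])
    define t where "t b F = (if b < r (Suc i) then x F b else 0)" for b F
    have "(\<lambda>b. u b G - kbd var (t b) G) \<in> range (ap (Suc i))" for G
    proof -
      have xt: "z a F - kbd var (w a) F = ap i (\<lambda>b. t b F) a" for a F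
      proof -
        have "ap i (\<lambda>b. t b F) = ap i (x F)" by (rule mat_app_cong) (simp add: t_def)
        then show ?thesis using x by (metis (no_types))
      qed
      have "ap i (\<lambda>b. u b G - kbd var (t b) G) a = 0" for a
      proof -
        have "ap i (\<lambda>b. kbd var (t b) G) a = kbd var (\<lambda>F. z a F - kbd var (w a) F) G"
          unfolding mat_app_kbd[symmetric] xt ..
        also have "\<dots> = y a G" unfolding kbd_diff kbd_kbd kz by simp
        finally show ?thesis unfolding mat_app_diff y_def by simp
      qed
      moreover have "u b G - kbd var (t b) G = 0" if "b \<ge> r (Suc i)" for b
      proof -
        have "t b = (\<lambda>_. 0)" using that by (auto simp: t_def)
        then show ?thesis using us that by simp
      qed
      ultimately show ?thesis unfolding exact by blast
    qed
    with un show False by blast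
  qed
  show ?thesis unfolding homol_nonzero_def using 1 2 3 4 5 by (intro exI[of _ z] conjI)
qed

lemma homol_nonzero_shift: "homol_nonzero i p j \<longleftrightarrow> homol_nonzero (i + p) 0 j"
proof (induction p arbitrary: i)
  case (Suc p)
  have "homol_nonzero i (Suc p) j \<longleftrightarrow> homol_nonzero (Suc i) p j" using homol_nonzero_shift_up homol_nonzero_shift_down by blast
  then show ?case using Suc[of "Suc i"] by simp
qed simp

text \<open>
  By minimality $H_0(F_i/N_i)$ is $F_i/\mathfrak{m} F_i$, which has one basis element for each basis element
  of $F_i$.
\<close>

lemma homol_nonzero_0_iff: "homol_nonzero i 0 j \<longleftrightarrow> (\<exists>b<r i. int (d i b) = j)"
proof
  assume "homol_nonzero i 0 j"
  then obtain z where zs: "\<forall>b F. b \<ge> r i \<longrightarrow> z b F = 0" and zc: "\<forall>b. kchain 0 (z b)"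
    and zh: "\<forall>b F. is_hom (j - int (d i b) - int 0) (z b F)"
    and zn: "\<forall>w. \<exists>F. (\<lambda>b. z b F - kbd var (w b) F) \<notin> range (ap i)"
    unfolding homol_nonzero_def by (elim exE conjE)
  show "\<exists>b<r i. int (d i b) = j"
  proof (rule ccontr)
    assume neg: "\<not> ?thesis"
    have "\<forall>b. \<exists>s. \<forall>F. z b F = kbd var s F"
    proof
      fix b
      have "z b {} \<in> max_ideal"
      proof (cases "b < r i")
        case True
        then have ne: "int (mdeg (0 :: 'x \<Rightarrow>\<^sub>0 nat)) \<noteq> j - int (d i b)" using neg by (auto simp: mdeg_def)
        have "is_hom (j - int (d i b)) (z b {})" using zh by simp
        then have "0 \<notin> keys (z b {})" using ne unfolding is_hom_iff by blast
        then show ?thesis by (simp add: max_ideal_iff in_keys_iff)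
      next
        case False
        then show ?thesis using zs by (simp add: max_ideal_iff)
      qed
      moreover have zF: "(if F = {} then z b {} else 0) = z b F" for F
      proof (cases "F = {}")
        case False
        then have "card F \<noteq> 0" by simp
        moreover have "kchain 0 (z b)" using zc by (rule spec)
        ultimately have "z b F = 0" unfolding kchain_def by metis
        then show ?thesis using False by simp
      qed simp
      ultimately show "\<exists>s. \<forall>F. z b F = kbd var s F" using max_ideal_boundary[of "z b {}"] unfolding zF by blast
    qed
    then obtain s where "\<forall>b F. z b F = kbd var (s b) F" by (rule choice[THEN exE])
    then have "(\<lambda>b. z b F - kbd var (s b) F) = (\<lambda>b. 0)" for F by (metis diff_self)
    then have "(\<lambda>b. z b F - kbd var (s b) F) \<in> range (ap i)" for F using range_ap_zero by metis
    with zn show False by blast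
  qed
next
  assume "\<exists>b<r i. int (d i b) = j"
  then obtain b0 where b0: "b0 < r i" "int (d i b0) = j" by blast
  define z :: "nat \<Rightarrow> 'x set \<Rightarrow> ('x, 'k) mpoly" where "z b F = (if b = b0 \<and> F = {} then 1 else 0)" for b F
  have kz: "kbd var (z b) G = 0" for b G by (simp add: kbd_def z_def)
  have 1: "\<forall>b F. b \<ge> r i \<longrightarrow> z b F = 0" using b0 by (simp add: z_def)
  have 2: "\<forall>b. kchain 0 (z b)" by (auto simp: kchain_def z_def split: if_splits)
  have 3: "\<forall>b F. is_hom (j - int (d i b) - int 0) (z b F)"
    using b0 by (auto simp: z_def is_hom_iff mdeg_def)
  have 4: "\<forall>G. (\<lambda>b. kbd var (z b) G) \<in> range (ap i)"
    unfolding kz using range_ap_zero by blast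
  have 5: "\<forall>w. \<exists>F. (\<lambda>b. z b F - kbd var (w b) F) \<notin> range (ap i)"
  proof (intro allI exI[of _ "{}"] notI)
    fix w assume "(\<lambda>b. z b {} - kbd var (w b) {}) \<in> range (ap i)"
    from range_ap_max_ideal[OF this, of b0] have "1 - kbd var (w b0) {} \<in> max_ideal" by (simp add: z_def)
    moreover have "kbd var (w b0) {} \<in> max_ideal"
      unfolding kbd_def
    proof (rule ideal.subspace_sum[OF subspace_max_ideal])
      fix v
      show "ksign v {} * var v * w b0 {v} \<in> max_ideal"
        using ideal.subspace_scale[OF subspace_max_ideal var_in_max_ideal[of v], of "ksign v {} * w b0 {v}"]
        by (simp add: mult.commute mult.left_commute)
    qed
    ultimately have "1 - kbd var (w b0) {} + kbd var (w b0) {} \<in> max_ideal"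
      by (rule ideal.subspace_add[OF subspace_max_ideal])
    then show False using one_notin_max_ideal[where 'x='x and 'k='k] by simp
  qed
  show "homol_nonzero i 0 j" unfolding homol_nonzero_def using 1 2 3 4 5 by (intro exI[of _ z] conjI)
qed

lemma homol_nonzero_start_iff:
  assumes J: "J = {f. keys f \<subseteq> U}"
  shows "homol_nonzero 0 p j \<longleftrightarrow> (\<exists>a. int (mdeg a) = j \<and> koszul_nonzero TYPE('k) U p a)"
proof
  have rg: "range (ap 0) = rank_one J" using exact0 by simp
  {
    assume "homol_nonzero 0 p j"
    then obtain z where zs: "\<forall>b F. b \<ge> r 0 \<longrightarrow> z b F = 0" and zc: "\<forall>b. kchain p (z b)"
      and zh: "\<forall>b F. is_hom (j - int (d 0 b) - int p) (z b F)"
      and zb: "\<forall>G. (\<lambda>b. kbd var (z b) G) \<in> range (ap 0)"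
      and zn: "\<forall>w. \<exists>F. (\<lambda>b. z b F - kbd var (w b) F) \<notin> range (ap 0)"
      unfolding homol_nonzero_def by (elim exE conjE)
    show "\<exists>a. int (mdeg a) = j \<and> koszul_nonzero TYPE('k) U p a"
    proof (rule ccontr)
      assume neg: "\<not> ?thesis"
      have "\<exists>w. \<forall>F. keys (z 0 F - kbd var w F) \<subseteq> U"
      proof (rule koszul_zero_imp_boundary)
        show "kchain p (z 0)" using zc by blast
        show "keys (kbd var (z 0) G) \<subseteq> U" for G
          using zb[rule_format, of G] unfolding rg J by simp
        fix F m assume m: "m \<in> keys (z 0 F)"
        then have "z 0 F \<noteq> 0" by auto
        then have "card F = p" using zc unfolding kchain_def by blast
        moreover have "int (mdeg m) = j - int (d 0 0) - int p" using zh m unfolding is_hom_iff by blast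
        ultimately have "int (mdeg (m + mchi F)) = j" by (simp add: mdeg_add mdeg_mchi d0)
        then show "\<not> koszul_nonzero TYPE('k) U p (m + mchi F)" using neg by blast
      qed
      then obtain w where w: "\<forall>F. keys (z 0 F - kbd var w F) \<subseteq> U" by blast
      define w' where "w' b = (if b = (0::nat) then w else (\<lambda>_. 0))" for b
      have "(\<lambda>b. z b F - kbd var (w' b) F) \<in> range (ap 0)" for F
        unfolding rg J using w zs r0 by (simp add: w'_def)
      with zn[rule_format, of w'] show False by blast
    qed
  next
    assume "\<exists>a. int (mdeg a) = j \<and> koszul_nonzero TYPE('k) U p a"
    then obtain a where a: "int (mdeg a) = j" "koszul_nonzero TYPE('k) U p a" by blast
    obtain y :: "'x set \<Rightarrow> ('x, 'k) mpoly" where y: "kchain p y" "\<And>G. keys (kbd var y G) \<subseteq> U"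
      "\<And>F m. m \<in> keys (y F) \<Longrightarrow> m + mchi F = a"
      and yn: "\<And>w. \<exists>F. \<not> keys (y F - kbd var w F) \<subseteq> U"
      using koszul_nonzero_imp_nonboundary[OF a(2)] by blast
    define z where "z b = (if b = (0::nat) then y else (\<lambda>_. 0))" for b
    have 1: "\<forall>b F. b \<ge> r 0 \<longrightarrow> z b F = 0" using r0 by (simp add: z_def)
    have 2: "\<forall>b. kchain p (z b)" using y(1) by (simp add: z_def kchain_def)
    have "is_hom (j - int p) (y F)" for F
      unfolding is_hom_iff
    proof
      fix m assume m: "m \<in> keys (y F)"
      then have "y F \<noteq> 0" by auto
      then have "card F = p" using y(1) unfolding kchain_def by blast
      then have "mdeg a = mdeg m + p" using y(3)[OF m] by (metis mdeg_add mdeg_mchi)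
      then show "int (mdeg m) = j - int p" using a(1) by simp
    qed
    then have 3: "\<forall>b F. is_hom (j - int (d 0 b) - int p) (z b F)" by (simp add: z_def d0)
    have 4: "\<forall>G. (\<lambda>b. kbd var (z b) G) \<in> range (ap 0)" unfolding rg J using y(2) by (simp add: z_def)
    have 5: "\<forall>w. \<exists>F. (\<lambda>b. z b F - kbd var (w b) F) \<notin> range (ap 0)"
    proof
      fix w :: "nat \<Rightarrow> 'x set \<Rightarrow> ('x, 'k) mpoly"
      obtain F where "\<not> keys (y F - kbd var (w 0) F) \<subseteq> U" using yn by blast
      then show "\<exists>F. (\<lambda>b. z b F - kbd var (w b) F) \<notin> range (ap 0)"
        unfolding rg J by (intro exI[of _ F]) (simp add: z_def)
    qed
    show "homol_nonzero 0 p j" unfolding homol_nonzero_def using 1 2 3 4 5 by (intro exI[of _ z] conjI)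
  }
qed

theorem generator_degree_iff_koszul_nonzero:
  assumes "J = {f. keys f \<subseteq> U}"
  shows "(\<exists>b<r i. d i b = j) \<longleftrightarrow> (\<exists>a. mdeg a = j \<and> koszul_nonzero TYPE('k) U i a)"
  using homol_nonzero_0_iff[of i "int j"] homol_nonzero_shift[of 0 i "int j"] homol_nonzero_start_iff[OF assms, of i "int j"]
  by simp

end

section \<open>Existence of minimal graded free resolutions\<close>

lemma mat_app_eq_sum_vscale:
  assumes "\<And>b a. b < s \<Longrightarrow> a \<ge> r \<Longrightarrow> g b a = 0"
  shows "mat_app r s (\<lambda>a b. g b a) u = (\<Sum>b<s. vscale (u b) (g b))"
  using assms by (auto simp: mat_app_def fun_eq_iff sum_fun_apply vscale_def mult.commute intro!: sum.cong)

lemma span_image_lessThan: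
  fixes g :: "nat \<Rightarrow> nat \<Rightarrow> 'r::comm_ring_1"
  shows "rvec.span (g ` {..<s}) = {\<Sum>b<s. vscale (c b) (g b) | c. True}" (is "_ = ?S")
proof (rule rvec.span_unique)
  show "g ` {..<s} \<subseteq> ?S"
  proof
    fix x assume "x \<in> g ` {..<s}"
    then obtain b0 where b0: "b0 < s" "x = g b0" by blast
    have "(\<Sum>b<s. vscale (if b = b0 then 1 else 0) (g b)) = (\<Sum>b<s. if b = b0 then g b else 0)"
      by (rule sum.cong) auto
    also have "\<dots> = x" by (subst sum.delta) (use b0 in simp_all)
    finally have "x = (\<Sum>b<s. vscale (if b = b0 then 1 else 0) (g b))" ..
    then show "x \<in> ?S" by (intro CollectI exI[of _ "\<lambda>b. if b = b0 then 1 else 0"] conjI TrueI)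
  qed
  show "rvec.subspace ?S"
  proof (rule rvec.subspaceI)
    have "0 = (\<Sum>b<s. vscale 0 (g b))" by simp
    then show "0 \<in> ?S" by (intro CollectI exI[of _ "\<lambda>b. 0"] conjI TrueI)
  next
    fix x y assume "x \<in> ?S" "y \<in> ?S"
    then obtain c e where "x = (\<Sum>b<s. vscale (c b) (g b))" "y = (\<Sum>b<s. vscale (e b) (g b))" by blast
    then have "x + y = (\<Sum>b<s. vscale (c b + e b) (g b))"
      by (simp add: rvec.scale_left_distrib sum.distrib)
    then show "x + y \<in> ?S" by (intro CollectI exI[of _ "\<lambda>b. c b + e b"] conjI TrueI)
  next
    fix k x assume "x \<in> ?S"
    then obtain c where "x = (\<Sum>b<s. vscale (c b) (g b))" by blast
    then have "vscale k x = (\<Sum>b<s. vscale (k * c b) (g b))"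
      by (simp add: rvec.scale_sum_right)
    then show "vscale k x \<in> ?S" by (intro CollectI exI[of _ "\<lambda>b. k * c b"] conjI TrueI)
  qed
  fix T assume T: "g ` {..<s} \<subseteq> T" "rvec.subspace T"
  show "?S \<subseteq> T"
  proof
    fix x assume "x \<in> ?S"
    then obtain c where "x = (\<Sum>b<s. vscale (c b) (g b))" by blast
    then show "x \<in> T" using T by (auto intro!: rvec.subspace_sum[OF T(2)] rvec.subspace_scale[OF T(2)])
  qed
qed

text \<open>
  A graded submodule of $\mathfrak{m} F$, where \<open>F\<close> is free of rank \<open>r\<close> with generators in the degrees
  \<open>d b\<close>. These are the submodules that occur as kernels in a minimal resolution.
\<close>

definition graded_submodule :: "nat \<Rightarrow> (nat \<Rightarrow> nat) \<Rightarrow> (nat \<Rightarrow> ('x::finite, 'k::field) mpoly) set \<Rightarrow> bool" where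
  "graded_submodule r d N \<longleftrightarrow> rvec.subspace N \<and> (\<forall>u\<in>N. \<forall>b\<ge>r. u b = 0) \<and>
     (\<forall>u\<in>N. \<forall>t. (\<lambda>b. hom_part (t - int (d b)) (u b)) \<in> N) \<and> (\<forall>u\<in>N. \<forall>b. u b \<in> max_ideal)"

text \<open>
  The homogeneous components of finitely many generators generate as well, and there are finitely many
  of them.
\<close>

lemma graded_submodule_finite_generators:
  assumes N: "graded_submodule r d N"
  shows "\<exists>H. finite H \<and> (\<forall>(h, e)\<in>H. h \<in> N \<and> (\<forall>a. is_hom (int e - int (d a)) (h a))) \<and> N \<subseteq> rvec.span (fst ` H)"
proof -
  have sub: "rvec.subspace N" and supp: "\<And>u b. u \<in> N \<Longrightarrow> b \<ge> r \<Longrightarrow> u b = 0"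
    and gr: "\<And>u t. u \<in> N \<Longrightarrow> (\<lambda>b. hom_part (t - int (d b)) (u b)) \<in> N"
    using N unfolding graded_submodule_def by blast+
  have "\<exists>T. finite T \<and> T \<subseteq> N \<and> N \<subseteq> rvec.span T"
    by (rule hilbert_basis_submodule[OF sub, of r]) (erule supp)
  then obtain T where T: "finite T" "T \<subseteq> N" "N \<subseteq> rvec.span T" by blast
  define D where "D u = (\<Union>b<r. (\<lambda>m. mdeg m + d b) ` keys (u b))" for u :: "nat \<Rightarrow> ('a, 'b) mpoly"
  define cp where "cp e u = (\<lambda>b. hom_part (int e - int (d b)) (u b))" for e :: nat and u :: "nat \<Rightarrow> ('a, 'b) mpoly"
  have finD: "finite (D u)" for u by (simp add: D_def)
  define H where "H = (\<Union>u\<in>T. (\<lambda>e. (cp e u, e)) ` D u)"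
  have decomp: "u = (\<Sum>e\<in>D u. cp e u)" if "u \<in> N" for u
  proof (intro ext poly_mapping_eqI)
    fix b m
    have "lookup ((\<Sum>e\<in>D u. cp e u) b) m =
       (\<Sum>e\<in>D u. if e = mdeg m + d b then lookup (u b) m else 0)"
      unfolding sum_fun_apply lookup_sum cp_def lookup_hom_part by (rule sum.cong) auto
    also have "\<dots> = (if mdeg m + d b \<in> D u then lookup (u b) m else 0)"
      using finD by simp
    also have "\<dots> = lookup (u b) m"
    proof (cases "lookup (u b) m = 0")
      case False
      then have "b < r" using supp[OF that, of b] by (cases "b < r") auto
      moreover have "m \<in> keys (u b)" using False by (simp add: in_keys_iff)
      ultimately have "mdeg m + d b \<in> D u" unfolding D_def by blast
      then show ?thesis by simp
    qed simp
    finally show "lookup (u b) m = lookup ((\<Sum>e\<in>D u. cp e u) b) m" ..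
  qed
  have "T \<subseteq> rvec.span (fst ` H)"
  proof
    fix u assume u: "u \<in> T"
    have "(\<Sum>e\<in>D u. cp e u) \<in> rvec.span (fst ` H)"
    proof (intro rvec.span_sum rvec.span_base)
      fix e assume "e \<in> D u"
      then have "(cp e u, e) \<in> H" using u unfolding H_def by blast
      then show "cp e u \<in> fst ` H" by force
    qed
    then show "u \<in> rvec.span (fst ` H)" using decomp[of u] u T(2) by auto
  qed
  then have "rvec.span T \<subseteq> rvec.span (fst ` H)" by (rule rvec.span_minimal) (rule rvec.subspace_span)
  then have "N \<subseteq> rvec.span (fst ` H)" using T(3) by blast
  moreover have "finite H" using T(1) finD by (simp add: H_def)
  moreover have "\<forall>(h, e)\<in>H. h \<in> N \<and> (\<forall>a. is_hom (int e - int (d a)) (h a))"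
    using T(2) gr by (auto simp: H_def cp_def)
  ultimately show ?thesis by blast
qed

text \<open>
  Choose homogeneous generators in the smallest possible number. A relation between them with a
  coefficient outside the ideal of the variables would have a homogeneous component with a nonzero
  constant coefficient, and could be solved for one of the generators.
\<close>

lemma graded_submodule_minimal_presentation:
  fixes N :: "(nat \<Rightarrow> ('x::finite, 'k::field) mpoly) set"
  assumes N: "graded_submodule r d N"
  shows "\<exists>s d' M. (\<forall>a b. a < r \<longrightarrow> b < s \<longrightarrow> is_hom (int (d' b) - int (d a)) (M a b) \<and> M a b \<in> max_ideal) \<and>
      range (mat_app r s M) = N \<and>
      graded_submodule s d' (mat_ker r s M)"
proof -
  define Q where "Q H \<longleftrightarrow> finite H \<and> (\<forall>(h, e)\<in>H. h \<in> N \<and> (\<forall>a. is_hom (int e - int (d a)) (h a))) \<and> N \<subseteq> rvec.span (fst ` H)"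
    for H :: "((nat \<Rightarrow> ('x, 'k) mpoly) \<times> nat) set"
  obtain H where H: "Q H" and least: "\<And>H'. Q H' \<Longrightarrow> card H \<le> card H'"
    using graded_submodule_finite_generators[OF N] ex_has_least_nat[of Q _ card]
    unfolding Q_def[symmetric] by blast
  have sub: "rvec.subspace N" and supp: "\<And>u b. u \<in> N \<Longrightarrow> b \<ge> r \<Longrightarrow> u b = 0"
    and mx: "\<And>u b. u \<in> N \<Longrightarrow> u b \<in> max_ideal"
    using N unfolding graded_submodule_def by blast+
  have finH: "finite H" and HN: "\<And>x. x \<in> H \<Longrightarrow> fst x \<in> N"
    and Hh: "\<And>x a. x \<in> H \<Longrightarrow> is_hom (int (snd x) - int (d a)) (fst x a)"
    and gen: "N \<subseteq> rvec.span (fst ` H)"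
    using H unfolding Q_def by auto
  define s where "s = card H"
  obtain f where f: "bij_betw f {0..<s} H" using ex_bij_betw_nat_finite[OF finH] unfolding s_def by blast
  have fH: "f b \<in> H" if "b < s" for b using f that by (auto simp: bij_betw_def)
  have imf: "f ` {..<s} = H" using f by (simp add: bij_betw_def atLeast0LessThan)
  define g where "g b = fst (f b)" for b
  define d' where "d' b = snd (f b)" for b
  define M where "M a b = g b a" for a b
  have gN: "g b \<in> N" if "b < s" for b using HN fH that by (simp add: g_def)
  have img: "g ` {..<s} = fst ` H" unfolding imf[symmetric] by (auto simp: g_def)
  have hom: "is_hom (int (d' b) - int (d a)) (M a b)" if "b < s" for a b
    using Hh[OF fH[OF that]] by (simp add: M_def g_def d'_def)
  have mat_app: "mat_app r s M u = (\<Sum>b<s. vscale (u b) (g b))" for u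
    unfolding M_def by (rule mat_app_eq_sum_vscale) (use supp gN in blast)
  have span_eq: "rvec.span (fst ` H) = N"
    using gen rvec.span_minimal[OF _ sub, of "fst ` H"] HN by blast
  have range: "range (mat_app r s M) = N"
    using span_image_lessThan[of g s] unfolding img span_eq mat_app by auto
  define K where "K = mat_ker r s M"
  have subK: "rvec.subspace K"
    unfolding K_def
  proof (rule rvec.subspaceI)
    show "0 \<in> mat_ker r s M" by (simp add: mat_app_def)
  next
    fix x y assume "x \<in> mat_ker r s M" "y \<in> mat_ker r s M"
    moreover have "mat_app r s M (x + y) a = mat_app r s M x a + mat_app r s M y a" for a
      by (simp add: mat_app_def distrib_left sum.distrib)
    ultimately show "x + y \<in> mat_ker r s M" by simp
  next
    fix c x assume "x \<in> mat_ker r s M"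
    moreover have "mat_app r s M (vscale c x) a = c * mat_app r s M x a" for a
      by (simp add: mat_app_def vscale_def sum_distrib_left mult.left_commute)
    ultimately show "vscale c x \<in> mat_ker r s M" by (simp add: vscale_def)
  qed
  have grK: "(\<lambda>b. hom_part (t - int (d' b)) (u b)) \<in> K" if "u \<in> K" for u t
  proof -
    have "mat_app r s M (\<lambda>b. hom_part (t - int (d' b)) (u b)) a = 0" for a
    proof (cases "a < r")
      case True
      have "mat_app r s M (\<lambda>b. hom_part (t - int (d' b)) (u b)) a = hom_part (t - int (d a)) (mat_app r s M u a)"
        by (rule hom_part_mat_app[OF True, symmetric]) (rule hom)
      then show ?thesis using that by (simp add: K_def)
    qed (simp add: mat_app_def)
    then show ?thesis using that by (simp add: K_def)
  qed
  have mxK: "u b0 \<in> max_ideal" if u: "u \<in> K" for u b0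
  proof (rule ccontr)
    assume neg: "u b0 \<notin> max_ideal"
    define k where "k = lookup (u b0) 0"
    have k: "k \<noteq> 0" using neg by (simp add: max_ideal_iff k_def)
    have b0: "b0 < s" using neg u by (cases "b0 < s") (auto simp: K_def max_ideal_iff)
    \<comment> \<open>In the component of degree \<open>d' b0\<close> the coefficient of the generator \<open>b0\<close> is the nonzero constant \<open>k\<close>.\<close>
    define w where "w = (\<lambda>b. hom_part (int (d' b0) - int (d' b)) (u b))"
    have "w \<in> K" unfolding w_def by (rule grK[OF u])
    have mdeg0: "mdeg m = 0 \<longleftrightarrow> m = 0" for m :: "'x \<Rightarrow>\<^sub>0 nat"
      by (auto simp: mdeg_def intro!: poly_mapping_eqI)
    have wb0: "w b0 = single 0 k"
      by (rule poly_mapping_eqI) (auto simp: w_def lookup_hom_part lookup_single when_def k_def mdeg0)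
    define c where "c = single (0 :: 'x \<Rightarrow>\<^sub>0 nat) (1 / k)"
    have cw: "c * w b0 = 1" using k by (simp add: c_def wb0 mult_single)
    have "(\<Sum>b<s. vscale (w b) (g b)) = 0"
      using \<open>w \<in> K\<close> unfolding mat_app[symmetric] K_def by (auto simp: fun_eq_iff)
    then have "vscale (w b0) (g b0) + (\<Sum>b\<in>{..<s} - {b0}. vscale (w b) (g b)) = 0"
      using sum.remove[of "{..<s}" b0 "\<lambda>b. vscale (w b) (g b)"] b0 by simp
    then have "vscale (w b0) (g b0) = - (\<Sum>b\<in>{..<s} - {b0}. vscale (w b) (g b))"
      by (simp add: eq_neg_iff_add_eq_0)
    then have "vscale c (vscale (w b0) (g b0)) = vscale c (- (\<Sum>b\<in>{..<s} - {b0}. vscale (w b) (g b)))" by simp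
    then have gb0: "g b0 = vscale c (- (\<Sum>b\<in>{..<s} - {b0}. vscale (w b) (g b)))"
      by (simp add: cw del: rvec.scale_minus_right)
    define H' where "H' = H - {f b0}"
    have others: "g b \<in> fst ` H'" if "b < s" "b \<noteq> b0" for b
    proof -
      have "f b \<noteq> f b0" using f that b0 by (auto simp: bij_betw_def inj_on_def)
      then show ?thesis using fH that by (auto simp: H'_def g_def)
    qed
    have "g b0 \<in> rvec.span (fst ` H')"
      unfolding gb0 using others
      by (intro rvec.span_scale rvec.span_neg rvec.span_sum) (auto intro: rvec.span_base)
    then have "g b \<in> rvec.span (fst ` H')" if "b < s" for b
      using others[OF that] by (cases "b = b0") (auto intro: rvec.span_base)
    then have "g ` {..<s} \<subseteq> rvec.span (fst ` H')" by blast
    then have "rvec.span (fst ` H) \<subseteq> rvec.span (fst ` H')"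
      unfolding img by (intro rvec.span_minimal) auto
    then have "Q H'" using H gen unfolding Q_def H'_def by auto
    then have "card H \<le> card H'" by (rule least)
    moreover have "card H' < card H" unfolding H'_def using finH fH[OF b0] by (intro card_Diff1_less)
    ultimately show False by simp
  qed
  have "graded_submodule s d' K"
    unfolding graded_submodule_def using subK grK mxK by (auto simp: K_def)
  moreover have "M a b \<in> max_ideal" if "b < s" for a b
    unfolding M_def using mx gN that by blast
  ultimately show ?thesis using hom range unfolding K_def by blast
qed

text \<open>
  Iterate the minimal presentation, taking the kernel of each step as the next submodule.
\<close>

lemma ex_minimal_resolution:
  fixes J :: "('x::finite, 'k::field) mpoly set"
  assumes J: "ideal.subspace J" "J \<subseteq> max_ideal" "\<And>f t. f \<in> J \<Longrightarrow> hom_part t f \<in> J"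
  shows "\<exists>r d M. minimal_resolution J r d M"
proof -
  let ?start = "(1 :: nat, (\<lambda>_. 0) :: nat \<Rightarrow> nat, rank_one J)"
  define P where "P n S \<longleftrightarrow> (case S of (r, d, N) \<Rightarrow> graded_submodule r d N) \<and> (n = 0 \<longrightarrow> S = ?start)" for n :: nat and S
  define R where "R S S' M \<longleftrightarrow> (case S of (r, d, N) \<Rightarrow> case S' of (s, d', N') \<Rightarrow>
      (\<forall>a b. a < r \<longrightarrow> b < s \<longrightarrow> is_hom (int (d' b) - int (d a)) (M a b) \<and> M a b \<in> max_ideal) \<and>
      range (mat_app r s M) = N \<and> N' = mat_ker r s M)"
    for S S' :: "nat \<times> (nat \<Rightarrow> nat) \<times> (nat \<Rightarrow> ('x, 'k) mpoly) set" and M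
  have "graded_submodule 1 (\<lambda>_. 0) (rank_one J)"
    unfolding graded_submodule_def
  proof (intro conjI ballI allI)
    show "rvec.subspace (rank_one J)"
      using ideal.subspace_0[OF J(1)] ideal.subspace_add[OF J(1)] ideal.subspace_scale[OF J(1)]
      by (intro rvec.subspaceI) (simp_all add: vscale_def)
    fix u :: "nat \<Rightarrow> ('x, 'k) mpoly" and b assume u: "u \<in> rank_one J"
    show "u b \<in> max_ideal"
      using u J(2) by (cases "b = 0") (auto simp: max_ideal_iff)
  qed (use J(3) in auto)
  then have start: "\<exists>S. P 0 S" unfolding P_def by (intro exI[of _ ?start]) simp
  have step: "\<exists>S'. P (Suc n) S' \<and> (\<exists>M. R S S' M)" if "P n S" for n S
  proof -
    obtain r d N where S: "S = (r, d, N)" by (cases S)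
    have "graded_submodule r d N" using that by (simp add: P_def S)
    from graded_submodule_minimal_presentation[OF this] obtain s d' M where
      1: "(\<forall>a b. a < r \<longrightarrow> b < s \<longrightarrow> is_hom (int (d' b) - int (d a)) (M a b) \<and> M a b \<in> max_ideal)"
      "range (mat_app r s M) = N"
      and 2: "graded_submodule s d' (mat_ker r s M)" by blast
    have "P (Suc n) (s, d', mat_ker r s M)"
      using 2 by (simp add: P_def)
    moreover have "R S (s, d', mat_ker r s M) M"
      using 1 by (simp add: R_def S)
    ultimately show ?thesis by blast
  qed
  obtain S where S: "\<And>n. P n (S n)" and "\<And>n. \<exists>M. R (S n) (S (Suc n)) M"
    using dependent_nat_choice[of P "\<lambda>n S S'. \<exists>M. R S S' M", OF start step] by blast
  then obtain M where M: "\<And>n. R (S n) (S (Suc n)) (M n)" by metis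
  define r where "r n = fst (S n)" for n
  define d where "d n = fst (snd (S n))" for n
  define N where "N n = snd (snd (S n))" for n
  have S_eq: "S n = (r n, d n, N n)" for n by (simp add: r_def d_def N_def)
  have R: "\<And>a b. a < r n \<Longrightarrow> b < r (Suc n) \<Longrightarrow> is_hom (int (d (Suc n) b) - int (d n a)) (M n a b) \<and> M n a b \<in> max_ideal"
     "range (mat_app (r n) (r (Suc n)) (M n)) = N n"
     "N (Suc n) = mat_ker (r n) (r (Suc n)) (M n)" for n
    using M[of n] unfolding R_def S_eq by simp_all
  have S0: "r 0 = 1" "d 0 = (\<lambda>_. 0)" "N 0 = rank_one J"
    using S[of 0] unfolding P_def S_eq by simp_all
  have "minimal_resolution J r d M"
  proof
    show "r 0 = 1" "d 0 0 = 0" by (simp_all add: S0)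
    show "range (mat_app (r 0) (r 1) (M 0)) = rank_one J"
      using R(2)[of 0] S0(3) by simp
    show "range (mat_app (r (Suc i)) (r (Suc (Suc i))) (M (Suc i))) =
       mat_ker (r i) (r (Suc i)) (M i)" for i
      using R(2)[of "Suc i"] R(3)[of i] by simp
  qed (use R(1) in blast)+
  then show ?thesis by blast
qed

lemma mult_mat_vec_mat_app:
  assumes "A \<in> carrier_mat r s" "w \<in> carrier_vec s"
  shows "A *\<^sub>v w = Matrix.vec r (mat_app r s (\<lambda>a b. A $$ (a, b)) (\<lambda>b. vec_index w b))"
proof (rule eq_vecI)
  fix i assume "i < dim_vec (Matrix.vec r (mat_app r s (\<lambda>a b. A $$ (a, b)) (\<lambda>b. vec_index w b)))"
  then have "i < r" by simp
  then show "vec_index (A *\<^sub>v w) i = vec_index (Matrix.vec r (mat_app r s (\<lambda>a b. A $$ (a, b)) (\<lambda>b. vec_index w b))) i"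
    using assms by (simp add: mat_app_def scalar_prod_def atLeast0LessThan)
qed (use assms in simp)

lemma image_mult_mat_vec:
  assumes "A \<in> carrier_mat r s"
  shows "(\<lambda>w. A *\<^sub>v w) ` carrier_vec s = Matrix.vec r ` range (mat_app r s (\<lambda>a b. A $$ (a, b)))"
proof (intro equalityI subsetI)
  fix x assume "x \<in> (\<lambda>w. A *\<^sub>v w) ` carrier_vec s"
  then show "x \<in> Matrix.vec r ` range (mat_app r s (\<lambda>a b. A $$ (a, b)))"
    using mult_mat_vec_mat_app[OF assms] by auto
next
  fix x assume "x \<in> Matrix.vec r ` range (mat_app r s (\<lambda>a b. A $$ (a, b)))"
  then obtain u where u: "x = Matrix.vec r (mat_app r s (\<lambda>a b. A $$ (a, b)) u)" by blast
  have "mat_app r s (\<lambda>a b. A $$ (a, b)) (\<lambda>b. vec_index (Matrix.vec s u) b) = mat_app r s (\<lambda>a b. A $$ (a, b)) u"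
    by (rule mat_app_cong) simp
  then have "x = A *\<^sub>v Matrix.vec s u" using mult_mat_vec_mat_app[OF assms, of "Matrix.vec s u"] u by simp
  then show "x \<in> (\<lambda>w. A *\<^sub>v w) ` carrier_vec s" by simp
qed

lemma vec_image_eq_iff:
  assumes "\<And>u b. u \<in> S \<Longrightarrow> b \<ge> n \<Longrightarrow> u b = 0" "\<And>u b. u \<in> T \<Longrightarrow> b \<ge> n \<Longrightarrow> u b = 0"
  shows "Matrix.vec n ` S = Matrix.vec n ` T \<longleftrightarrow> S = T"
proof (rule inj_on_image_eq_iff)
  show "inj_on (Matrix.vec n) (S \<union> T)"
  proof (intro inj_onI ext)
    fix u w b assume uw: "u \<in> S \<union> T" "w \<in> S \<union> T" "Matrix.vec n u = Matrix.vec n w"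
    show "u b = w b"
    proof (cases "b < n")
      case True
      then show ?thesis using uw(3) by (metis index_vec)
    next
      case False
      then have "u b = 0" "w b = 0" using assms uw(1,2) by auto
      then show ?thesis by simp
    qed
  qed
qed auto

lemma vec_1_image:
  "{u \<in> carrier_vec 1. vec_index u 0 \<in> J} = Matrix.vec 1 ` rank_one J"
proof (intro equalityI subsetI)
  fix x assume x: "x \<in> {u \<in> carrier_vec 1. vec_index u 0 \<in> J}"
  then have "x = Matrix.vec 1 (\<lambda>b. if b < 1 then vec_index x b else 0)" by (intro eq_vecI) auto
  moreover have "(\<lambda>b. if b < 1 then vec_index x b else 0) \<in> rank_one J"
    using x by simp
  ultimately show "x \<in> Matrix.vec 1 ` rank_one J"
    by (rule image_eqI)
qed auto

lemma mat_kernel_image: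
  assumes "B \<in> carrier_mat q r"
  shows "mat_kernel B = Matrix.vec r ` mat_ker q r (\<lambda>a b. B $$ (a, b))"
proof (intro equalityI subsetI)
  fix x assume x: "x \<in> mat_kernel B"
  then have xc: "x \<in> carrier_vec r" "B *\<^sub>v x = 0\<^sub>v q" using assms by (auto simp: mat_kernel_def)
  define u where "u b = (if b < r then vec_index x b else 0)" for b
  have "x = Matrix.vec r u" using xc(1) by (intro eq_vecI) (auto simp: u_def)
  moreover have "mat_app q r (\<lambda>a b. B $$ (a, b)) u a = 0" for a
  proof (cases "a < q")
    case True
    have "mat_app q r (\<lambda>a b. B $$ (a, b)) u = mat_app q r (\<lambda>a b. B $$ (a, b)) (\<lambda>b. vec_index x b)"
      by (rule mat_app_cong) (simp add: u_def)
    then have "B *\<^sub>v x = Matrix.vec q (mat_app q r (\<lambda>a b. B $$ (a, b)) u)"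
      using mult_mat_vec_mat_app[OF assms xc(1)] by simp
    then show ?thesis using True xc(2) by (metis index_vec index_zero_vec(1))
  qed (simp add: mat_app_def)
  moreover have "\<forall>b\<ge>r. u b = 0" by (simp add: u_def)
  ultimately show "x \<in> Matrix.vec r ` mat_ker q r (\<lambda>a b. B $$ (a, b))" by blast
next
  fix x assume "x \<in> Matrix.vec r ` mat_ker q r (\<lambda>a b. B $$ (a, b))"
  then obtain u where u: "x = Matrix.vec r u" "\<forall>a. mat_app q r (\<lambda>a b. B $$ (a, b)) u a = 0" by blast
  have "mat_app q r (\<lambda>a b. B $$ (a, b)) (\<lambda>b. vec_index (Matrix.vec r u) b) = mat_app q r (\<lambda>a b. B $$ (a, b)) u"
    by (rule mat_app_cong) simp
  then have "B *\<^sub>v x = Matrix.vec q (mat_app q r (\<lambda>a b. B $$ (a, b)) u)"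
    using mult_mat_vec_mat_app[OF assms, of x] u(1) by simp
  also have "\<dots> = 0\<^sub>v q" using u(2) by (intro eq_vecI) auto
  finally show "x \<in> mat_kernel B" using assms u(1) by (auto simp: mat_kernel_def)
qed

text \<open>
  Translates between the encodings of vectors: \<open>Matrix.vec\<close> is injective on functions that vanish beyond
  the length of the vector, so equality of images and kernels can be tested on functions.
\<close>

lemma minimal_graded_free_resolution_iff:
  fixes J :: "('x::finite, 'k::field) mpoly set"
  shows "minimal_graded_free_resolution J r d \<phi> \<longleftrightarrow>
    (\<forall>i. \<phi> i \<in> carrier_mat (r i) (r (Suc i))) \<and> minimal_resolution J r d (\<lambda>i a b. \<phi> i $$ (a, b))"
proof (cases "(\<forall>i. \<phi> i \<in> carrier_mat (r i) (r (Suc i))) \<and> r 0 = 1")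
  case False
  then show ?thesis by (auto simp: minimal_graded_free_resolution_def minimal_resolution_def)
next
  case True
  then have c: "\<And>i. \<phi> i \<in> carrier_mat (r i) (r (Suc i))" and r0: "r 0 = 1" by auto
  have supp: "u b = 0" if "u \<in> range (mat_app n s M)" "b \<ge> n" for u b n s and M :: "nat \<Rightarrow> nat \<Rightarrow> ('x, 'k) mpoly"
    using that by (auto simp: mat_app_def)
  have e0: "(\<lambda>w. \<phi> 0 *\<^sub>v w) ` carrier_vec (r 1) = {u \<in> carrier_vec 1. vec_index u 0 \<in> J} \<longleftrightarrow>
     range (mat_app (r 0) (r 1) (\<lambda>a b. \<phi> 0 $$ (a, b))) = rank_one J"
    using image_mult_mat_vec[OF c[of 0]] supp unfolding vec_1_image r0
    by (simp, intro vec_image_eq_iff) (auto simp: mat_app_def)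
  have e: "(\<lambda>w. \<phi> (Suc i) *\<^sub>v w) ` carrier_vec (r (Suc (Suc i))) = mat_kernel (\<phi> i) \<longleftrightarrow>
     range (mat_app (r (Suc i)) (r (Suc (Suc i))) (\<lambda>a b. \<phi> (Suc i) $$ (a, b))) =
       mat_ker (r i) (r (Suc i)) (\<lambda>a b. \<phi> i $$ (a, b))" for i
    unfolding image_mult_mat_vec[OF c] mat_kernel_image[OF c]
    by (intro vec_image_eq_iff) (auto simp: mat_app_def)
  have h: "(\<forall>i. \<forall>a<r i. \<forall>b<r (Suc i). if d i a \<le> d (Suc i) b
        then homogeneous (d (Suc i) b - d i a) (\<phi> i $$ (a, b)) else \<phi> i $$ (a, b) = 0) \<longleftrightarrow>
      (\<forall>i a b. a < r i \<longrightarrow> b < r (Suc i) \<longrightarrow> is_hom (int (d (Suc i) b) - int (d i a)) (\<phi> i $$ (a, b)))"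
    unfolding is_hom_int_iff_homogeneous by blast
  have m: "(\<forall>i. \<forall>a<r i. \<forall>b<r (Suc i). \<phi> i $$ (a, b) \<in> max_ideal) \<longleftrightarrow>
      (\<forall>i a b. a < r i \<longrightarrow> b < r (Suc i) \<longrightarrow> \<phi> i $$ (a, b) \<in> max_ideal)"
    by blast
  show ?thesis
    unfolding minimal_graded_free_resolution_def minimal_resolution_def e0 e h m
    using True by argo
qed

lemma ex_minimal_graded_free_resolution:
  fixes J :: "('x::finite, 'k::field) mpoly set"
  assumes "ideal.subspace J" "J \<subseteq> max_ideal" "\<And>f t. f \<in> J \<Longrightarrow> hom_part t f \<in> J"
  shows "\<exists>r d \<phi>. minimal_graded_free_resolution J r d \<phi>"
proof -
  have "\<exists>r d M. minimal_resolution J r d M" by (rule ex_minimal_resolution) (use assms in auto)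
  then obtain r d M where "minimal_resolution J r d M" by blast
  then interpret minimal_resolution J r d M .
  define \<phi> where "\<phi> i = Matrix.mat (r i) (r (Suc i)) (\<lambda>(a, b). M i a b)" for i
  have M: "mat_app (r i) (r (Suc i)) (\<lambda>a b. \<phi> i $$ (a, b)) = mat_app (r i) (r (Suc i)) (M i)" for i
    by (intro ext) (auto simp: mat_app_def \<phi>_def)
  have "minimal_resolution J r d (\<lambda>i a b. \<phi> i $$ (a, b))"
  proof
    show "is_hom (int (d (Suc i) b) - int (d i a)) (\<phi> i $$ (a, b))" if "a < r i" "b < r (Suc i)" for i a b
      using hom[OF that] that by (simp add: \<phi>_def)
    show "\<phi> i $$ (a, b) \<in> max_ideal" if "a < r i" "b < r (Suc i)" for i a b
      using min[OF that] that by (simp add: \<phi>_def)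
    show "range (mat_app (r 0) (r 1) (\<lambda>a b. \<phi> 0 $$ (a, b))) = rank_one J"
      using M[of 0] exact0 by simp
    show "range (mat_app (r (Suc i)) (r (Suc (Suc i))) (\<lambda>a b. \<phi> (Suc i) $$ (a, b))) =
       mat_ker (r i) (r (Suc i)) (\<lambda>a b. \<phi> i $$ (a, b))" for i
      unfolding M by (rule exact)
  qed (use r0 d0 in auto)
  then have "minimal_graded_free_resolution J r d \<phi>"
    unfolding minimal_graded_free_resolution_iff by (simp add: \<phi>_def)
  then show ?thesis by blast
qed

definition mon_ideal :: "('x \<Rightarrow>\<^sub>0 nat) set \<Rightarrow> ('x::finite, 'k::field) mpoly set" where
  "mon_ideal U = {f. keys f \<subseteq> U}"

lemma subspace_mon_ideal:
  assumes "upset U"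
  shows "ideal.subspace (mon_ideal U :: ('x::finite, 'k::field) mpoly set)"
  unfolding mon_ideal_def
proof (rule ideal.subspaceI)
  show "x + y \<in> {f. keys f \<subseteq> U}"
    if "x \<in> {f. keys f \<subseteq> U}" "y \<in> {f. keys f \<subseteq> U}" for x y :: "('x, 'k) mpoly"
    using that Poly_Mapping.keys_add[of x y] by blast
  show "c * x \<in> {f. keys f \<subseteq> U}" if "x \<in> {f. keys f \<subseteq> U}" for c x :: "('x, 'k) mpoly"
  proof -
    have "a + b \<in> U" if "b \<in> U" for a b using assms that unfolding upset_def by (metis add.commute)
    then show ?thesis using that keys_mult[of c x] by blast
  qed
qed simp

lemma mon_ideal_subset_max_ideal: "0 \<notin> U \<Longrightarrow> mon_ideal U \<subseteq> max_ideal"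
  by (auto simp: mon_ideal_def max_ideal_iff in_keys_iff)

lemma hom_part_mon_ideal: "f \<in> mon_ideal U \<Longrightarrow> hom_part t f \<in> mon_ideal U"
  by (auto simp: mon_ideal_def in_keys_iff lookup_hom_part subset_iff split: if_splits)

text \<open>
  Koszul homology determines the degrees of the generators of every minimal resolution, in particular of
  the one that is chosen in \<open>quot_betti\<close>.
\<close>

theorem quot_betti_nonzero_iff:
  assumes "upset U" "0 \<notin> U"
  shows "quot_betti (mon_ideal U :: ('x::finite, 'k::field) mpoly set) i j \<noteq> 0 \<longleftrightarrow>
     (\<exists>a. mdeg a = j \<and> koszul_nonzero TYPE('k) U i a)"
proof -
  let ?J = "mon_ideal U :: ('x, 'k) mpoly set"
  have "\<exists>r d \<phi>. minimal_graded_free_resolution ?J r d \<phi>"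
    by (rule ex_minimal_graded_free_resolution)
       (use subspace_mon_ideal[OF assms(1)] mon_ideal_subset_max_ideal[OF assms(2)] hom_part_mon_ideal in auto)
  then have ex: "\<exists>x. (case x of (r, d, \<phi>) \<Rightarrow> minimal_graded_free_resolution ?J r d \<phi>)" by auto
  define x where "x = (SOME (r, d, \<phi>). minimal_graded_free_resolution ?J r d \<phi>)"
  obtain r d \<phi> where x: "x = (r, d, \<phi>)" by (cases x)
  have "minimal_graded_free_resolution ?J r d \<phi>"
    using someI_ex[OF ex] unfolding x_def[symmetric] x by simp
  then interpret minimal_resolution ?J r d "\<lambda>i a b. \<phi> i $$ (a, b)"
    unfolding minimal_graded_free_resolution_iff by blast
  have "quot_betti ?J i j = card {b. b < r i \<and> d i b = j}"
    unfolding quot_betti_def x_def[symmetric] x by simp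
  then have "quot_betti ?J i j \<noteq> 0 \<longleftrightarrow> (\<exists>b<r i. d i b = j)" by auto
  then show ?thesis using generator_degree_iff_koszul_nonzero[of U i j] by (simp add: mon_ideal_def)
qed

section \<open>Packings and covers in clutters with the max-flow min-cut property\<close>

lemma sum_incidence: "(\<Sum>v\<in>UNIV. x v * incidence v e) = (\<Sum>v\<in>e. x v)"
  by (simp add: incidence_def if_distrib sum.If_cases cong: if_cong)

text \<open>
  Strong duality up to an error. A separating hyperplane between the closed cone generated by the
  constraints and the point given by \<open>\<alpha>\<close> and a value beyond the dual bound is a primal solution after
  scaling. The slack \<open>1/2\<close> is harmless later, where all values are integers.
\<close>

lemma dual_bound_imp_near_optimal_primal:
  fixes E :: "'x::finite set set"
  assumes bound: "\<And>y. dual_feasible E \<alpha> y \<Longrightarrow> (\<Sum>e\<in>E. y e) \<le> N"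
  shows "\<exists>x. primal_feasible E x \<and> (\<Sum>v\<in>UNIV. real (\<alpha> v) * x v) < N + 1/2"
proof -
  let ?chi = "\<lambda>e. (vec_lambda (\<lambda>v. incidence v e), 1) :: (real ^ 'x) \<times> real"
  let ?ax = "\<lambda>v. (axis v 1, 0) :: (real ^ 'x) \<times> real"
  define S where "S = ?chi ` E \<union> range ?ax \<union> {(0, -1)}"
  define K where "K = convex_cone hull S"
  define ok where "ok a t y \<longleftrightarrow> (\<forall>e\<in>E. y e \<ge> 0) \<and>
     (\<forall>v. (\<Sum>e\<in>E. incidence v e * y e) \<le> vec_nth a v) \<and> t \<le> (\<Sum>e\<in>E. y e)"
    for a :: "(real ^ 'x)" and t :: real and y
  define B where "B = {(a, t). \<exists>y. ok a t y}"
  have B_I: "(a, t) \<in> B" if "ok a t y" for a t y using that unfolding B_def by blast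
  have B_E: "\<exists>y. ok a t y" if "(a, t) \<in> B" for a t using that unfolding B_def by blast
  have finE: "finite E" by simp
  have "K \<subseteq> B"
    unfolding K_def
  proof (rule hull_minimal)
    have "?chi e \<in> B" if "e \<in> E" for e
    proof (rule B_I)
      have "(\<Sum>e'\<in>E. incidence v e' * (if e' = e then 1 else 0)) = incidence v e" for v
      proof -
        have "(\<Sum>e'\<in>E. incidence v e' * (if e' = e then 1 else 0)) = (\<Sum>e'\<in>E. if e' = e then incidence v e else 0)"
          by (rule sum.cong) auto
        then show ?thesis using that finE by simp
      qed
      then show "ok (vec_lambda (\<lambda>v. incidence v e)) 1 (\<lambda>e'. if e' = e then 1 else 0)"
        using that finE by (simp add: ok_def)
    qed
    moreover have "?ax v \<in> B" for v
      by (rule B_I[of _ _ "\<lambda>_. 0"]) (simp add: ok_def axis_def)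
    moreover have "(0, -1) \<in> B"
      by (rule B_I[of _ _ "\<lambda>_. 0"]) (simp add: ok_def)
    ultimately show "S \<subseteq> B" unfolding S_def by blast
    have add: "p + q \<in> B" if pq: "p \<in> B" "q \<in> B" for p q
    proof -
      obtain a t where p: "p = (a, t)" by (cases p)
      obtain a' t' where q: "q = (a', t')" by (cases q)
      obtain y where y: "ok a t y" using pq(1) B_E unfolding p by blast
      obtain y' where y': "ok a' t' y'" using pq(2) B_E unfolding q by blast
      have "ok (a + a') (t + t') (\<lambda>e. y e + y' e)"
        using y y' unfolding ok_def by (simp add: distrib_left sum.distrib add_mono)
      then show ?thesis unfolding p q by (simp add: B_I)
    qed
    have mul: "c *\<^sub>R p \<in> B" if pc: "p \<in> B" "c \<ge> 0" for p c
    proof -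
      obtain a t where p: "p = (a, t)" by (cases p)
      obtain y where y: "ok a t y" using pc(1) B_E unfolding p by blast
      have "(\<Sum>e\<in>E. incidence v e * (c * y e)) \<le> c * vec_nth a v" for v
      proof -
        have "c * (\<Sum>e\<in>E. incidence v e * y e) \<le> c * vec_nth a v"
          using y pc(2) unfolding ok_def by (intro mult_left_mono) auto
        then show ?thesis by (simp add: sum_distrib_left mult.left_commute)
      qed
      moreover have "c * t \<le> (\<Sum>e\<in>E. c * y e)"
        using y pc(2) unfolding ok_def by (simp add: mult_left_mono flip: sum_distrib_left)
      ultimately have "ok (c *\<^sub>R a) (c * t) (\<lambda>e. c * y e)"
        using y pc(2) unfolding ok_def by simp
      then show ?thesis unfolding p by (simp add: B_I)
    qed
    have "0 \<in> B" using mul[OF \<open>(0, -1) \<in> B\<close>, of 0] by (simp add: zero_prod_def)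
    then show "convex_cone B"
      unfolding convex_cone_iff using add mul by blast
  qed
  define z where "z = (vec_lambda (\<lambda>v. real (\<alpha> v)), N + 1/2) "
  have "z \<notin> K"
  proof
    assume "z \<in> K"
    then have "z \<in> B" using \<open>K \<subseteq> B\<close> by blast
    then obtain y where y: "ok (vec_lambda (\<lambda>v. real (\<alpha> v))) (N + 1/2) y"
      using B_E unfolding z_def by blast
    then have "dual_feasible E \<alpha> y" by (simp add: dual_feasible_def ok_def)
    from bound[OF this] y show False by (simp add: ok_def)
  qed
  moreover have "finite S" using finE by (simp add: S_def)
  ultimately obtain a b where ab: "inner a z < b" "\<And>x. x \<in> K \<Longrightarrow> b < inner a x"
    using separating_hyperplane_closed_point[of K z] closed_convex_cone_hull[of S] convex_convex_cone_hull[of S]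
    unfolding K_def by blast
  have "b < 0" using ab(2)[of 0] convex_cone_hull_contains_0[of S] by (simp add: K_def)
  \<comment> \<open>A functional that is bounded below on a cone is nonnegative on it.\<close>
  have pos: "inner a s \<ge> 0" if "s \<in> S" for s
  proof (rule ccontr)
    assume neg: "\<not> inner a s \<ge> 0"
    \<comment> \<open>scales \<open>s\<close> onto the hyperplane\<close>
    define c where "c = b / inner a s"
    have "c \<ge> 0" using \<open>b < 0\<close> neg by (simp add: c_def divide_nonpos_neg)
    then have "c *\<^sub>R s \<in> K" using that hull_inc[of s S convex_cone] convex_cone_hull_mul[of s S c] by (simp add: K_def)
    from ab(2)[OF this] show False using neg by (simp add: c_def)
  qed
  obtain p q where a: "a = (p, q)" by (cases a)
  define t where "t = - q"
  have t0: "t \<ge> 0" using pos[of "(0, -1)"] by (simp add: S_def a t_def)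
  have p0: "vec_nth p v \<ge> 0" for v
    using pos[of "?ax v"] by (simp add: S_def a inner_axis)
  have pe: "(\<Sum>v\<in>e. vec_nth p v) \<ge> t" if "e \<in> E" for e
  proof -
    have "inner p (vec_lambda (\<lambda>v. incidence v e)) = (\<Sum>v\<in>e. vec_nth p v)"
      by (subst sum_incidence[symmetric]) (simp add: inner_vec_def)
    then show ?thesis using pos[of "?chi e"] that by (simp add: S_def a t_def)
  qed
  have val: "(\<Sum>v\<in>UNIV. real (\<alpha> v) * vec_nth p v) < t * (N + 1/2)"
    using ab(1) \<open>b < 0\<close> by (simp add: a z_def inner_vec_def t_def mult.commute)
  have "0 \<le> (\<Sum>v\<in>UNIV. real (\<alpha> v) * vec_nth p v)" using p0 by (simp add: sum_nonneg)
  then have tpos: "t > 0" using val t0 by (cases "t = 0") auto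
  define x where "x v = vec_nth p v / t" for v
  have "primal_feasible E x"
    unfolding primal_feasible_def sum_incidence
    using p0 pe tpos by (auto simp: x_def simp flip: sum_divide_distrib)
  moreover have "(\<Sum>v\<in>UNIV. real (\<alpha> v) * x v) < N + 1/2"
    using val tpos by (simp add: x_def pos_divide_less_eq mult.commute flip: sum_divide_distrib)
  ultimately show ?thesis by blast
qed

text \<open>
  A function \<open>y\<close> on edges is read as a multiset of edges; the load of a vertex is the number of these
  edges through it, that is, the exponent of the vertex in the product of their monomials.
\<close>

definition edge_load :: "'x::finite set set \<Rightarrow> ('x set \<Rightarrow> nat) \<Rightarrow> 'x \<Rightarrow> nat" where
  "edge_load E y v = (\<Sum>e\<in>{e \<in> E. v \<in> e}. y e)"

lemma real_edge_load: "real (edge_load E y v) = (\<Sum>e\<in>E. incidence v e * real (y e))"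
proof -
  have "(\<Sum>e\<in>E. incidence v e * real (y e)) = (\<Sum>e\<in>E. if v \<in> e then real (y e) else 0)"
    by (rule sum.cong) (auto simp: incidence_def)
  also have "\<dots> = (\<Sum>e\<in>{e \<in> E. v \<in> e}. real (y e))" by (simp add: sum.inter_filter)
  finally show ?thesis by (simp add: edge_load_def)
qed

lemma max_flow_min_cut_packing_cover:
  fixes E :: "'x::finite set set"
  assumes "max_flow_min_cut E"
  shows "\<exists>y C. (\<forall>v. edge_load E y v \<le> \<alpha> v) \<and> vertex_cover E C \<and> (\<Sum>v\<in>C. \<alpha> v) \<le> (\<Sum>e\<in>E. y e)"
proof -
  obtain x y where x: "primal_optimal E \<alpha> x" "\<forall>v. x v \<in> \<int>" and y: "dual_optimal E \<alpha> y" "\<forall>e\<in>E. y e \<in> \<int>"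
    using assms unfolding max_flow_min_cut_def by blast
  define y' where "y' e = nat \<lfloor>y e\<rfloor>" for e
  have y0: "\<forall>e\<in>E. y e \<ge> 0" and yl: "\<And>v. (\<Sum>e\<in>E. incidence v e * y e) \<le> real (\<alpha> v)"
    using y(1) by (auto simp: dual_optimal_def dual_feasible_def)
  have y': "real (y' e) = y e" if "e \<in> E" for e
    using y(2) y0 that by (simp add: y'_def)
  have load: "edge_load E y' v \<le> \<alpha> v" for v
  proof -
    have "real (edge_load E y' v) = (\<Sum>e\<in>E. incidence v e * y e)"
      unfolding real_edge_load by (rule sum.cong) (simp_all add: y')
    then show ?thesis using yl[of v] by simp
  qed
  have sum_y: "real (\<Sum>e\<in>E. y' e) = (\<Sum>e\<in>E. y e)" by (simp add: y')
  define C where "C = {v. x v \<ge> 1}"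
  have x0: "\<And>v. x v \<ge> 0" and xe: "\<And>e. e \<in> E \<Longrightarrow> (\<Sum>v\<in>e. x v) \<ge> 1"
    using x(1) by (auto simp: primal_optimal_def primal_feasible_def sum_incidence)
  have x_out: "x v = 0" if "v \<notin> C" for v
  proof -
    obtain n where n: "x v = of_int n" using x(2) by (auto elim: Ints_cases)
    then show ?thesis using that x0[of v] by (simp add: C_def)
  qed
  have "vertex_cover E C"
    unfolding vertex_cover_def
  proof
    fix e assume "e \<in> E"
    show "C \<inter> e \<noteq> {}"
    proof
      assume "C \<inter> e = {}"
      then have "(\<Sum>v\<in>e. x v) = 0" using x_out by (intro sum.neutral) blast
      then show False using xe[OF \<open>e \<in> E\<close>] by simp
    qed
  qed
  moreover have "(\<Sum>v\<in>C. \<alpha> v) \<le> (\<Sum>e\<in>E. y' e)"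
  proof -
    have "\<exists>x'. primal_feasible E x' \<and> (\<Sum>v\<in>UNIV. real (\<alpha> v) * x' v) < (\<Sum>e\<in>E. y e) + 1/2"
      by (rule dual_bound_imp_near_optimal_primal) (use y(1) in \<open>simp add: dual_optimal_def\<close>)
    then obtain x' where x': "primal_feasible E x'" "(\<Sum>v\<in>UNIV. real (\<alpha> v) * x' v) < (\<Sum>e\<in>E. y e) + 1/2" by blast
    have "real (\<Sum>v\<in>C. \<alpha> v) = (\<Sum>v\<in>C. real (\<alpha> v))" by simp
    also have "\<dots> \<le> (\<Sum>v\<in>C. real (\<alpha> v) * x v)"
      by (intro sum_mono) (simp add: C_def mult_le_cancel_left1)
    also have "\<dots> \<le> (\<Sum>v\<in>UNIV. real (\<alpha> v) * x v)" using x0 by (intro sum_mono2) auto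
    also have "\<dots> \<le> (\<Sum>v\<in>UNIV. real (\<alpha> v) * x' v)" using x(1) x'(1) by (simp add: primal_optimal_def)
    also have "\<dots> < real (\<Sum>e\<in>E. y' e) + 1/2" using x'(2) sum_y by simp
    finally show ?thesis by linarith
  qed
  ultimately show ?thesis using load by blast
qed

lemma vertex_cover_contains_minimal:
  fixes C :: "'x::finite set"
  assumes "vertex_cover E C"
  obtains D where "D \<subseteq> C" "minimal_vertex_cover E D"
proof -
  have "finite {D. D \<subseteq> C \<and> vertex_cover E D}" by simp
  then obtain D where D: "D \<subseteq> C" "vertex_cover E D" "\<forall>D'\<in>{D. D \<subseteq> C \<and> vertex_cover E D}. D' \<subseteq> D \<longrightarrow> D = D'"
    using finite_has_minimal2[of "{D. D \<subseteq> C \<and> vertex_cover E D}" C] assms by auto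
  have "minimal_vertex_cover E D"
    unfolding minimal_vertex_cover_def
  proof (intro conjI allI impI notI)
    fix D' assume "D' \<subset> D" "vertex_cover E D'"
    then show False using D by blast
  qed (rule D(2))
  then show ?thesis using that D(1) by blast
qed

text \<open>
  Double counting of the incidences between the edges of \<open>y\<close> and the vertices of \<open>D\<close>.
\<close>

lemma sum_card_edge_load:
  fixes E :: "'x::finite set set"
  shows "(\<Sum>e\<in>E. y e * card (e \<inter> D)) = (\<Sum>v\<in>D. edge_load E y v)"
proof -
  have "(\<Sum>v\<in>D. edge_load E y v) = (\<Sum>v\<in>D. \<Sum>e\<in>E. if v \<in> e then y e else 0)"
    by (simp add: edge_load_def sum.inter_filter)
  also have "\<dots> = (\<Sum>e\<in>E. \<Sum>v\<in>D. if v \<in> e then y e else 0)" by (rule sum.swap)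
  also have "\<dots> = (\<Sum>e\<in>E. y e * card (e \<inter> D))"
  proof (rule sum.cong)
    fix e
    show "(\<Sum>v\<in>D. if v \<in> e then y e else 0) = y e * card (e \<inter> D)"
      by (simp add: sum.If_cases Int_commute)
  qed simp
  finally show ?thesis ..
qed

lemma card_edge_inter_cover:
  fixes D :: "'x::finite set"
  shows "vertex_cover E D \<Longrightarrow> e \<in> E \<Longrightarrow> card (e \<inter> D) \<ge> 1"
  by (auto simp: vertex_cover_def Suc_le_eq card_gt_0_iff)

text \<open>
  Any edge of a maximum packing for the constant weight \<open>1\<close> will do. If a minimal cover had two vertices
  in it, double counting would give this cover more vertices than there are packed edges, and hence more
  than some other minimal cover.
\<close>

lemma ex_edge_meeting_minimal_covers_once:
  fixes E :: "'x::finite set set"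
  assumes "clutter E" "unmixed E" "max_flow_min_cut E"
  shows "\<exists>e0\<in>E. \<forall>D. minimal_vertex_cover E D \<longrightarrow> card (e0 \<inter> D) = 1"
proof -
  obtain y C where y: "\<forall>v. edge_load E y v \<le> 1" and C: "vertex_cover E C" "card C \<le> (\<Sum>e\<in>E. y e)"
    using max_flow_min_cut_packing_cover[OF assms(3), of "\<lambda>_. 1"] by auto
  obtain D0 where D0: "D0 \<subseteq> C" "minimal_vertex_cover E D0" using vertex_cover_contains_minimal[OF C(1)] .
  have "E \<noteq> {}" using assms(1) by (simp add: clutter_def)
  then have "C \<noteq> {}" using C(1) by (auto simp: vertex_cover_def)
  then have "card C \<noteq> 0" by simp
  then have "(\<Sum>e\<in>E. y e) \<noteq> 0" using C(2) by linarith
  then obtain e0 where e0: "e0 \<in> E" "y e0 \<noteq> 0" by (meson sum.neutral)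
  have "card (e0 \<inter> D) = 1" if D: "minimal_vertex_cover E D" for D
  proof (rule ccontr)
    assume neg: "card (e0 \<inter> D) \<noteq> 1"
    have cov: "vertex_cover E D" using D by (simp add: minimal_vertex_cover_def)
    have ge: "card (e \<inter> D) \<ge> 1" if "e \<in> E" for e by (rule card_edge_inter_cover[OF cov that])
    have "(\<Sum>e\<in>E. y e) < (\<Sum>e\<in>E. y e * card (e \<inter> D))"
    proof (rule sum_strict_mono_ex1)
      show "\<forall>e\<in>E. y e \<le> y e * card (e \<inter> D)" using ge by simp
      have "card (e0 \<inter> D) > 1" using ge[OF e0(1)] neg by linarith
      then show "\<exists>e\<in>E. y e < y e * card (e \<inter> D)" using e0 by (intro bexI[of _ e0]) auto
    qed simp
    also have "\<dots> = (\<Sum>v\<in>D. edge_load E y v)" by (rule sum_card_edge_load)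
    also have "\<dots> \<le> (\<Sum>v\<in>D. 1)" using y by (intro sum_mono) blast
    also have "\<dots> = card D" by simp
    also have "\<dots> = card D0" using assms(2) D D0(2) unfolding unmixed_def by blast
    also have "\<dots> \<le> card C" by (rule card_mono) (use D0(1) in auto)
    finally show False using C(2) by simp
  qed
  then show ?thesis using e0(1) by blast
qed

text \<open>
  The exponents of the monomials in $I^k$: those divisible by a product of \<open>k\<close> edge monomials.
\<close>

definition power_exponents :: "'x::finite set set \<Rightarrow> nat \<Rightarrow> ('x \<Rightarrow>\<^sub>0 nat) set" where
  "power_exponents E k = {m. \<exists>y. (\<Sum>e\<in>E. y e) = k \<and> (\<forall>v. edge_load E y v \<le> lookup m v)}"

lemma edge_load_mono: "(\<And>e. e \<in> E \<Longrightarrow> y e \<le> y' e) \<Longrightarrow> edge_load E y v \<le> edge_load E y' v"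
  unfolding edge_load_def by (rule sum_mono) auto

lemma sub_packing:
  fixes E :: "'x::finite set set"
  assumes "k \<le> (\<Sum>e\<in>E. y e)"
  shows "\<exists>y'. (\<forall>e. y' e \<le> y e) \<and> (\<Sum>e\<in>E. y' e) = (k :: nat)"
  using assms
proof (induction "(\<Sum>e\<in>E. y e) - k" arbitrary: y)
  case 0
  then show ?case by (intro exI[of _ y]) simp
next
  case (Suc n)
  then have "(\<Sum>e\<in>E. y e) \<noteq> 0" by linarith
  then obtain e where e: "e \<in> E" "y e \<noteq> 0" by (meson sum.neutral)
  define y1 where "y1 = y(e := y e - 1)"
  have "(\<Sum>e\<in>E. y e) = y e + (\<Sum>e\<in>E - {e}. y e)" using e by (simp add: sum.remove)
  moreover have "(\<Sum>e\<in>E. y1 e) = y1 e + (\<Sum>e\<in>E - {e}. y1 e)" using e by (simp add: sum.remove)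
  moreover have "(\<Sum>e\<in>E - {e}. y1 e) = (\<Sum>e\<in>E - {e}. y e)" by (rule sum.cong) (auto simp: y1_def)
  ultimately have s: "Suc (\<Sum>e\<in>E. y1 e) = (\<Sum>e\<in>E. y e)" using e by (simp add: y1_def)
  then have "n = (\<Sum>e\<in>E. y1 e) - k" "k \<le> (\<Sum>e\<in>E. y1 e)" using Suc.hyps(2) by linarith+
  then obtain y' where y': "\<forall>e. y' e \<le> y1 e" "(\<Sum>e\<in>E. y' e) = k" using Suc.hyps(1) by blast
  have "y' e' \<le> y e'" for e'
    using y'(1)[rule_format, of e'] by (cases "e' = e") (auto simp: y1_def)
  then show ?case using y'(2) by blast
qed

lemma edge_load_upd:
  fixes E :: "'x::finite set set"
  assumes "e \<in> E"
  shows "edge_load E (y(e := Suc (y e))) v = edge_load E y v + (if v \<in> e then 1 else 0)"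
proof (cases "v \<in> e")
  case True
  then have e: "e \<in> {e \<in> E. v \<in> e}" using assms by simp
  have "(\<Sum>x\<in>{e \<in> E. v \<in> e} - {e}. (y(e := Suc (y e))) x) = (\<Sum>x\<in>{e \<in> E. v \<in> e} - {e}. y x)"
    by (rule sum.cong) auto
  then show ?thesis using True sum.remove[OF _ e, of y] sum.remove[OF _ e, of "y(e := Suc (y e))"]
    unfolding edge_load_def by simp
next
  case False
  then show ?thesis unfolding edge_load_def by (auto intro!: sum.cong)
qed

lemma sum_fun_upd_Suc:
  fixes E :: "'x::finite set set"
  assumes "e \<in> E"
  shows "(\<Sum>e'\<in>E. (y(e := Suc (y e))) e') = Suc (\<Sum>e\<in>E. y e)"
proof -
  have "(\<Sum>x\<in>E - {e}. (y(e := Suc (y e))) x) = (\<Sum>x\<in>E - {e}. y x)"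
    by (rule sum.cong) auto
  then show ?thesis using sum.remove[OF _ assms, of y] sum.remove[OF _ assms, of "y(e := Suc (y e))"]
    by simp
qed

text \<open>
  Removing one edge from a packing need not lead to a packing below \<open>m\<close>, as that edge may differ from
  \<open>e0\<close>. Instead a minimal cover of least weight under \<open>m\<close> bounds the packing from above: its weight
  drops by exactly one when the exponent of \<open>e0\<close> is removed.
\<close>

lemma power_exponents_colon:
  fixes E :: "'x::finite set set"
  assumes mf: "max_flow_min_cut E" and e0: "e0 \<in> E" "\<And>D. minimal_vertex_cover E D \<Longrightarrow> card (e0 \<inter> D) = 1"
  shows "{m. m + mchi e0 \<in> power_exponents E (Suc k)} = power_exponents E k"
proof (intro equalityI subsetI)
  fix m assume "m \<in> {m. m + mchi e0 \<in> power_exponents E (Suc k)}"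
  then obtain y where y: "(\<Sum>e\<in>E. y e) = Suc k" "\<forall>v. edge_load E y v \<le> lookup m v + (if v \<in> e0 then 1 else 0)"
    unfolding power_exponents_def by (auto simp: lookup_add)
  obtain y1 C where y1: "\<forall>v. edge_load E y1 v \<le> lookup m v"
    and C: "vertex_cover E C" "(\<Sum>v\<in>C. lookup m v) \<le> (\<Sum>e\<in>E. y1 e)"
    using max_flow_min_cut_packing_cover[OF mf, of "lookup m"] by blast
  obtain D where D: "D \<subseteq> C" "minimal_vertex_cover E D" using vertex_cover_contains_minimal[OF C(1)] .
  have cov: "vertex_cover E D" using D(2) by (simp add: minimal_vertex_cover_def)
  have "Suc k \<le> (\<Sum>e\<in>E. y e * card (e \<inter> D))"
    unfolding y(1)[symmetric] using card_edge_inter_cover[OF cov] by (intro sum_mono) simp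
  also have "\<dots> = (\<Sum>v\<in>D. edge_load E y v)" by (rule sum_card_edge_load)
  also have "\<dots> \<le> (\<Sum>v\<in>D. lookup m v + (if v \<in> e0 then 1 else 0))" using y(2) by (intro sum_mono) blast
  also have "\<dots> = (\<Sum>v\<in>D. lookup m v) + card (e0 \<inter> D)"
    by (simp add: sum.distrib sum.If_cases Int_commute)
  also have "\<dots> \<le> (\<Sum>v\<in>C. lookup m v) + 1"
    using D e0(2)[OF D(2)] by (simp add: sum_mono2)
  finally have "k \<le> (\<Sum>e\<in>E. y1 e)" using C(2) by simp
  then obtain y2 where "\<forall>e. y2 e \<le> y1 e" "(\<Sum>e\<in>E. y2 e) = k" using sub_packing by blast
  then show "m \<in> power_exponents E k"
    unfolding power_exponents_def using y1 edge_load_mono[of E y2 y1] by (auto intro!: exI[of _ y2] intro: le_trans)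
next
  fix m assume "m \<in> power_exponents E k"
  then obtain y where "(\<Sum>e\<in>E. y e) = k" "\<forall>v. edge_load E y v \<le> lookup m v"
    unfolding power_exponents_def by blast
  then show "m \<in> {m. m + mchi e0 \<in> power_exponents E (Suc k)}"
    using sum_fun_upd_Suc[OF e0(1), of y] edge_load_upd[OF e0(1), of y]
    unfolding power_exponents_def by (auto simp: lookup_add intro!: exI[of _ "y(e0 := Suc (y e0))"])
qed

section \<open>Powers of the edge ideal\<close>

lemma upset_power_exponents: "upset (power_exponents E k)"
  unfolding upset_def power_exponents_def
proof (intro ballI allI)
  fix m m' assume "m \<in> {m. \<exists>y. (\<Sum>e\<in>E. y e) = k \<and> (\<forall>v. edge_load E y v \<le> lookup m v)}"
  then obtain y where "(\<Sum>e\<in>E. y e) = k" "\<forall>v. edge_load E y v \<le> lookup m v" by blast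
  then show "m + m' \<in> {m. \<exists>y. (\<Sum>e\<in>E. y e) = k \<and> (\<forall>v. edge_load E y v \<le> lookup m v)}"
    by (auto simp: lookup_add intro!: exI[of _ y] trans_le_add1)
qed

lemma edge_monomial:
  fixes e :: "'x::finite set"
  shows "(\<Prod>v\<in>e. var v) = single (mchi e) (1 :: 'k::field)"
proof (induction e rule: infinite_finite_induct)
  case empty
  have "mchi {} = (0 :: 'x \<Rightarrow>\<^sub>0 nat)" by (rule poly_mapping_eqI) simp
  then show ?case by simp
next
  case (insert v e)
  have "mchi (insert v e) = single v 1 + mchi e"
    using insert.hyps by (intro poly_mapping_eqI) (auto simp: lookup_add lookup_single when_def)
  then show ?case using insert by (simp add: var_def mult_single)
qed simp

lemma mon_ideal_edge_power_mult:
  assumes "f \<in> mon_ideal (power_exponents E a)" "g \<in> mon_ideal (power_exponents E b)"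
  shows "f * g \<in> mon_ideal (power_exponents E (a + b))"
proof -
  have "m + n \<in> power_exponents E (a + b)"
    if mn: "m \<in> power_exponents E a" "n \<in> power_exponents E b" for m n
  proof -
    obtain y where y: "(\<Sum>e\<in>E. y e) = a" "\<forall>v. edge_load E y v \<le> lookup m v"
      using mn(1) unfolding power_exponents_def by blast
    obtain y' where y': "(\<Sum>e\<in>E. y' e) = b" "\<forall>v. edge_load E y' v \<le> lookup n v"
      using mn(2) unfolding power_exponents_def by blast
    have "edge_load E (\<lambda>e. y e + y' e) v = edge_load E y v + edge_load E y' v" for v
      by (simp add: edge_load_def sum.distrib)
    then show ?thesis using y y' unfolding power_exponents_def
      by (auto simp: lookup_add sum.distrib intro!: exI[of _ "\<lambda>e. y e + y' e"] add_mono)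
  qed
  then show ?thesis using assms keys_mult[of f g] unfolding mon_ideal_def by blast
qed

lemma edge_monomial_in_mon_ideal:
  fixes E :: "'x::finite set set"
  assumes "e \<in> E"
  shows "(single (mchi e) 1 :: ('x, 'k::field) mpoly) \<in> mon_ideal (power_exponents E 1)"
proof -
  have "(\<Sum>e'\<in>E. ((\<lambda>_. 0)(e := Suc 0)) e') = 1" using sum_fun_upd_Suc[OF assms, of "\<lambda>_. 0"] by simp
  moreover have "edge_load E ((\<lambda>_. 0)(e := Suc 0)) v \<le> lookup (mchi e) v" for v
    using edge_load_upd[OF assms, of "\<lambda>_. 0" v] by (simp add: edge_load_def)
  ultimately have "mchi e \<in> power_exponents E 1" unfolding power_exponents_def by blast
  then show ?thesis by (simp add: mon_ideal_def)
qed

lemma edge_ideal_subset_mon_ideal: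
  fixes E :: "'x::finite set set"
  shows "(edge_ideal E :: ('x, 'k::field) mpoly set) \<subseteq> mon_ideal (power_exponents E 1)"
  unfolding edge_ideal_def ideal_gen_eq_span
proof (rule ideal.span_minimal)
  show "(\<lambda>e. \<Prod>v\<in>e. var v) ` E \<subseteq> (mon_ideal (power_exponents E 1) :: ('x, 'k) mpoly set)"
    using edge_monomial_in_mon_ideal[of _ E] by (auto simp: edge_monomial)
qed (rule subspace_mon_ideal[OF upset_power_exponents])

text \<open>
  Lists the edges of a packing one by one, so that the definition of the power of an ideal by products of
  sequences applies.
\<close>

lemma power_exponent_factorization:
  fixes E :: "'x::finite set set"
  assumes "m \<in> power_exponents E k"
  shows "\<exists>f m'. (\<forall>i<k. f i \<in> (edge_ideal E :: ('x, 'k::field) mpoly set)) \<and>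
     single m 1 = single m' 1 * (\<Prod>i<k. f i)"
  using assms
proof (induction k arbitrary: m)
  case 0
  then show ?case by (intro exI[of _ "\<lambda>_. 0"] exI[of _ m]) simp
next
  case (Suc k)
  then obtain y where y: "(\<Sum>e\<in>E. y e) = Suc k" "\<And>v. edge_load E y v \<le> lookup m v"
    unfolding power_exponents_def by blast
  then have "(\<Sum>e\<in>E. y e) \<noteq> 0" by simp
  then obtain e where e: "e \<in> E" "y e \<noteq> 0" by (meson sum.neutral)
  define y1 where "y1 = y(e := y e - 1)"
  have y_eq: "y = y1(e := Suc (y1 e))" using e by (auto simp: y1_def)
  have "(\<Sum>e\<in>E. y1 e) = k" using y(1) sum_fun_upd_Suc[OF e(1), of y1] unfolding y_eq[symmetric] by simp
  moreover have le: "edge_load E y1 v + (if v \<in> e then 1 else 0) \<le> lookup m v" for v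
    using y(2)[of v] edge_load_upd[OF e(1), of y1 v] unfolding y_eq[symmetric] by simp
  have "edge_load E y1 v \<le> lookup (m - mchi e) v" for v
    using le[of v] by (simp add: lookup_minus split: if_splits)
  ultimately have "m - mchi e \<in> power_exponents E k" unfolding power_exponents_def by blast
  from Suc.IH[OF this] obtain f m' where f: "\<forall>i<k. f i \<in> (edge_ideal E :: ('x, 'k) mpoly set)"
     "single (m - mchi e) 1 = single m' 1 * (\<Prod>i<k. f i)" by blast
  define f' where "f' = f(k := single (mchi e) 1)"
  have "single (mchi e) 1 \<in> (edge_ideal E :: ('x, 'k) mpoly set)"
    unfolding edge_ideal_def ideal_gen_eq_span edge_monomial using e(1) by (intro ideal.span_base) blast
  then have "\<forall>i<Suc k. f' i \<in> edge_ideal E" using f(1) by (auto simp: f'_def less_Suc_eq)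
  moreover have "(\<Prod>i<Suc k. f' i) = (\<Prod>i<k. f i) * single (mchi e) 1"
    by (simp add: f'_def)
  moreover have "m = m - mchi e + mchi e"
  proof (rule poly_mapping_eqI)
    fix v
    show "lookup m v = lookup (m - mchi e + mchi e) v"
      using le[of v] by (simp add: lookup_add lookup_minus split: if_splits)
  qed
  then have "single m (1 :: 'k) = single (m - mchi e) 1 * single (mchi e) 1"
    by (simp add: mult_single)
  ultimately show ?case using f(2) by (intro exI[of _ f'] exI[of _ m']) (simp add: mult.assoc)
qed

theorem ideal_pow_edge_ideal:
  fixes E :: "'x::finite set set"
  shows "ideal_pow (edge_ideal E :: ('x, 'k::field) mpoly set) k = mon_ideal (power_exponents E k)"
proof (rule equalityI)
  show "ideal_pow (edge_ideal E :: ('x, 'k) mpoly set) k \<subseteq> mon_ideal (power_exponents E k)"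
    unfolding ideal_pow_def ideal_gen_eq_span
  proof (rule ideal.span_minimal)
    have "(\<Prod>i<k. f i) \<in> mon_ideal (power_exponents E k)"
      if "\<forall>i<k. f i \<in> (edge_ideal E :: ('x, 'k) mpoly set)" for f
      using that
    proof (induction k)
      case 0
      then show ?case
        by (auto simp: mon_ideal_def power_exponents_def edge_load_def intro!: exI[of _ "\<lambda>_. 0"])
    next
      case (Suc k)
      then have "(\<Prod>i<k. f i) * f k \<in> mon_ideal (power_exponents E (k + 1))"
        using edge_ideal_subset_mon_ideal by (intro mon_ideal_edge_power_mult) auto
      then show ?case by simp
    qed
    then show "{\<Prod>i<k. f i | f. \<forall>i<k. f i \<in> (edge_ideal E :: ('x, 'k) mpoly set)} \<subseteq> mon_ideal (power_exponents E k)"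
      by blast
  qed (rule subspace_mon_ideal[OF upset_power_exponents])
  show "mon_ideal (power_exponents E k) \<subseteq> ideal_pow (edge_ideal E :: ('x, 'k) mpoly set) k"
  proof
    fix p :: "('x, 'k) mpoly" assume p: "p \<in> mon_ideal (power_exponents E k)"
    have "(\<Sum>m\<in>keys p. single m (lookup p m)) \<in> ideal_pow (edge_ideal E) k"
      unfolding ideal_pow_def ideal_gen_eq_span
    proof (rule ideal.span_sum)
      fix m assume "m \<in> keys p"
      then have "m \<in> power_exponents E k" using p unfolding mon_ideal_def by blast
      from power_exponent_factorization[OF this, where 'k='k]
      obtain f m' where f: "\<forall>i<k. f i \<in> (edge_ideal E :: ('x, 'k) mpoly set)"
        "single m 1 = single m' 1 * (\<Prod>i<k. f i)" by blast
      have "single m (lookup p m) =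
          single 0 (lookup p m) * single m 1"
        by (simp add: mult_single)
      also have "\<dots> = (single 0 (lookup p m) * single m' 1) * (\<Prod>i<k. f i)"
        by (simp only: f(2) mult.assoc)
      also have "\<dots> \<in> ideal.span {\<Prod>i<k. f i | f. \<forall>i<k. f i \<in> (edge_ideal E :: ('x, 'k) mpoly set)}"
        using f(1) by (intro ideal.span_scale ideal.span_base) blast
      finally show "single m (lookup p m) \<in>
        ideal.span {\<Prod>i<k. f i | f. \<forall>i<k. f i \<in> (edge_ideal E :: ('x, 'k) mpoly set)}" .
    qed
    then show "p \<in> ideal_pow (edge_ideal E) k" by (simp flip: poly_mapping_sum_singles)
  qed
qed

lemma zero_notin_power_exponents:
  fixes E :: "'x::finite set set"
  assumes "clutter E" "k \<ge> 1"
  shows "0 \<notin> power_exponents E k"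
proof
  assume "0 \<in> power_exponents E k"
  then obtain y where y: "(\<Sum>e\<in>E. y e) = k" "\<forall>v. edge_load E y v = 0"
    unfolding power_exponents_def by auto
  have "(\<Sum>e\<in>E. y e) \<noteq> 0" using y(1) assms(2) by simp
  then obtain e where e: "e \<in> E" "y e \<noteq> 0" by (meson sum.neutral)
  then have "e \<noteq> {}" using assms(1) unfolding clutter_def by blast
  then obtain v where v: "v \<in> e" by blast
  have "y e = 0" using y(2)[rule_format, of v] e(1) v by (auto simp: edge_load_def)
  with e(2) show False by simp
qed

lemma upset_colon: "upset U \<Longrightarrow> upset {m. m + n \<in> U}"
  unfolding upset_def
proof (intro ballI allI)
  fix m m' assume U: "\<forall>m\<in>U. \<forall>m'. m + m' \<in> U" and "m \<in> {m. m + n \<in> U}"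
  then have "m + n + m' \<in> U" by simp
  then show "m + m' \<in> {m. m + n \<in> U}" by (simp add: algebra_simps)
qed

text \<open>
  Taking the colon by a squarefree monomial is taking it by its variables in turn.
\<close>

lemma koszul_nonzero_colon:
  fixes U :: "('x::finite \<Rightarrow>\<^sub>0 nat) set"
  assumes "upset U" "koszul_nonzero TYPE('k::field) {m. m + mchi F \<in> U} i a"
  shows "\<exists>a'. mdeg a \<le> mdeg a' \<and> koszul_nonzero TYPE('k) U i a'"
proof -
  have "finite F" by simp
  then show ?thesis using assms(2)
  proof (induction F arbitrary: a)
    case empty
    have "mchi {} = (0 :: 'x \<Rightarrow>\<^sub>0 nat)" by (rule poly_mapping_eqI) simp
    then show ?case using empty by auto
  next
    case (insert v F)
    let ?U = "{m. m + mchi F \<in> U}"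
    have "mchi (insert v F) = single v 1 + mchi F"
      using insert.hyps by (intro poly_mapping_eqI) (auto simp: lookup_add lookup_single when_def)
    then have "koszul_nonzero TYPE('k) {m. m + single v 1 \<in> ?U} i a"
      using insert.prems by (simp add: add.assoc)
    then have "koszul_nonzero TYPE('k) ?U i a \<or> koszul_nonzero TYPE('k) ?U i (a + single v 1)"
      by (rule koszul_nonzero_colon_var[OF upset_colon[OF assms(1)]])
    then show ?case
    proof
      assume "koszul_nonzero TYPE('k) ?U i a"
      then show ?thesis by (rule insert.IH)
    next
      assume "koszul_nonzero TYPE('k) ?U i (a + single v 1)"
      from insert.IH[OF this] obtain a' where
        "mdeg (a + single v 1) \<le> mdeg a'" "koszul_nonzero TYPE('k) U i a'" by blast
      then show ?thesis by (intro exI[of _ a']) (simp add: mdeg_add)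
    qed
  qed
qed

lemma koszul_vanish_mon_ideal_iff:
  fixes U :: "('x::finite \<Rightarrow>\<^sub>0 nat) set"
  shows "koszul_vanish (mon_ideal U :: ('x, 'k::field) mpoly set) d \<longleftrightarrow>
    (\<forall>i a. i + d > CARD('x) \<longrightarrow> \<not> koszul_nonzero TYPE('k) U i a)"
proof
  assume Q: "koszul_vanish (mon_ideal U :: ('x, 'k) mpoly set) d"
  show "\<forall>i a. i + d > CARD('x) \<longrightarrow> \<not> koszul_nonzero TYPE('k) U i a"
  proof (intro allI impI notI)
    fix i a assume i: "i + d > CARD('x)" and nv: "koszul_nonzero TYPE('k) U i a"
    obtain z :: "'x set \<Rightarrow> ('x, 'k) mpoly" where z: "kchain i z" "\<And>G. keys (kbd var z G) \<subseteq> U"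
      and n: "\<And>w. \<exists>F. \<not> keys (z F - kbd var w F) \<subseteq> U"
      using koszul_nonzero_imp_nonboundary[OF nv] by metis
    have "\<forall>G. kbd var z G \<in> mon_ideal U" using z(2) by (simp add: mon_ideal_def)
    then obtain w where w: "\<forall>F. z F - kbd var w F \<in> mon_ideal U"
      using Q i z(1) unfolding koszul_vanish_def by blast
    obtain F where "\<not> keys (z F - kbd var w F) \<subseteq> U" using n by blast
    then show False using w by (simp add: mon_ideal_def)
  qed
next
  assume n: "\<forall>i a. i + d > CARD('x) \<longrightarrow> \<not> koszul_nonzero TYPE('k) U i a"
  show "koszul_vanish (mon_ideal U :: ('x, 'k) mpoly set) d"
    unfolding koszul_vanish_def mon_ideal_def mem_Collect_eq
  proof (intro allI impI)
    fix i and z :: "'x set \<Rightarrow> ('x, 'k) mpoly"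
    assume "i + d > CARD('x)" "kchain i z" "\<forall>G. keys (kbd var z G) \<subseteq> U"
    then show "\<exists>w. \<forall>F. keys (z F - kbd var w F) \<subseteq> U"
      using n by (intro koszul_zero_imp_boundary[of i]) auto
  qed
qed

theorem theorem4p9:
  fixes E :: "'x::finite set set"
    and I :: "('x, 'k::field) mpoly set"
  assumes "clutter E"
    and "I = edge_ideal E"
    and "unmixed E"
    and "max_flow_min_cut E"
  shows "(\<forall>k\<ge>1. quot_depth (ideal_pow I k) \<ge> quot_depth (ideal_pow I (k + 1))) \<and>
         (\<forall>k\<ge>1. quot_reg (ideal_pow I k) \<le> quot_reg (ideal_pow I (k + 1)))"
proof -
  obtain e0 where e0: "e0 \<in> E" "\<forall>D. minimal_vertex_cover E D \<longrightarrow> card (e0 \<inter> D) = 1"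
    using ex_edge_meeting_minimal_covers_once[OF assms(1,3,4)] by blast
  define U where "U k = power_exponents E k" for k
  have up: "upset (U k)" for k unfolding U_def by (rule upset_power_exponents)
  have U0: "0 \<notin> U k" if "k \<ge> 1" for k
    unfolding U_def by (rule zero_notin_power_exponents[OF assms(1) that])
  have pow: "ideal_pow I k = mon_ideal (U k)" for k
    unfolding U_def assms(2) by (rule ideal_pow_edge_ideal)
  have colon: "{m. m + mchi e0 \<in> U (k + 1)} = U k" for k
    using power_exponents_colon[OF assms(4) e0(1), of k] e0(2) by (simp add: U_def)
  have transfer: "\<exists>a'. mdeg a \<le> mdeg a' \<and> koszul_nonzero TYPE('k) (U (k + 1)) i a'"
    if "koszul_nonzero TYPE('k) (U k) i a" for k i a
    using koszul_nonzero_colon[OF up[of "k + 1"], of e0 i a, where 'k='k] that unfolding colon by blast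
  have "quot_depth (ideal_pow I (k + 1)) \<le> quot_depth (ideal_pow I k)" if "k \<ge> 1" for k
    unfolding pow
  proof (rule quot_depth_mono)
    show "koszul_vanish (mon_ideal (U k) :: ('x, 'k) mpoly set) d"
      if "koszul_vanish (mon_ideal (U (k + 1)) :: ('x, 'k) mpoly set) d" for d
      using that transfer unfolding koszul_vanish_mon_ideal_iff by blast
  qed (use subspace_mon_ideal[OF up] mon_ideal_subset_max_ideal[OF U0[OF that]] in blast)+
  moreover have "quot_reg (ideal_pow I k) \<le> quot_reg (ideal_pow I (k + 1))" if k: "k \<ge> 1" for k
    unfolding pow quot_reg_def
  proof (rule SUP_mono)
    fix ij assume "ij \<in> {(i, j). quot_betti (mon_ideal (U k) :: ('x, 'k) mpoly set) i j \<noteq> 0}"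
    then obtain i j where ij: "ij = (i, j)" "quot_betti (mon_ideal (U k) :: ('x, 'k) mpoly set) i j \<noteq> 0" by blast
    then obtain a where a: "mdeg a = j" "koszul_nonzero TYPE('k) (U k) i a"
      unfolding quot_betti_nonzero_iff[OF up U0[OF k]] by blast
    then obtain a' where a': "mdeg a \<le> mdeg a'" "koszul_nonzero TYPE('k) (U (k + 1)) i a'" using transfer by blast
    have "0 \<notin> U (k + 1)" by (rule U0) simp
    then have "quot_betti (mon_ideal (U (k + 1)) :: ('x, 'k) mpoly set) i (mdeg a') \<noteq> 0"
      using quot_betti_nonzero_iff[OF up] a'(2) by blast
    then show "\<exists>y\<in>{(i, j). quot_betti (mon_ideal (U (k + 1)) :: ('x, 'k) mpoly set) i j \<noteq> 0}.
        (case ij of (i, j) \<Rightarrow> ereal (real j - real i)) \<le> (case y of (i, j) \<Rightarrow> ereal (real j - real i))"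
      using a(1) a'(1) ij(1) by (intro bexI[of _ "(i, mdeg a')"]) auto
  qed
  ultimately show ?thesis by blast
qed

end
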